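(* Let $q=p^f$ be a power of a prime $p$ (with $f\ge 1$), and set $$\varepsilon_q=\begin{cases}\frac{4}{3}&\text{if } p=2 \text{ and } f \text{ is even},\\ \frac{p}{p-1}&\text{if } p \text{ is a Fermat prime},\\ 1&\text{otherwise.}\end{cases}$$ Then there are infinitely many positive integers $d$ for which there exists an irreducible subgroup $G$ of $\mathrm{GL}(d,q)$ with $$c_p(G)=\frac{\varepsilon_q d-1}{p-1}.$$
   Context: For a finite group $G$ and a prime $p$, $c_p(G)$ denotes the number of composition factors of $G$ of order $p$ (counted with multiplicity in a composition series). A Fermat prime is a prime of the form $2^{2^n}+1$ for some integer $n\ge 0$. A subgroup of $\mathrm{GL}(d,q)$ is irreducible if it acts irreducibly on $(\mathbb{F}_q)^d$. *)

theory Defs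
  imports
    "HOL-Library.Cardinality"
    "HOL-Algebra.SimpleGroups"
    "Jordan_Normal_Form.VS_Connect"
begin

definition GL :: "'a::field itself \<Rightarrow> nat \<Rightarrow> 'a mat monoid" where
  "GL ty d = units_of (ring_mat ty d ())"

text \<open>The zero space does not count as irreducible; hence the condition \<open>d \<noteq> 0\<close>.\<close>

definition irreducible_linear_group :: "'a::field itself \<Rightarrow> nat \<Rightarrow> 'a mat set \<Rightarrow> bool" where
  "irreducible_linear_group ty d G \<longleftrightarrow>
     subgroup G (GL ty d) \<and> d \<noteq> 0 \<and>
     (\<forall>W. VectorSpace.subspace class_ring W (module_vec ty d) \<and>
          (\<forall>g\<in>G. \<forall>w\<in>W. g *\<^sub>v w \<in> W) \<longrightarrow>
          W = {0\<^sub>v d} \<or> W = carrier_vec d)"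

definition series_factor :: "('a, 'b) monoid_scheme \<Rightarrow> 'a set list \<Rightarrow> nat \<Rightarrow> 'a set monoid" where
  "series_factor G H i = (G\<lparr>carrier := H ! Suc i\<rparr>) Mod (H ! i)"

definition composition_series :: "('a, 'b) monoid_scheme \<Rightarrow> 'a set list \<Rightarrow> bool" where
  "composition_series G H \<longleftrightarrow>
     H \<noteq> [] \<and> hd H = {\<one>\<^bsub>G\<^esub>} \<and> last H = carrier G \<and>
     (\<forall>i < length H - 1.
        (H ! i) \<lhd> (G\<lparr>carrier := H ! Suc i\<rparr>) \<and> simple_group (series_factor G H i))"

text \<open>
  A finite group has a composition series, and by the Jordan--Hoelder theorem the count does not
  depend on the one that is chosen.
\<close>

definition num_comp_factors :: "nat \<Rightarrow> ('a, 'b) monoid_scheme \<Rightarrow> nat" where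
  "num_comp_factors p G =
     (let H = (SOME H. composition_series G H)
      in card {i. i < length H - 1 \<and> Coset.order (series_factor G H i) = p})"

definition fermat_prime :: "nat \<Rightarrow> bool" where
  "fermat_prime p \<longleftrightarrow> prime p \<and> (\<exists>n. p = 2 ^ (2 ^ n) + 1)"

text \<open>\<open>eps p f\<close> is the constant belonging to \<open>q = p ^ f\<close>.\<close>

definition eps :: "nat \<Rightarrow> nat \<Rightarrow> real" where
  "eps p f =
     (if p = 2 \<and> even f then 4 / 3
      else if fermat_prime p then real p / (real p - 1)
      else 1)"

end

theory Submission
  imports Defs "HOL-Algebra.Sylow" "HOL-Algebra.Group_Action" "HOL-Number_Theory.Residues"
begin

text \<open>
  If \<open>G \<le> GL(d, q)\<close> is irreducible and nontrivial, then so is the wreath product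
  \<open>G wr C\<^sub>p \<le> GL(p d, q)\<close>, and \<open>c\<^sub>p\<close> passes from \<open>k\<close> to \<open>p k + 1\<close>. The equation
  \<open>(p - 1) k + 1 = \<epsilon> d\<close> is preserved, so it suffices to find one group satisfying it:

  \<^item> the scalars in dimension \<open>1\<close> if \<open>\<epsilon> = 1\<close> and \<open>q > 2\<close>, and \<open>GL(2, 2)\<close> if \<open>q = 2\<close>;
  \<^item> otherwise, an extension by a \<open>p\<close>-group of a group \<open>E\<close> of scalar multiples of Weyl operators
    (for \<open>p = 3\<close>, of quaternion units), where \<open>d = p - 1\<close> and \<open>k = 1\<close> for a Fermat prime \<open>p\<close>, and
    \<open>d = 3\<close> and \<open>k = 3\<close> for \<open>p = 2\<close>. Let \<open>r\<close> be the prime divisor of \<open>d\<close>. The normalizer of \<open>E\<close> is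
    transitive on the \<open>r (d\<^sup>2 - 1)\<close> nonscalar elements of \<open>E\<close> with a suitable fixed \<open>r\<close>-th power, so
    \<open>p\<^sup>k\<close> divides its order.

  All these groups are \<open>p\<close>-solvable in the sense that a simple section has order \<open>p\<close> or an order
  prime to \<open>p\<close>. Therefore every composition series has \<open>v\<^sub>p(|G|)\<close> factors of order \<open>p\<close>, and the
  Jordan--Hoelder theorem is not needed.
\<close>

section \<open>\<open>p\<close>-solvable groups\<close>

text \<open>The constant is the ratio \<open>((p - 1) * k + 1) / d\<close> of the base group. Ratio
  1 comes from \<open>k = 0\<close> in dimension 1, or from \<open>k = 1\<close> in dimension 2 if
  \<open>q = 2\<close>. A larger ratio needs many factors of order \<open>p\<close> in a small
  dimension. For a Fermat prime, \<open>d = p - 1\<close> is a power of two and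
  \<open>d * d - 1 = p * (p - 2)\<close>; for \<open>p = 2\<close> and \<open>d = 3\<close> the
  orbit has \<open>3 * 8 = 24\<close> elements. This yields the ratios \<open>p / (p - 1)\<close>
  and \<open>4 / 3\<close>. The parity of \<open>f\<close> matters because Weyl operators in
  dimension 3 require a cube root of unity in the field. For \<open>p = 3\<close> a square root of
  \<open>-1\<close> may be absent, but quaternion units have square \<open>-1\<close> anyway.

  The obstacle is a lower bound for the normalizer of \<open>E\<close> that avoids symplectic groups
  and their representations. Two noncommuting roots \<open>s\<close> and \<open>t\<close> have an
  explicit intertwining matrix, a polynomial in both, and a commuting pair is joined through a third
  root. Transitivity thus reduces to matrix identities, and the orbit-stabilizer theorem gives the
  divisibility.\<close>

definition p_solvable :: "'s itself \<Rightarrow> nat \<Rightarrow> ('a, 'b) monoid_scheme \<Rightarrow> bool" where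
  "p_solvable ty p G \<longleftrightarrow>
     (\<forall>B (S :: 's monoid) \<psi>. subgroup B G \<longrightarrow> simple_group S \<longrightarrow> \<psi> \<in> hom (G\<lparr>carrier := B\<rparr>) S \<longrightarrow>
        \<psi> ` B = carrier S \<longrightarrow> Coset.order S = p \<or> \<not> p dvd Coset.order S)"

lemma (in group_hom) order_kernel_image:
  "Coset.order G = card (kernel G H h) * card (h ` carrier G)"
proof -
  let ?H = "H\<lparr>carrier := h ` carrier G\<rparr>"
  interpret I: group ?H
    by (simp add: H.subgroup_imp_group img_is_subgroup)
  interpret K: group_hom G ?H h
    by unfold_locales (auto simp: hom_def)
  have k: "kernel G ?H h = kernel G H h"
    by (simp add: kernel_def)
  have "card (carrier (G Mod kernel G ?H h)) = card (h ` carrier G)"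
    using iso_same_card[OF K.FactGroup_iso] by simp
  moreover have "card (rcosets (kernel G H h)) * card (kernel G H h) = Coset.order G"
    by (rule G.lagrange[OF subgroup_kernel])
  ultimately show ?thesis
    unfolding k FactGroup_def by (simp add: mult.commute)
qed

lemma (in group_hom) order_image_dvd: "card (h ` carrier G) dvd Coset.order G"
  by (simp add: order_kernel_image)

text \<open>If \<open>\<psi>\<close> maps \<open>B\<close> onto a simple group, the image of \<open>B \<inter> ker h\<close> is normal, hence everything or
  trivial; in the second case \<open>\<psi>\<close> factors through \<open>h\<close>.\<close>

lemma (in group_hom) p_solvable_extension:
  assumes ker: "p_solvable TYPE('s) p (G\<lparr>carrier := kernel G H h\<rparr>)"
    and img: "p_solvable TYPE('s) p H"
  shows "p_solvable TYPE('s) p G"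
  unfolding p_solvable_def
proof (intro allI impI)
  fix B and S :: "'s monoid" and \<psi>
  assume B: "subgroup B G" and S: "simple_group S"
    and \<psi>: "\<psi> \<in> hom (G\<lparr>carrier := B\<rparr>) S" and onto: "\<psi> ` B = carrier S"
  interpret S: simple_group S by fact
  interpret B: subgroup B G by fact
  let ?B = "G\<lparr>carrier := B\<rparr>"
  interpret GB: group ?B by (rule G.subgroup_imp_group[OF B])
  interpret P: group_hom ?B S \<psi>
    using \<psi> by unfold_locales
  interpret hB: group_hom ?B H h
    by (rule induced_group_hom'[OF B])
  let ?K = "kernel ?B H h"
  have KB: "?K \<lhd> ?B" by (rule hB.normal_kernel)
  have "\<psi> ` ?K \<lhd> S"
    by (rule normal.surj_hom_normal_subgroup[OF KB P.group_hom_axioms]) (simp add: onto)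
  then consider "\<psi> ` ?K = carrier S" | "\<psi> ` ?K = {\<one>\<^bsub>S\<^esub>}"
    using S.no_real_normal_subgroup by blast
  then show "Coset.order S = p \<or> \<not> p dvd Coset.order S"
  proof cases
    case 1
    have "subgroup ?K G"
      using G.incl_subgroup[OF B] KB normal_imp_subgroup by blast
    moreover have sub: "?K \<subseteq> kernel G H h"
      using B.subset by (auto simp: kernel_def)
    ultimately have "subgroup ?K (G\<lparr>carrier := kernel G H h\<rparr>)"
      using G.subgroup_incl subgroup_kernel by blast
    moreover have "\<psi> \<in> hom (G\<lparr>carrier := kernel G H h, carrier := ?K\<rparr>) S"
      using \<psi> by (auto simp: hom_def kernel_def Pi_def)
    ultimately show ?thesis
      using ker S 1 unfolding p_solvable_def by blast
  next
    case 2
    have eq: "\<psi> x = \<psi> y" if "x \<in> B" "y \<in> B" "h x = h y" for x y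
    proof -
      have "x \<otimes> inv y \<in> ?K"
        using that by (simp add: kernel_def)
      then have "\<psi> (x \<otimes> inv y) = \<one>\<^bsub>S\<^esub>" using 2 by blast
      moreover have "\<psi> (x \<otimes> inv y) \<otimes>\<^bsub>S\<^esub> \<psi> y = \<psi> x"
        using that P.hom_mult[of "x \<otimes> inv y" y] by (simp add: G.m_assoc)
      ultimately show ?thesis
        using that P.hom_closed by auto
    qed
    define \<theta> where "\<theta> z = \<psi> (SOME b. b \<in> B \<and> h b = z)" for z
    have \<theta>: "\<theta> (h b) = \<psi> b" if "b \<in> B" for b
    proof -
      let ?c = "SOME c. c \<in> B \<and> h c = h b"
      have "?c \<in> B \<and> h ?c = h b" by (rule someI) (use that in auto)
      then show ?thesis unfolding \<theta>_def using eq that by blast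
    qed
    have "subgroup (h ` B) H" by (rule subgroup_img_is_subgroup[OF B])
    moreover have "\<theta> \<in> hom (H\<lparr>carrier := h ` B\<rparr>) S"
    proof (rule homI)
      show "\<theta> x \<in> carrier S" if "x \<in> carrier (H\<lparr>carrier := h ` B\<rparr>)" for x
        using that \<theta> P.hom_closed by auto
      show "\<theta> (x \<otimes>\<^bsub>H\<lparr>carrier := h ` B\<rparr>\<^esub> y) = \<theta> x \<otimes>\<^bsub>S\<^esub> \<theta> y"
        if xy: "x \<in> carrier (H\<lparr>carrier := h ` B\<rparr>)" "y \<in> carrier (H\<lparr>carrier := h ` B\<rparr>)" for x y
      proof -
        obtain a b where ab: "a \<in> B" "b \<in> B" "x = h a" "y = h b" using xy by auto
        then have "x \<otimes>\<^bsub>H\<^esub> y = h (a \<otimes> b)" by simp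
        then have "\<theta> (x \<otimes>\<^bsub>H\<^esub> y) = \<psi> (a \<otimes> b)" using ab \<theta>[of "a \<otimes> b"] by simp
        then show ?thesis using ab P.hom_mult[of a b] \<theta> by simp
      qed
    qed
    moreover have "\<theta> ` (h ` B) = carrier S"
      unfolding onto[symmetric] image_image using \<theta> by (intro image_cong) auto
    ultimately show ?thesis
      using img S unfolding p_solvable_def by blast
  qed
qed

lemma p_solvable_hom:
  fixes G :: "('a, 'b) monoid_scheme"
  assumes "group G" and "group H" and "h \<in> hom G H"
    and "p_solvable TYPE('s) p (G\<lparr>carrier := kernel G H h\<rparr>)" and "p_solvable TYPE('s) p H"
  shows "p_solvable TYPE('s) p G"
  using assms group_hom.p_solvable_extension[of G H h]
  by (simp add: group_hom_def group_hom_axioms_def)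

lemma order_simple_quotient_dvd:
  assumes "group G" "subgroup B G" "group S" "\<psi> \<in> hom (G\<lparr>carrier := B\<rparr>) S" "\<psi> ` B = carrier S"
  shows "Coset.order S dvd Coset.order G"
proof -
  interpret group_hom "G\<lparr>carrier := B\<rparr>" S \<psi>
    using assms by (simp add: group_hom_def group_hom_axioms_def group.subgroup_imp_group)
  have "Coset.order S dvd card B"
    using order_image_dvd assms(5) by (simp add: Coset.order_def)
  also have "card B dvd Coset.order G"
    using group.lagrange[OF assms(1,2)] by (metis dvd_triv_right)
  finally show ?thesis .
qed

lemma p_solvable_coprime:
  assumes "group G" "\<not> p dvd Coset.order G"
  shows "p_solvable TYPE('s) p G"
  unfolding p_solvable_def
  using order_simple_quotient_dvd[OF assms(1)] assms(2) dvd_trans simple_group.axioms(1) by metis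

lemma p_solvable_prime_order:
  assumes "group G" "Coset.order G = p"
  shows "p_solvable TYPE('s) p G"
  unfolding p_solvable_def
proof (intro allI impI)
  fix B and S :: "'s monoid" and \<psi>
  assume *: "subgroup B G" "simple_group S" "\<psi> \<in> hom (G\<lparr>carrier := B\<rparr>) S" "\<psi> ` B = carrier S"
  have "Coset.order S dvd p"
    using order_simple_quotient_dvd[OF assms(1) *(1) simple_group.axioms(1)[OF *(2)] *(3,4)] assms(2)
    by simp
  then show "Coset.order S = p \<or> \<not> p dvd Coset.order S"
    using dvd_antisym by blast
qed

section \<open>Subgroups of index two and simple groups of small order\<close>

lemma (in group) index_two_normal:
  assumes "finite (carrier G)" "subgroup H G" "Coset.order G = 2 * card H"
  shows "H \<lhd> G"
proof (rule normalI[OF assms(2)], intro ballI)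
  fix x assume x: "x \<in> carrier G"
  interpret subgroup H G by fact
  have fin: "finite H" using assms(1) subset finite_subset by blast
  \<comment> \<open>Both cosets of an element outside \<open>H\<close> avoid \<open>H\<close> and
    have \<open>card H\<close> elements, the size of the complement. Hence both are the
    complement.\<close>
  have compl: "A = carrier G - H" if "A \<subseteq> carrier G - H" "card A = card H" for A
  proof (rule card_subset_eq[OF _ that(1)])
    show "finite (carrier G - H)" using assms(1) by simp
    show "card A = card (carrier G - H)"
      using assms(3) that(2) card_Diff_subset[OF fin subset] by (simp add: Coset.order_def)
  qed
  show "H #> x = x <# H"
  proof (cases "x \<in> H")
    case True
    then show ?thesis
      using coset_join2[OF x assms(2)] coset_join3[OF x assms(2)] by simp
  next
    case False
    have "H #> x \<subseteq> carrier G - H"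
    proof -
      have "h \<otimes> x \<notin> H" if "h \<in> H" for h
      proof
        assume "h \<otimes> x \<in> H"
        then have "inv h \<otimes> (h \<otimes> x) \<in> H" using that by blast
        then show False using False x that by (simp add: m_assoc[symmetric])
      qed
      then show ?thesis using x by (auto simp: r_coset_def)
    qed
    moreover have "card (H #> x) = card H"
      using card_rcosets_equal[OF rcosetsI[OF subset x] subset] by simp
    ultimately have 1: "H #> x = carrier G - H" by (rule compl)
    have "x <# H \<subseteq> carrier G - H"
    proof -
      have "x \<otimes> h \<notin> H" if "h \<in> H" for h
      proof
        assume "x \<otimes> h \<in> H"
        then have "(x \<otimes> h) \<otimes> inv h \<in> H" using that by blast
        then show False using False x that by (simp add: m_assoc)
      qed
      then show ?thesis using x by (auto simp: l_coset_def)
    qed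
    moreover have "card (x <# H) = card H"
    proof -
      have "x <# H = (\<lambda>h. x \<otimes> h) ` H" by (auto simp: l_coset_def)
      moreover have "inj_on (\<lambda>h. x \<otimes> h) H"
        using x subset by (auto simp: inj_on_def)
      ultimately show ?thesis by (simp add: card_image)
    qed
    ultimately have "x <# H = carrier G - H" by (rule compl)
    with 1 show ?thesis by simp
  qed
qed

text \<open>A subgroup of index two is normal, and by its size it is not the whole group, so
  simplicity makes it trivial.\<close>

lemma simple_group_index_two:
  assumes "simple_group G" "subgroup H G" "Coset.order G = 2 * card H"
  shows "Coset.order G = 2"
proof -
  interpret simple_group G by fact
  have fin: "finite (carrier G)"
    using order_gt_one by (metis card.infinite not_one_less_zero Coset.order_def)
  have "H \<lhd> G" by (rule index_two_normal[OF fin assms(2,3)])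
  then have "H = carrier G \<or> H = {\<one>\<^bsub>G\<^esub>}" by (rule no_real_normal_subgroup)
  then show ?thesis
    using assms(3) order_gt_one by (auto simp: Coset.order_def)
qed

text \<open>A simple quotient of order \<open>2 ^ Suc i\<close> has by Sylow a subgroup of order
  \<open>2 ^ i\<close>. Its index is two, so the quotient has order 2.\<close>

lemma p_solvable_two_power_order:
  fixes G :: "('a, 'b) monoid_scheme"
  assumes "group G" "Coset.order G = 2 ^ c"
  shows "p_solvable TYPE('s) 2 G"
  unfolding p_solvable_def
proof (intro allI impI)
  fix B and S :: "'s monoid" and \<psi>
  assume *: "subgroup B G" "simple_group S" "\<psi> \<in> hom (G\<lparr>carrier := B\<rparr>) S" "\<psi> ` B = carrier S"
  interpret S: simple_group S by fact
  have "Coset.order S dvd 2 ^ c"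
    using order_simple_quotient_dvd[OF assms(1) *(1) S.is_group *(3,4)] assms(2) by simp
  then obtain j where j: "Coset.order S = 2 ^ j"
    by (metis divides_primepow_nat two_is_prime_nat)
  then obtain i where i: "j = Suc i"
    using S.order_gt_one by (cases j) auto
  have "finite (carrier S)"
    using S.order_gt_one by (metis card.infinite not_one_less_zero Coset.order_def)
  then obtain H where "subgroup H S" "card H = 2 ^ i"
    using sylow_thm[of 2 S i 2] S.is_group j i by auto
  then have "Coset.order S = 2"
    using simple_group_index_two[OF *(2)] j i by simp
  then show "Coset.order S = 2 \<or> \<not> 2 dvd Coset.order S" ..
qed

text \<open>For \<open>GL(2, 2)\<close>. The order of a simple quotient is 2, 3 or 6, and 6 is
  excluded because a Sylow 3-subgroup would have index two.\<close>

lemma p_solvable_order_six: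
  fixes G :: "('a, 'b) monoid_scheme"
  assumes "group G" "Coset.order G = 6"
  shows "p_solvable TYPE('s) 2 G"
  unfolding p_solvable_def
proof (intro allI impI)
  fix B and S :: "'s monoid" and \<psi>
  assume *: "subgroup B G" "simple_group S" "\<psi> \<in> hom (G\<lparr>carrier := B\<rparr>) S" "\<psi> ` B = carrier S"
  interpret S: simple_group S by fact
  have d: "Coset.order S dvd 6"
    using order_simple_quotient_dvd[OF assms(1) *(1) S.is_group *(3,4)] assms(2) by simp
  then have "Coset.order S \<le> 6" by (rule dvd_imp_le) simp
  then have "Coset.order S \<in> {0, 1, 2, 3, 4, 5, 6}" by auto
  then have "Coset.order S = 2 \<or> Coset.order S = 3 \<or> Coset.order S = 6"
    using d S.order_gt_one by auto
  moreover have "Coset.order S \<noteq> 6"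
  proof
    assume 6: "Coset.order S = 6"
    then have "finite (carrier S)"
      by (metis card.infinite Coset.order_def zero_neq_numeral)
    then obtain H where "subgroup H S" "card H = 3"
      using sylow_thm[of 3 S 1 2] S.is_group 6 by auto
    then have "Coset.order S = 2"
      using simple_group_index_two[OF *(2)] 6 by simp
    with 6 show False by simp
  qed
  ultimately show "Coset.order S = 2 \<or> \<not> 2 dvd Coset.order S" by auto
qed

section \<open>Normal subgroups and jointly injective families of homomorphisms\<close>

lemma p_solvable_normal_quotient:
  fixes G :: "('a, 'b) monoid_scheme"
  assumes "group G" "N \<lhd> G" "p_solvable TYPE('s) p (G\<lparr>carrier := N\<rparr>)"
    "p_solvable TYPE('s) p (G Mod N)"
  shows "p_solvable TYPE('s) p G"
proof -
  interpret group G by fact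
  interpret normal N G by fact
  have "kernel G (G Mod N) (\<lambda>a. N #>\<^bsub>G\<^esub> a) = N"
  proof (rule Set.set_eqI)
    show "x \<in> kernel G (G Mod N) (\<lambda>a. N #>\<^bsub>G\<^esub> a) \<longleftrightarrow> x \<in> N" for x
      using coset_join1[of N x] coset_join2[of x N] subgroup_axioms subset by (auto simp: kernel_def)
  qed
  then show ?thesis
    using p_solvable_hom[OF is_group factorgroup_is_group r_coset_hom_Mod, where 's='s] assms by simp
qed

text \<open>A substitute for an embedding into the direct power of \<open>H\<close>. The common
  kernels \<open>K j\<close> of the first \<open>j\<close> maps descend from the whole group to the
  trivial one, and \<open>\<phi> j\<close> embeds \<open>K j\<close> modulo \<open>K (Suc j)\<close>
  into \<open>H\<close>. The image may be a proper subgroup, which is covered because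
  \<open>p_solvable\<close> quantifies over all subgroups of \<open>H\<close>.\<close>

lemma p_solvable_jointly_injective:
  fixes G :: "('a, 'b) monoid_scheme" and k :: nat
  assumes G: "group G" and H: "group H" "p_solvable TYPE('s) p H"
    and hom: "\<And>i. i < k \<Longrightarrow> \<phi> i \<in> hom G H"
    and inj: "\<And>x. x \<in> carrier G \<Longrightarrow> (\<And>i. i < k \<Longrightarrow> \<phi> i x = \<one>\<^bsub>H\<^esub>) \<Longrightarrow> x = \<one>\<^bsub>G\<^esub>"
    and p: "prime p"
  shows "p_solvable TYPE('s) p G"
proof -
  interpret G: group G by fact
  interpret H: group H by fact
  define K where "K j = {x \<in> carrier G. \<forall>i<j. \<phi> i x = \<one>\<^bsub>H\<^esub>}" for j :: nat
  have hom_one: "\<phi> i \<one>\<^bsub>G\<^esub> = \<one>\<^bsub>H\<^esub>" if "i < k" for i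
    using hom_one[OF hom[OF that] G H(1)] .
  have sub: "subgroup (K j) G" if "j \<le> k" for j
    using that
  proof (induction j)
    case 0
    then show ?case by (simp add: K_def G.subgroup_self)
  next
    case (Suc j)
    interpret h: group_hom G H "\<phi> j"
      using hom Suc.prems by unfold_locales simp
    have "K (Suc j) = K j \<inter> kernel G H (\<phi> j)"
      by (auto simp: K_def kernel_def less_Suc_eq)
    then show ?case
      using G.subgroups_Inter_pair[OF Suc.IH h.subgroup_kernel] Suc.prems by simp
  qed
  \<comment> \<open>The induction starts at the trivial kernel \<open>K k\<close> and undoes one
    condition in each step.\<close>
  have "p_solvable TYPE('s) p (G\<lparr>carrier := K (k - j)\<rparr>)" if "j \<le> k" for j
    using that
  proof (induction j)
    case 0
    have "K k = {\<one>\<^bsub>G\<^esub>}"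
      unfolding K_def using inj hom_one by auto
    then show ?case
      using p G.subgroup_imp_group[OF G.triv_subgroup]
      by (auto intro!: p_solvable_coprime simp: Coset.order_def)
  next
    case (Suc j)
    let ?i = "k - Suc j"
    have i: "?i < k" "Suc ?i = k - j" using Suc.prems by auto
    let ?G = "G\<lparr>carrier := K ?i\<rparr>"
    have "\<phi> ?i \<in> hom ?G H"
      using hom[OF i(1)] by (auto simp: hom_def K_def Pi_def)
    moreover have "kernel ?G H (\<phi> ?i) = K (k - j)"
      unfolding i(2)[symmetric] by (auto simp: K_def kernel_def less_Suc_eq)
    ultimately show ?case
      using p_solvable_hom[of ?G H "\<phi> ?i" p, where 's='s] H Suc
        G.subgroup_imp_group[OF sub[of ?i]] by simp
  qed
  from this[of k] show ?thesis by (simp add: K_def)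
qed

section \<open>Composition series\<close>

lemma (in normal) comap_normal:
  assumes K: "K \<lhd> G Mod H"
  shows "{x \<in> carrier G. H #> x \<in> K} \<lhd> G"
proof -
  interpret Q: group "G Mod H" by (rule factorgroup_is_group)
  interpret K: normal K "G Mod H" by fact
  interpret \<pi>: group_hom G "G Mod H" "\<lambda>a. H #> a"
    by (unfold_locales) (rule r_coset_hom_Mod)
  show ?thesis
  proof (rule normal_invI)
    show "subgroup {x \<in> carrier G. H #> x \<in> K} G"
    proof (rule subgroupI)
      show "{x \<in> carrier G. H #> x \<in> K} \<noteq> {}"
        using K.one_closed \<pi>.hom_one by force
      show "inv a \<in> {x \<in> carrier G. H #> x \<in> K}" if "a \<in> {x \<in> carrier G. H #> x \<in> K}" for a
        using that K.m_inv_closed[of "H #> a"] \<pi>.hom_inv[of a] by simp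
      show "a \<otimes> b \<in> {x \<in> carrier G. H #> x \<in> K}"
        if "a \<in> {x \<in> carrier G. H #> x \<in> K}" "b \<in> {x \<in> carrier G. H #> x \<in> K}" for a b
        using that K.m_closed[of "H #> a" "H #> b"] \<pi>.hom_mult[of a b] by simp
    qed auto
    show "x \<otimes> h \<otimes> inv x \<in> {x \<in> carrier G. H #> x \<in> K}"
      if x: "x \<in> carrier G" and h: "h \<in> {x \<in> carrier G. H #> x \<in> K}" for x h
      using K.inv_op_closed2[of "H #> x" "H #> h"] \<pi>.hom_mult[of "x \<otimes> h" "inv x"]
        \<pi>.hom_mult[of x h] \<pi>.hom_inv[of x] \<pi>.hom_closed[OF x] x h by simp
  qed
qed

lemma (in group) simple_quotient_of_maximal_normal:
  assumes N: "N \<lhd> G" "N \<noteq> carrier G" and fin: "finite (carrier G)"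
    and max: "\<And>M. M \<lhd> G \<Longrightarrow> N \<subseteq> M \<Longrightarrow> M = N \<or> M = carrier G"
  shows "simple_group (G Mod N)"
proof -
  interpret N: normal N G by fact
  interpret Q: group "G Mod N" by (rule N.factorgroup_is_group)
  interpret \<pi>: group_hom G "G Mod N" "\<lambda>a. N #> a"
    by (unfold_locales) (rule N.r_coset_hom_Mod)
  have finQ: "finite (carrier (G Mod N))"
    unfolding carrier_FactGroup using fin by simp
  show ?thesis
  proof
    show "1 < Coset.order (G Mod N)"
    proof (rule ccontr)
      assume "\<not> 1 < Coset.order (G Mod N)"
      moreover have "0 < Coset.order (G Mod N)"
        using finQ Q.order_gt_0_iff_finite by simp
      ultimately have "carrier (G Mod N) = {N}"
        using Q.order_one_triv_iff by simp
      then have "x \<in> N" if "x \<in> carrier G" for x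
        using that rcos_self[OF that N.subgroup_axioms] by (auto simp: carrier_FactGroup)
      then show False using N(2) N.subset by blast
    qed
    fix K assume K: "K \<lhd> G Mod N"
    interpret K: normal K "G Mod N" by fact
    define M where "M = {x \<in> carrier G. N #> x \<in> K}"
    have "M \<lhd> G" unfolding M_def by (rule N.comap_normal[OF K])
    moreover have "N \<subseteq> M"
      unfolding M_def using K.one_closed N.rcos_const by auto
    moreover have KM: "K = (\<lambda>a. N #> a) ` M"
      using K.subset by (auto simp: carrier_FactGroup M_def)
    ultimately consider "M = N" | "M = carrier G" using max by blast
    then show "K = carrier (G Mod N) \<or> K = {\<one>\<^bsub>G Mod N\<^esub>}"
    proof cases
      case 1
      then have "K \<subseteq> {N}" unfolding KM using N.rcos_const by auto
      then show ?thesis using K.one_closed by auto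
    next
      case 2
      then show ?thesis using KM by (simp add: carrier_FactGroup)
    qed
  qed
qed

text \<open>The count is taken along a list chosen by \<open>SOME\<close>, which is known to be a
  series only once some series exists. A series of a maximal proper normal subgroup is prolonged by
  \<open>carrier G\<close>.\<close>

lemma composition_series_exists:
  fixes G :: "('a, 'b) monoid_scheme"
  assumes "group G" "finite (carrier G)"
  shows "\<exists>H. composition_series G H"
  using assms
proof (induction "card (carrier G)" arbitrary: G rule: less_induct)
  case less
  interpret group G by fact
  show ?case
  proof (cases "carrier G = {\<one>\<^bsub>G\<^esub>}")
    case True
    then have "composition_series G [carrier G]" by (simp add: composition_series_def)
    then show ?thesis by blast
  next
    case False
    let ?S = "{N. N \<lhd> G \<and> N \<noteq> carrier G}"
    have "finite ?S"
      by (rule finite_subset[of _ "Pow (carrier G)"])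
        (use less.prems normal_imp_subgroup subgroup.subset in \<open>blast+\<close>)
    moreover have "{\<one>\<^bsub>G\<^esub>} \<in> ?S" using one_is_normal False by auto
    ultimately obtain N where N: "N \<in> ?S" and max: "\<And>M. M \<in> ?S \<Longrightarrow> N \<subseteq> M \<Longrightarrow> N = M"
      using finite_has_maximal[of ?S] by blast
    interpret N: normal N G using N by simp
    let ?N = "G\<lparr>carrier := N\<rparr>"
    have simple: "simple_group (G Mod N)"
      by (rule simple_quotient_of_maximal_normal) (use N max less.prems in auto)
    have "card N < card (carrier G)"
      using N N.subset less.prems by (intro psubset_card_mono) auto
    then obtain H where H: "composition_series ?N H"
      using less.hyps[of ?N] subgroup_imp_group[OF N.subgroup_axioms]
        finite_subset[OF N.subset less.prems(2)] by auto
    have lenH: "H \<noteq> []" "hd H = {\<one>\<^bsub>G\<^esub>}" and lastH: "H ! (length H - 1) = N"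
      using H by (auto simp: composition_series_def last_conv_nth)
    have "composition_series G (H @ [carrier G])"
      unfolding composition_series_def
    proof (intro conjI allI impI)
      fix i assume i: "i < length (H @ [carrier G]) - 1"
      show "(H @ [carrier G]) ! i \<lhd> G\<lparr>carrier := (H @ [carrier G]) ! Suc i\<rparr>"
      proof (cases "i < length H - 1")
        case True
        then show ?thesis using H by (auto simp: composition_series_def nth_append)
      next
        case False
        then have "i = length H - 1" using i by simp
        then show ?thesis using lastH lenH N by (simp add: nth_append)
      qed
      show "simple_group (series_factor G (H @ [carrier G]) i)"
      proof (cases "i < length H - 1")
        case True
        then have "series_factor ?N H i = series_factor G (H @ [carrier G]) i"
          by (simp add: series_factor_def nth_append)
        then show ?thesis using H True by (auto simp: composition_series_def)
      next
        case False
        then have "i = length H - 1" using i by simp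
        then show ?thesis using lastH lenH simple by (simp add: nth_append series_factor_def)
      qed
    qed (use lenH in auto)
    then show ?thesis by blast
  qed
qed

text \<open>Orders multiply along the series, and a factor contributes 1 to the exponent of
  \<open>p\<close> if its order is \<open>p\<close> and 0 otherwise. The type argument is
  \<open>'a set\<close> because the elements of the factors are cosets.\<close>

lemma num_comp_factors_p_solvable:
  fixes G :: "('a, 'b) monoid_scheme"
  assumes G: "group G" and fin: "finite (carrier G)" and p: "prime p"
    and sep: "p_solvable TYPE('a set) p G"
  shows "num_comp_factors p G = multiplicity p (Coset.order G)"
proof -
  interpret group G by fact
  define H where "H = (SOME H. composition_series G H)"
  have H: "composition_series G H"
    unfolding H_def by (rule someI_ex[OF composition_series_exists[OF G fin]])
  define n where "n = length H - 1"
  have hd: "H ! 0 = {\<one>\<^bsub>G\<^esub>}" and last: "H ! n = carrier G"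
    using H by (auto simp: composition_series_def n_def hd_conv_nth last_conv_nth)
  have norm: "H ! i \<lhd> G\<lparr>carrier := H ! Suc i\<rparr>"
    and simple: "simple_group (series_factor G H i)" if "i < n" for i
    using that H by (auto simp: composition_series_def n_def)
  \<comment> \<open>Each term is only known to be normal in its successor, so the subgroup property
    is carried down from the top, hence the index \<open>n - j\<close>.\<close>
  have sub: "subgroup (H ! (n - j)) G" if "j \<le> n" for j
    using that
  proof (induction j)
    case 0
    then show ?case using last subgroup_self by simp
  next
    case (Suc j)
    then have "Suc (n - Suc j) = n - j" "n - Suc j < n" by auto
    then show ?case
      using incl_subgroup[OF Suc.IH] norm[of "n - Suc j"] normal_imp_subgroup Suc.prems by auto
  qed
  then have sub: "subgroup (H ! i) G" if "i \<le> n" for i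
    using that sub[of "n - i"] by simp
  let ?A = "\<lambda>j. {i. i < j \<and> Coset.order (series_factor G H i) = p}"
  have "multiplicity p (card (H ! j)) = card (?A j)" if "j \<le> n" for j
    using that
  proof (induction j)
    case 0
    then show ?case by (simp add: hd)
  next
    case (Suc j)
    let ?B = "G\<lparr>carrier := H ! Suc j\<rparr>"
    let ?f = "Coset.order (series_factor G H j)"
    interpret B: group ?B by (rule subgroup_imp_group[OF sub[OF Suc.prems]])
    interpret N: normal "H ! j" ?B using norm[of j] Suc.prems by simp
    have "?f * card (H ! j) = card (H ! Suc j)"
      using B.lagrange[OF N.subgroup_axioms]
      by (simp add: series_factor_def Coset.order_def FactGroup_def)
    moreover have "?f \<noteq> 0" "card (H ! j) \<noteq> 0"
    proof -
      have "finite (H ! Suc j)"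
        using finite_subset[OF subgroup.subset[OF sub[OF Suc.prems]] fin] .
      then have "card (H ! Suc j) \<noteq> 0" using B.one_closed by auto
      then show "?f \<noteq> 0" "card (H ! j) \<noteq> 0"
        using calculation by (metis mult_eq_0_iff)+
    qed
    ultimately have m: "multiplicity p (card (H ! Suc j)) = multiplicity p ?f + card (?A j)"
      using Suc p prime_elem_multiplicity_mult_distrib[of p ?f "card (H ! j)"] by simp
    \<comment> \<open>The coset map presents the factor as a simple image of the subgroup
      \<open>H ! Suc j\<close>, the situation described by \<open>p_solvable\<close>.\<close>
    have "r_coset ?B (H ! j) \<in> hom ?B (series_factor G H j)"
      unfolding series_factor_def by (rule N.r_coset_hom_Mod)
    moreover have "r_coset ?B (H ! j) ` (H ! Suc j) = carrier (series_factor G H j)"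
      unfolding series_factor_def carrier_FactGroup by simp
    ultimately have "?f = p \<or> \<not> p dvd ?f"
      using sep sub[OF Suc.prems] simple[of j] Suc.prems unfolding p_solvable_def by simp
    then have "multiplicity p ?f = (if ?f = p then 1 else 0)"
      using p by (auto simp: not_dvd_imp_multiplicity_0)
    moreover have "card (?A (Suc j)) = (if ?f = p then 1 else 0) + card (?A j)"
    proof -
      have "?A (Suc j) = (if ?f = p then insert j (?A j) else ?A j)"
        by (auto simp: less_Suc_eq)
      then show ?thesis by simp
    qed
    ultimately show ?case using m by simp
  qed
  from this[of n] show ?thesis
    unfolding num_comp_factors_def Let_def H_def[symmetric] n_def[symmetric]
    by (simp add: last Coset.order_def)
qed

text \<open>\<open>G\<close> is the preimage of a \<open>p\<close>-subgroup of \<open>N Mod E\<close>.\<close>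

lemma subgroup_with_p_part:
  fixes N :: "('a, 'b) monoid_scheme"
  assumes N: "group N" "finite (carrier N)" and E: "E \<lhd> N" "\<not> p dvd card E"
    and p: "prime p" and c: "c = 1 \<or> p = 2" and dvd: "p ^ c dvd Coset.order N"
  shows "\<exists>G. subgroup G N \<and> E \<subseteq> G \<and> multiplicity p (card G) = c \<and>
    p_solvable TYPE('s) p (N\<lparr>carrier := G\<rparr>)"
proof -
  interpret N: group N by fact
  interpret E: normal E N by fact
  let ?Q = "N Mod E"
  interpret Q: group ?Q by (rule E.factorgroup_is_group)
  interpret \<pi>: group_hom N ?Q "\<lambda>a. E #>\<^bsub>N\<^esub> a"
    by (unfold_locales) (rule E.r_coset_hom_Mod)
  have "Coset.order ?Q * card E = Coset.order N"
    using N.lagrange[OF E.subgroup_axioms] by (simp add: Coset.order_def FactGroup_def)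
  \<comment> \<open>Since \<open>p\<close> does not divide \<open>card E\<close>, the full power
    survives in the quotient.\<close>
  then have "p ^ c dvd Coset.order ?Q"
    using dvd E(2) p
    using coprime_dvd_mult_left_iff[of "p ^ c" "card E" "Coset.order ?Q"] prime_imp_coprime[OF p, of "card E"]
    by simp
  then obtain m where m: "Coset.order ?Q = p ^ c * m" by (elim dvdE)
  have "finite (carrier ?Q)" using N(2) by (simp add: carrier_FactGroup)
  then obtain K where K: "subgroup K ?Q" "card K = p ^ c"
    using sylow_thm[OF p Q.is_group m] by blast
  interpret K: subgroup K ?Q by fact
  define G where "G = {x \<in> carrier N. E #>\<^bsub>N\<^esub> x \<in> K}"
  have G: "subgroup G N"
    unfolding G_def
  proof (rule N.subgroupI)
    show "{x \<in> carrier N. E #>\<^bsub>N\<^esub> x \<in> K} \<noteq> {}"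
      using K.one_closed \<pi>.hom_one by force
    show "inv\<^bsub>N\<^esub> a \<in> {x \<in> carrier N. E #>\<^bsub>N\<^esub> x \<in> K}" if "a \<in> {x \<in> carrier N. E #>\<^bsub>N\<^esub> x \<in> K}" for a
      using that K.m_inv_closed[of "E #>\<^bsub>N\<^esub> a"] \<pi>.hom_inv[of a] by simp
    show "a \<otimes>\<^bsub>N\<^esub> b \<in> {x \<in> carrier N. E #>\<^bsub>N\<^esub> x \<in> K}"
      if "a \<in> {x \<in> carrier N. E #>\<^bsub>N\<^esub> x \<in> K}" "b \<in> {x \<in> carrier N. E #>\<^bsub>N\<^esub> x \<in> K}" for a b
      using that K.m_closed[of "E #>\<^bsub>N\<^esub> a" "E #>\<^bsub>N\<^esub> b"] \<pi>.hom_mult[of a b] by simp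
  qed auto
  have EG: "E \<subseteq> G"
    unfolding G_def using K.one_closed E.rcos_const by auto
  let ?G = "N\<lparr>carrier := G\<rparr>" and ?K = "?Q\<lparr>carrier := K\<rparr>"
  have gG: "group ?G" and gK: "group ?K"
    using N.subgroup_imp_group[OF G] Q.subgroup_imp_group[OF K(1)] by auto
  have hom: "(\<lambda>a. E #>\<^bsub>N\<^esub> a) \<in> hom ?G ?K"
    using \<pi>.homh by (auto simp: hom_def G_def Pi_def)
  have ker: "kernel ?G ?K (\<lambda>a. E #>\<^bsub>N\<^esub> a) = E"
  proof (rule Set.set_eqI)
    show "x \<in> kernel ?G ?K (\<lambda>a. E #>\<^bsub>N\<^esub> a) \<longleftrightarrow> x \<in> E" for x
      using N.coset_join1[of E x] N.coset_join2[of x E] E.subgroup_axioms E.subset EG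
      by (auto simp: kernel_def G_def)
  qed
  have img: "(\<lambda>a. E #>\<^bsub>N\<^esub> a) ` G = K"
    using K.subset by (auto simp: G_def carrier_FactGroup)
  interpret h: group_hom ?G ?K "\<lambda>a. E #>\<^bsub>N\<^esub> a"
    using gG gK hom by (simp add: group_hom_def group_hom_axioms_def)
  have "card G = card E * p ^ c"
    using h.order_kernel_image ker img K(2) by (simp add: Coset.order_def)
  moreover have "card E \<noteq> 0" using E(2) by (metis dvd_0_right)
  ultimately have "multiplicity p (card G) = c"
    using p E(2) by (simp add: prime_elem_multiplicity_mult_distrib not_dvd_imp_multiplicity_0)
  moreover have "p_solvable TYPE('s) p ?G"
  proof (rule p_solvable_hom[OF gG gK hom])
    show "p_solvable TYPE('s) p (?G\<lparr>carrier := kernel ?G ?K (\<lambda>a. E #>\<^bsub>N\<^esub> a)\<rparr>)"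
      using p_solvable_coprime[OF N.subgroup_imp_group[OF E.subgroup_axioms], of p] E(2)
      by (simp add: ker Coset.order_def)
    \<comment> \<open>The order of \<open>K\<close> is \<open>p\<close> or a power of two. These are
      the two kinds of \<open>p\<close>-groups treated above, which explains the condition on
      \<open>c\<close>.\<close>
    show "p_solvable TYPE('s) p ?K"
    proof (cases "c = 1")
      case True
      then have "Coset.order ?K = p" using K(2) by (simp add: Coset.order_def)
      then show ?thesis by (rule p_solvable_prime_order[OF gK])
    next
      case False
      then have "p = 2" "Coset.order ?K = 2 ^ c" using c K(2) by (auto simp: Coset.order_def)
      with p_solvable_two_power_order[OF gK this(2), where 's='s] show ?thesis by metis
    qed
  qed
  ultimately show ?thesis using G EG by (intro exI[of _ G] conjI)
qed

section \<open>Linear groups\<close>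

definition invariant_subspace :: "'a::field mat set \<Rightarrow> nat \<Rightarrow> 'a vec set \<Rightarrow> bool" where
  "invariant_subspace G d W \<longleftrightarrow> W \<subseteq> carrier_vec d \<and> 0\<^sub>v d \<in> W \<and>
     (\<forall>u\<in>W. \<forall>v\<in>W. u + v \<in> W) \<and> (\<forall>c. \<forall>v\<in>W. c \<cdot>\<^sub>v v \<in> W) \<and> (\<forall>g\<in>G. \<forall>v\<in>W. g *\<^sub>v v \<in> W)"

lemma irreducible_linear_group_iff:
  "irreducible_linear_group TYPE('a::field) d G \<longleftrightarrow>
     subgroup G (GL TYPE('a) d) \<and> d \<noteq> 0 \<and>
     (\<forall>W. invariant_subspace G d W \<longrightarrow> W = {0\<^sub>v d} \<or> W = carrier_vec d)"
proof -
  have "VectorSpace.subspace class_ring W (module_vec TYPE('a) d) \<longleftrightarrow>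
      W \<subseteq> carrier_vec d \<and> 0\<^sub>v d \<in> W \<and> (\<forall>u\<in>W. \<forall>v\<in>W. u + v \<in> W) \<and> (\<forall>c. \<forall>v\<in>W. c \<cdot>\<^sub>v v \<in> W)"
    for W :: "'a vec set"
    unfolding VectorSpace.subspace_def submodule_def
    using vec_vs[where 'a = 'a] vec_module[where 'a = 'a] by (auto simp: module_vec_simps)
  then show ?thesis
    unfolding irreducible_linear_group_def invariant_subspace_def by (auto 0 0)
qed

lemma GL_simps [simp]:
  "monoid.mult (GL TYPE('a::field) d) = (*)" "monoid.one (GL TYPE('a) d) = 1\<^sub>m d"
  by (auto simp: GL_def units_of_def ring_mat_def)

lemma group_GL: "group (GL TYPE('a::field) d)"
proof -
  interpret ring "ring_mat TYPE('a) d ()" by (rule ring_mat)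
  show ?thesis unfolding GL_def by (rule units_group)
qed

text \<open>A right inverse of a square matrix is also a left inverse, so one product certifies
  invertibility.\<close>

lemma carrier_GL_iff:
  "A \<in> carrier (GL TYPE('a::field) d) \<longleftrightarrow>
     A \<in> carrier_mat d d \<and> (\<exists>B\<in>carrier_mat d d. A * B = 1\<^sub>m d)"
  using mat_mult_left_right_inverse[of A d]
  by (auto simp: GL_def units_of_def Units_def ring_mat_def)

lemma carrier_GL_carrier_mat: "A \<in> carrier (GL TYPE('a::field) d) \<Longrightarrow> A \<in> carrier_mat d d"
  by (simp add: carrier_GL_iff)

section \<open>Counting matrices, finite matrix groups\<close>

lemma bij_betw_mat:
  "bij_betw (\<lambda>f. mat n m f) (PiE ({..<n} \<times> {..<m}) (\<lambda>_. UNIV)) (carrier_mat n m :: 'a mat set)"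
proof (rule bij_betwI[where g = "\<lambda>A. restrict (\<lambda>ij. A $$ ij) ({..<n} \<times> {..<m})"])
  show "restrict (\<lambda>ij. mat n m f $$ ij) ({..<n} \<times> {..<m}) = f"
    if "f \<in> PiE ({..<n} \<times> {..<m}) (\<lambda>_. UNIV)" for f :: "nat \<times> nat \<Rightarrow> 'a"
  proof (rule ext)
    fix x
    show "restrict (\<lambda>ij. mat n m f $$ ij) ({..<n} \<times> {..<m}) x = f x"
    proof (cases "x \<in> {..<n} \<times> {..<m}")
      case True
      then show ?thesis by auto
    next
      case False
      then show ?thesis using PiE_arb[OF that False] by simp
    qed
  qed
qed (auto intro!: eq_matI)

lemma finite_carrier_mat [simp]: "finite (carrier_mat n m :: 'a::finite mat set)"
  using bij_betw_finite[OF bij_betw_mat[of n m]] by (auto intro!: finite_PiE)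

text \<open>The exact count lets \<open>lin_surj\<close> turn injectivity of the coordinate map into
  surjectivity.\<close>

lemma card_carrier_mat: "card (carrier_mat n m :: 'a::finite mat set) = CARD('a) ^ (n * m)"
  using bij_betw_same_card[OF bij_betw_mat[of n m, where 'a = 'a]] by (simp add: card_PiE)

lemma finite_carrier_GL [simp]: "finite (carrier (GL TYPE('a::{field,finite}) d))"
  by (rule finite_subset[OF _ finite_carrier_mat[of d d]]) (auto simp: carrier_GL_iff)

text \<open>Translation by \<open>a \<in> H\<close> is an injective map from the finite set
  \<open>H\<close> to itself, hence onto; the preimages of \<open>a\<close> and
  \<open>\<one>\<close> are the unit and the inverse. Thus closure under inverses never has to be
  checked for the groups below.\<close>

lemma (in group) finite_subgroupI:
  assumes fin: "finite H" and H: "H \<subseteq> carrier G" "H \<noteq> {}"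
    and m: "\<And>x y. x \<in> H \<Longrightarrow> y \<in> H \<Longrightarrow> x \<otimes> y \<in> H"
  shows "subgroup H G"
proof (rule subgroupI[OF H _ m])
  fix a assume a: "a \<in> H"
  then have aG: "a \<in> carrier G" using H by blast
  have "inj_on (\<lambda>x. a \<otimes> x) H"
    using H aG by (intro inj_onI) (metis Units_eq Units_l_cancel subsetD)
  then have surj: "(\<lambda>x. a \<otimes> x) ` H = H"
    using m a fin by (intro card_subset_eq) (auto simp: card_image)
  then obtain x where x: "x \<in> H" "a \<otimes> x = a" using a by (metis imageE)
  then have "x \<in> carrier G" using H by blast
  with x aG have "x = \<one>" by simp
  then have "\<one> \<in> (\<lambda>x. a \<otimes> x) ` H" using surj x by simp
  then obtain y where y: "y \<in> H" "a \<otimes> y = \<one>" by (metis imageE)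
  then have "y \<in> carrier G" using H by blast
  with y aG have "y = inv a" by (metis inv_equality inv_comm)
  then show "inv a \<in> H" using y by simp
qed auto

text \<open>The data that the wreath step consumes and reproduces. Nontriviality is part of it
  because the trivial group in dimension 1 is irreducible, whereas its wreath product with
  \<open>C_p\<close> consists of permutation matrices and fixes the all-ones vector.\<close>

definition base_group :: "'a::{field,finite} itself \<Rightarrow> nat \<Rightarrow> nat \<Rightarrow> nat \<Rightarrow> bool" where
  "base_group ty p d k \<longleftrightarrow> (\<exists>G. irreducible_linear_group ty d G \<and> G \<noteq> {1\<^sub>m d} \<and>
     p_solvable TYPE('a mat set) p (GL ty d\<lparr>carrier := G\<rparr>) \<and> multiplicity p (card G) = k)"

lemma num_comp_factors_base_group:
  assumes "base_group TYPE('a::{field,finite}) p d k" "prime p"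
  shows "d > 0 \<and> (\<exists>G. irreducible_linear_group TYPE('a) d G \<and>
    num_comp_factors p ((GL TYPE('a) d)\<lparr>carrier := G\<rparr>) = k)"
proof -
  obtain G where G: "irreducible_linear_group TYPE('a) d G"
      "p_solvable TYPE('a mat set) p (GL TYPE('a) d\<lparr>carrier := G\<rparr>)" "multiplicity p (card G) = k"
    using assms(1) unfolding base_group_def by blast
  have sub: "subgroup G (GL TYPE('a) d)" and "d > 0"
    using G(1) by (auto simp: irreducible_linear_group_iff)
  have "finite G"
    using finite_subset[OF subgroup.subset[OF sub]] by simp
  then have "num_comp_factors p (GL TYPE('a) d\<lparr>carrier := G\<rparr>) = k"
    using num_comp_factors_p_solvable[OF group.subgroup_imp_group[OF group_GL sub] _ assms(2) G(2)] G(3)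
    by (simp add: Coset.order_def)
  with G(1) \<open>d > 0\<close> show ?thesis by blast
qed

section \<open>Wreath products with a cyclic group of prime order\<close>

text \<open>The only nonzero block in the \<open>i\<close>-th block row of \<open>block_monomial p d g s\<close> is \<open>g i\<close>, in block
  column \<open>i + s\<close> (modulo \<open>p\<close>).\<close>

definition block_monomial :: "nat \<Rightarrow> nat \<Rightarrow> (nat \<Rightarrow> 'a::field mat) \<Rightarrow> nat \<Rightarrow> 'a mat" where
  "block_monomial p d g s = mat (p * d) (p * d)
     (\<lambda>(k, l). if l div d = (k div d + s) mod p then g (k div d) $$ (k mod d, l mod d) else 0)"

lemma block_index_less: "i < p \<Longrightarrow> r < d \<Longrightarrow> i * d + r < p * (d::nat)"
proof -
  assume "i < p" "r < d"
  then have "i * d + r < Suc i * d" by simp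
  also have "\<dots> \<le> p * d" using \<open>i < p\<close> by (intro mult_le_mono1) simp
  finally show ?thesis .
qed

lemma block_index_cases:
  fixes k p d :: nat
  assumes "k < p * d"
  obtains i r where "i < p" "r < d" "k = i * d + r"
proof
  show "k div d < p" using assms by (simp add: less_mult_imp_div_less)
  show "k mod d < d" using assms by (cases "d = 0") auto
  show "k = k div d * d + k mod d" by simp
qed

lemma sum_blocks:
  "(\<Sum>k<p * d. f k) = (\<Sum>i<p. \<Sum>r<d. f (i * d + r :: nat) :: 'a::comm_monoid_add)"
proof -
  have "sum f {i * d..<i * d + d} = (\<Sum>r<d. f (i * d + r))" for i
    using sum.shift_bounds_nat_ivl[of f 0 "i * d" d]
    by (simp add: add.commute atLeast0LessThan)
  then show ?thesis
    using sum.nat_group[of f d p] by simp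
qed

lemma index_block_monomial:
  assumes "i < p" "r < d" "j < p" "c < d"
  shows "block_monomial p d g s $$ (i * d + r, j * d + c) =
    (if j = (i + s) mod p then g i $$ (r, c) else 0)"
  using assms block_index_less[of i p r d] block_index_less[of j p c d]
  by (simp add: block_monomial_def)

lemma block_monomial_carrier [simp]: "block_monomial p d g s \<in> carrier_mat (p * d) (p * d)"
  by (simp add: block_monomial_def)

lemma dim_block_monomial [simp]:
  "dim_row (block_monomial p d g s) = p * d" "dim_col (block_monomial p d g s) = p * d"
  by (simp_all add: block_monomial_def)

lemma block_mat_eqI:
  assumes A: "A \<in> carrier_mat (p * d) (p * d)" and B: "B \<in> carrier_mat (p * d) (p * d)"
    and eq: "\<And>i r j c. i < p \<Longrightarrow> r < d \<Longrightarrow> j < p \<Longrightarrow> c < d \<Longrightarrow>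
      A $$ (i * d + r, j * d + c) = B $$ (i * d + r, j * d + c)"
  shows "A = B"
proof (rule eq_matI)
  fix k l assume "k < dim_row B" "l < dim_col B"
  then have "k < p * d" "l < p * d" using B by auto
  then show "A $$ (k, l) = B $$ (k, l)"
    using eq by (elim block_index_cases) simp
qed (use A B in auto)

lemma block_vec_eqI:
  assumes v: "v \<in> carrier_vec (p * d)" and w: "w \<in> carrier_vec (p * d)"
    and eq: "\<And>i r. i < p \<Longrightarrow> r < d \<Longrightarrow> v $ (i * d + r) = w $ (i * d + r)"
  shows "v = w"
proof (rule eq_vecI)
  fix k assume "k < dim_vec w"
  then have "k < p * d" using w by auto
  then show "v $ k = w $ k" using eq by (elim block_index_cases) simp
qed (use v w in auto)

lemma block_monomial_cong:
  "(\<And>i. i < p \<Longrightarrow> g i = h i) \<Longrightarrow> block_monomial p d g s = block_monomial p d h s"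
  by (rule block_mat_eqI[of _ p d]) (auto simp: index_block_monomial)

lemma block_monomial_one: "p > 0 \<Longrightarrow> block_monomial p d (\<lambda>_. 1\<^sub>m d) 0 = 1\<^sub>m (p * d)"
proof (rule block_mat_eqI[of _ p d])
  fix i r j c assume *: "i < p" "r < d" "j < p" "c < d"
  have "i * d + r = j * d + c \<longleftrightarrow> i = j \<and> r = c"
  proof
    assume e: "i * d + r = j * d + c"
    have "(i * d + r) div d = i" "(j * d + c) div d = j" using * by simp_all
    then show "i = j \<and> r = c" using e by simp
  qed auto
  then show "block_monomial p d (\<lambda>_. 1\<^sub>m d) 0 $$ (i * d + r, j * d + c) =
      1\<^sub>m (p * d) $$ (i * d + r, j * d + c)"
    using * block_index_less[of i p r d] block_index_less[of j p c d]
    by (auto simp: index_block_monomial)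
qed auto

text \<open>Block row \<open>i\<close> of the first factor leads to block row \<open>i + s\<close>
  of the second, where \<open>h\<close> has to be read. This is the multiplication rule of the
  wreath product.\<close>

lemma block_monomial_mult:
  assumes g: "\<And>i. i < p \<Longrightarrow> g i \<in> carrier_mat d d" and h: "\<And>i. i < p \<Longrightarrow> h i \<in> carrier_mat d d"
  shows "block_monomial p d g s * block_monomial p d h t =
    block_monomial p d (\<lambda>i. g i * h ((i + s) mod p)) ((s + t) mod p)"
proof (rule block_mat_eqI[of _ p d])
  fix i r j c assume *: "i < p" "r < d" "j < p" "c < d"
  let ?k = "(i + s) mod p"
  have k: "?k < p" using * by simp
  have "(block_monomial p d g s * block_monomial p d h t) $$ (i * d + r, j * d + c) =
      (\<Sum>k<p. \<Sum>x<d. block_monomial p d g s $$ (i * d + r, k * d + x) *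
        block_monomial p d h t $$ (k * d + x, j * d + c))"
    using block_index_less[OF *(1,2)] block_index_less[OF *(3,4)]
    by (simp add: scalar_prod_def atLeast0LessThan sum_blocks)
  also have "\<dots> = (\<Sum>k<p. if k = ?k then
      (\<Sum>x<d. g i $$ (r, x) * (if j = (k + t) mod p then h k $$ (x, c) else 0)) else 0)"
    by (rule sum.cong) (auto simp: index_block_monomial *)
  also have "\<dots> = (\<Sum>x<d. g i $$ (r, x) * (if j = (?k + t) mod p then h ?k $$ (x, c) else 0))"
    using k by simp
  also have "\<dots> = (if j = (i + (s + t) mod p) mod p then (g i * h ?k) $$ (r, c) else 0)"
    using * g[OF *(1)] h[OF k]
    by (auto simp: scalar_prod_def atLeast0LessThan mod_simps add.assoc intro!: sum.cong)
  finally show "(block_monomial p d g s * block_monomial p d h t) $$ (i * d + r, j * d + c) =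
      block_monomial p d (\<lambda>i. g i * h ((i + s) mod p)) ((s + t) mod p) $$ (i * d + r, j * d + c)"
    using * by (simp add: index_block_monomial)
qed auto

section \<open>Block coordinates of matrices and vectors\<close>

definition block :: "nat \<Rightarrow> nat \<Rightarrow> nat \<Rightarrow> 'a mat \<Rightarrow> 'a mat" where
  "block d i j A = mat d d (\<lambda>(r, c). A $$ (i * d + r, j * d + c))"

lemma block_block_monomial:
  assumes "i < p" "j < p" "g i \<in> carrier_mat d d"
  shows "block d i j (block_monomial p d g s) = (if j = (i + s) mod p then g i else 0\<^sub>m d d)"
  by (rule eq_matI) (use assms in \<open>auto simp: block_def index_block_monomial\<close>)

definition slice :: "nat \<Rightarrow> nat \<Rightarrow> 'a vec \<Rightarrow> 'a vec" where
  "slice d i v = vec d (\<lambda>r. v $ (i * d + r))"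

definition put :: "nat \<Rightarrow> nat \<Rightarrow> nat \<Rightarrow> 'a::zero vec \<Rightarrow> 'a vec" where
  "put p d i u = vec (p * d) (\<lambda>k. if k div d = i then u $ (k mod d) else 0)"

lemma slice_carrier [simp]: "slice d i v \<in> carrier_vec d"
  by (simp add: slice_def)

lemma put_carrier [simp]: "put p d i u \<in> carrier_vec (p * d)"
  by (simp add: put_def)

lemma slice_eqI:
  assumes "v \<in> carrier_vec (p * d)" "w \<in> carrier_vec (p * d)"
    and "\<And>i. i < p \<Longrightarrow> slice d i v = slice d i w"
  shows "v = w"
proof (rule block_vec_eqI[OF assms(1,2)])
  fix i r assume "i < p" "r < d"
  then have "slice d i v $ r = slice d i w $ r" using assms(3) by simp
  then show "v $ (i * d + r) = w $ (i * d + r)" using \<open>r < d\<close> by (simp add: slice_def)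
qed

lemma slice_put:
  assumes "j < p" "u \<in> carrier_vec d"
  shows "slice d j (put p d i u) = (if j = i then u else 0\<^sub>v d)"
  using assms block_index_less[of j p _ d] by (intro eq_vecI) (auto simp: slice_def put_def)

lemma slice_add:
  "i < p \<Longrightarrow> v \<in> carrier_vec (p * d) \<Longrightarrow> w \<in> carrier_vec (p * d) \<Longrightarrow>
    slice d i (v + w) = slice d i v + slice d i w"
  using block_index_less[of i p _ d] by (intro eq_vecI) (auto simp: slice_def)

lemma slice_smult:
  "i < p \<Longrightarrow> v \<in> carrier_vec (p * d) \<Longrightarrow> slice d i (c \<cdot>\<^sub>v v) = c \<cdot>\<^sub>v slice d i v"
  using block_index_less[of i p _ d] by (intro eq_vecI) (auto simp: slice_def)

lemma slice_block_monomial: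
  assumes i: "i < p" and v: "v \<in> carrier_vec (p * d)" and g: "g i \<in> carrier_mat d d"
  shows "slice d i (block_monomial p d g s *\<^sub>v v) = g i *\<^sub>v slice d ((i + s) mod p) v"
proof (rule eq_vecI)
  fix r assume "r < dim_vec (g i *\<^sub>v slice d ((i + s) mod p) v)"
  then have r: "r < d" using g by simp
  let ?k = "(i + s) mod p"
  have k: "?k < p" using i by simp
  have "slice d i (block_monomial p d g s *\<^sub>v v) $ r =
      (\<Sum>k<p. \<Sum>x<d. block_monomial p d g s $$ (i * d + r, k * d + x) * v $ (k * d + x))"
    using block_index_less[OF i r] r v
    by (simp add: slice_def scalar_prod_def atLeast0LessThan sum_blocks)
  also have "\<dots> = (\<Sum>k<p. if k = ?k then (\<Sum>x<d. g i $$ (r, x) * v $ (k * d + x)) else 0)"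
    by (rule sum.cong) (auto simp: index_block_monomial i r)
  also have "\<dots> = (\<Sum>x<d. g i $$ (r, x) * v $ (?k * d + x))"
    using k by simp
  also have "\<dots> = (g i *\<^sub>v slice d ?k v) $ r"
    using g r by (simp add: scalar_prod_def slice_def atLeast0LessThan)
  finally show "slice d i (block_monomial p d g s *\<^sub>v v) $ r = (g i *\<^sub>v slice d ?k v) $ r" .
qed (use g in \<open>simp add: slice_def\<close>)

lemma mult_mat_zero_vec:
  "A \<in> carrier_mat n m \<Longrightarrow> A *\<^sub>v 0\<^sub>v m = (0\<^sub>v n :: 'a::semiring_0 vec)"
  by (rule eq_vecI) (auto simp: scalar_prod_def)

text \<open>\<open>PiE\<close> fixes the values of the functions outside \<open>{..<p}\<close>; this
  makes the parametrization injective for invertible blocks and the group countable.\<close>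

definition wreath :: "nat \<Rightarrow> nat \<Rightarrow> 'a::field mat set \<Rightarrow> 'a mat set" where
  "wreath p d G = (\<lambda>(g, s). block_monomial p d g s) ` (PiE {..<p} (\<lambda>_. G) \<times> {..<p})"

lemma block_monomial_in_wreath:
  assumes "\<And>i. i < p \<Longrightarrow> g i \<in> G" "s < p"
  shows "block_monomial p d g s \<in> wreath p d G"
proof -
  have "block_monomial p d g s = block_monomial p d (restrict g {..<p}) s"
    by (rule block_monomial_cong) simp
  then show ?thesis
    using assms unfolding wreath_def by (intro image_eqI[of _ _ "(restrict g {..<p}, s)"]) auto
qed

lemma wreathE:
  assumes "A \<in> wreath p d G"
  obtains g s where "\<And>i. i < p \<Longrightarrow> g i \<in> G" "s < p" "A = block_monomial p d g s"
  using assms unfolding wreath_def by (auto simp: PiE_def Pi_def)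

context
  fixes p d :: nat and G :: "'a::{field,finite} mat set"
  assumes G: "subgroup G (GL TYPE('a) d)" and d: "d > 0" and p: "prime p"
begin

interpretation GL: group "GL TYPE('a) d" by (rule group_GL)
interpretation GLp: group "GL TYPE('a) (p * d)" by (rule group_GL)
interpretation G: subgroup G "GL TYPE('a) d" by (rule G)

lemma p_pos: "p > 0"
  using p prime_gt_0_nat by blast

lemma G_carrier: "g \<in> G \<Longrightarrow> g \<in> carrier_mat d d"
  using G.subset carrier_GL_carrier_mat by blast

lemma G_one: "1\<^sub>m d \<in> G"
  using G.one_closed by simp

lemma G_mult: "g \<in> G \<Longrightarrow> h \<in> G \<Longrightarrow> g * h \<in> G"
  using G.m_closed[of g h] by simp

lemma G_nonzero: "g \<in> G \<Longrightarrow> g \<noteq> 0\<^sub>m d d"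
proof
  assume "g \<in> G" "g = 0\<^sub>m d d"
  then obtain B where "B \<in> carrier_mat d d" "0\<^sub>m d d * B = (1\<^sub>m d :: 'a mat)"
    using G.subset carrier_GL_iff by blast
  then have "(0\<^sub>m d d :: 'a mat) $$ (0, 0) = 1\<^sub>m d $$ (0, 0)" by simp
  then show False using d by simp
qed

lemma block_monomial_in_GL:
  assumes g: "\<And>i. i < p \<Longrightarrow> g i \<in> G" and s: "s < p"
  shows "block_monomial p d g s \<in> carrier (GL TYPE('a) (p * d))"
proof -
  \<comment> \<open>The inverse has the opposite shift and the inverse blocks, placed in the rows
    where they are met. The \<open>mod\<close> takes care of \<open>s = 0\<close>.\<close>
  let ?t = "(p - s) mod p"
  let ?h = "\<lambda>j. inv\<^bsub>GL TYPE('a) d\<^esub> (g ((j + ?t) mod p))"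
  have h: "?h j \<in> G" for j
    using g[of "(j + ?t) mod p"] p_pos by simp
  have shift: "((i + s) mod p + ?t) mod p = i" if "i < p" for i
  proof -
    have "((i + s) mod p + ?t) mod p = (i + s + (p - s)) mod p" by (rule mod_add_eq)
    then show ?thesis using that s by simp
  qed
  have "block_monomial p d g s * block_monomial p d ?h ?t =
      block_monomial p d (\<lambda>i. g i * ?h ((i + s) mod p)) ((s + ?t) mod p)"
    by (rule block_monomial_mult) (use g h G_carrier in auto)
  also have "(s + ?t) mod p = 0" using s by (simp add: mod_simps)
  also have "block_monomial p d (\<lambda>i. g i * ?h ((i + s) mod p)) 0 = block_monomial p d (\<lambda>_. 1\<^sub>m d) 0"
    by (rule block_monomial_cong) (use g shift GL.r_inv G.subset in force)
  also have "\<dots> = 1\<^sub>m (p * d)" by (rule block_monomial_one[OF p_pos])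
  finally show ?thesis
    unfolding carrier_GL_iff using block_monomial_carrier by blast
qed

text \<open>Elements of \<open>G\<close> are nonzero as \<open>d > 0\<close>, so the position of the
  nonzero block in row 0 reveals the shift; then the blocks can be compared.\<close>

lemma block_monomial_eqD:
  assumes g: "\<And>i. i < p \<Longrightarrow> g i \<in> G" and h: "\<And>i. i < p \<Longrightarrow> h i \<in> G" and st: "s < p" "t < p"
    and eq: "block_monomial p d g s = block_monomial p d h t"
  shows "s = t" "\<And>i. i < p \<Longrightarrow> g i = h i"
proof -
  have b: "(if j = (i + s) mod p then g i else 0\<^sub>m d d) = (if j = (i + t) mod p then h i else 0\<^sub>m d d)"
    if "i < p" "j < p" for i j
    using block_block_monomial[of i p j g d s] block_block_monomial[of i p j h d t]
      that g h G_carrier eq by simp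
  show "s = t"
    using b[of 0 s] st p_pos g[of 0] G_nonzero[of "g 0"] by (auto split: if_splits)
  then show "g i = h i" if "i < p" for i
    using b[OF that, of "(i + s) mod p"] p_pos by simp
qed

lemma card_wreath: "card (wreath p d G) = card G ^ p * p"
proof -
  have "inj_on (\<lambda>(g, s). block_monomial p d g s) (PiE {..<p} (\<lambda>_. G) \<times> {..<p})"
  proof (rule inj_onI)
    fix x y :: "(nat \<Rightarrow> 'a mat) \<times> nat"
    assume xy: "x \<in> PiE {..<p} (\<lambda>_. G) \<times> {..<p}" "y \<in> PiE {..<p} (\<lambda>_. G) \<times> {..<p}"
      "(\<lambda>(g, s). block_monomial p d g s) x = (\<lambda>(g, s). block_monomial p d g s) y"
    obtain g s h t where gh: "x = (g, s)" "y = (h, t)" by (cases x, cases y) blast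
    with xy have *: "g \<in> PiE {..<p} (\<lambda>_. G)" "h \<in> PiE {..<p} (\<lambda>_. G)" "s \<in> {..<p}" "t \<in> {..<p}"
      "block_monomial p d g s = block_monomial p d h t"
      by auto
    then have "g i \<in> G" "h i \<in> G" if "i < p" for i
      using that by (auto simp: PiE_mem)
    note eqD = block_monomial_eqD[of g h s t, OF this]
    then have "s = t" "\<And>i. i < p \<Longrightarrow> g i = h i"
      using * by auto
    then show "x = y"
      using PiE_ext[OF *(1,2)] gh by simp
  qed
  then show ?thesis
    unfolding wreath_def by (simp add: card_image card_cartesian_product card_PiE)
qed

lemma finite_wreath: "finite (wreath p d G)"
  using card_wreath p_pos G_one finite_subset[OF G.subset]
  by (metis card_0_eq card.infinite empty_iff finite_carrier_GL mult_is_0 not_less0 power_not_zero)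

lemma wreath_mult: "A \<in> wreath p d G \<Longrightarrow> B \<in> wreath p d G \<Longrightarrow> A * B \<in> wreath p d G"
  using p_pos G_carrier G_mult
  by (elim wreathE) (auto simp: block_monomial_mult intro!: block_monomial_in_wreath)

lemma subgroup_wreath: "subgroup (wreath p d G) (GL TYPE('a) (p * d))"
proof (rule GLp.finite_subgroupI[OF finite_wreath])
  show "wreath p d G \<subseteq> carrier (GL TYPE('a) (p * d))"
  proof
    fix A assume "A \<in> wreath p d G"
    then show "A \<in> carrier (GL TYPE('a) (p * d))"
      by (elim wreathE) (simp add: block_monomial_in_GL)
  qed
  show "wreath p d G \<noteq> {}"
    using block_monomial_in_wreath[of p "\<lambda>_. 1\<^sub>m d" G 0 d] G_one p_pos by auto
qed (simp add: wreath_mult)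

section \<open>The base group of the wreath product\<close>

definition diag_part :: "'a mat set" where
  "diag_part = (\<lambda>g. block_monomial p d g 0) ` PiE {..<p} (\<lambda>_. G)"

lemma diag_part_mem: "(\<And>i. i < p \<Longrightarrow> g i \<in> G) \<Longrightarrow> block_monomial p d g 0 \<in> diag_part"
proof -
  assume g: "\<And>i. i < p \<Longrightarrow> g i \<in> G"
  have "block_monomial p d g 0 = block_monomial p d (restrict g {..<p}) 0"
    by (rule block_monomial_cong) simp
  then show ?thesis
    using g unfolding diag_part_def by (intro image_eqI[of _ _ "restrict g {..<p}"]) auto
qed

lemma diag_partE:
  assumes "A \<in> diag_part"
  obtains g where "\<And>i. i < p \<Longrightarrow> g i \<in> G" "A = block_monomial p d g 0"
  using assms unfolding diag_part_def by (auto simp: PiE_def Pi_def)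

lemma diag_part_subset: "diag_part \<subseteq> wreath p d G"
proof
  fix A assume "A \<in> diag_part"
  then show "A \<in> wreath p d G"
    by (elim diag_partE) (simp add: block_monomial_in_wreath p_pos)
qed

lemma card_diag_part: "card diag_part = card G ^ p"
proof -
  have "inj_on (\<lambda>g. block_monomial p d g 0) (PiE {..<p} (\<lambda>_. G))"
  proof (rule inj_onI)
    fix g h
    assume *: "g \<in> PiE {..<p} (\<lambda>_. G)" "h \<in> PiE {..<p} (\<lambda>_. G)"
      "block_monomial p d g 0 = block_monomial p d h 0"
    then have "g i \<in> G" "h i \<in> G" if "i < p" for i
      using that by (auto simp: PiE_mem)
    then have "\<And>i. i < p \<Longrightarrow> g i = h i"
      using block_monomial_eqD(2)[of g h 0 0] * p_pos by auto
    then show "g = h"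
      using PiE_ext[OF *(1,2)] by simp
  qed
  then show ?thesis
    unfolding diag_part_def by (simp add: card_image card_PiE)
qed

lemma diag_part_mult:
  assumes "\<And>i. i < p \<Longrightarrow> g i \<in> G" "\<And>i. i < p \<Longrightarrow> h i \<in> G"
  shows "block_monomial p d g 0 * block_monomial p d h 0 = block_monomial p d (\<lambda>i. g i * h i) 0"
proof -
  have "block_monomial p d g 0 * block_monomial p d h 0 =
      block_monomial p d (\<lambda>i. g i * h ((i + 0) mod p)) ((0 + 0) mod p)"
    by (rule block_monomial_mult) (use assms G_carrier in auto)
  also have "\<dots> = block_monomial p d (\<lambda>i. g i * h i) 0"
    by simp (rule block_monomial_cong, simp)
  finally show ?thesis .
qed

lemma diag_part_subgroup: "subgroup diag_part (GL TYPE('a) (p * d))"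
proof (rule GLp.finite_subgroupI)
  show "finite diag_part" by (rule finite_subset[OF diag_part_subset finite_wreath])
  show "diag_part \<subseteq> carrier (GL TYPE('a) (p * d))"
    using diag_part_subset subgroup.subset[OF subgroup_wreath] by blast
  show "diag_part \<noteq> {}"
    using diag_part_mem[of "\<lambda>_. 1\<^sub>m d"] G_one by auto
  show "A \<otimes>\<^bsub>GL TYPE('a) (p * d)\<^esub> B \<in> diag_part" if "A \<in> diag_part" "B \<in> diag_part" for A B
    using that by (elim diag_partE) (auto simp: diag_part_mult intro!: diag_part_mem G_mult)
qed

lemma diag_part_normal: "diag_part \<lhd> GL TYPE('a) (p * d)\<lparr>carrier := wreath p d G\<rparr>"
proof -
  let ?W = "GL TYPE('a) (p * d)\<lparr>carrier := wreath p d G\<rparr>"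
  interpret W: group ?W by (rule GLp.subgroup_imp_group[OF subgroup_wreath])
  show ?thesis
  proof (rule W.normal_invI)
    show "subgroup diag_part ?W"
      using GLp.subgroup_incl[OF diag_part_subgroup subgroup_wreath diag_part_subset] .
    fix A B assume A: "A \<in> carrier ?W" and B: "B \<in> diag_part"
    from A have "A \<in> wreath p d G" by simp
    then obtain g s where g: "\<And>i. i < p \<Longrightarrow> g i \<in> G" "s < p" "A = block_monomial p d g s"
      by (elim wreathE) (rule that; simp)
    have "inv\<^bsub>?W\<^esub> A \<in> wreath p d G" using W.inv_closed[OF A] by simp
    then obtain g' s' where g': "\<And>i. i < p \<Longrightarrow> g' i \<in> G" "s' < p" "inv\<^bsub>?W\<^esub> A = block_monomial p d g' s'"
      by (elim wreathE) (rule that; simp)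
    obtain b where b: "\<And>i. i < p \<Longrightarrow> b i \<in> G" "B = block_monomial p d b 0"
      using B by (elim diag_partE) (rule that; simp)
    have "block_monomial p d g s * block_monomial p d g' s' = 1\<^sub>m (p * d)"
      using W.r_inv[OF A] g g' by simp
    also have "\<dots> = block_monomial p d (\<lambda>_. 1\<^sub>m d) 0"
      by (rule block_monomial_one[OF p_pos, symmetric])
    finally have "block_monomial p d (\<lambda>i. g i * g' ((i + s) mod p)) ((s + s') mod p) =
        block_monomial p d (\<lambda>_. 1\<^sub>m d) 0"
      using g g' G_carrier by (simp add: block_monomial_mult)
    \<comment> \<open>The shifts of a matrix and of its inverse cancel modulo \<open>p\<close>, so a
      conjugate of \<open>B\<close> again has shift 0.\<close>
    then have s: "(s + s') mod p = 0"
      using g g' p_pos G_one G_mult by (intro block_monomial_eqD(1)) auto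
    have "A * B = block_monomial p d (\<lambda>i. g i * b ((i + s) mod p)) s"
      using g b G_carrier by (simp add: block_monomial_mult)
    then have "A * B * inv\<^bsub>?W\<^esub> A =
        block_monomial p d (\<lambda>i. g i * b ((i + s) mod p) * g' ((i + s) mod p)) 0"
      using g b g' G_carrier G_mult p_pos s by (simp add: block_monomial_mult)
    moreover have "\<dots> \<in> diag_part"
      by (rule diag_part_mem) (use g b g' G_mult p_pos in auto)
    ultimately show "A \<otimes>\<^bsub>?W\<^esub> B \<otimes>\<^bsub>?W\<^esub> inv\<^bsub>?W\<^esub> A \<in> diag_part" by simp
  qed
qed

text \<open>The \<open>p\<close> diagonal blocks are jointly injective homomorphisms from the base
  group to \<open>G\<close>, and by counting the quotient by the base group has order
  \<open>p\<close>.\<close>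

lemma p_solvable_wreath:
  assumes "p_solvable TYPE('s) p (GL TYPE('a) d\<lparr>carrier := G\<rparr>)"
  shows "p_solvable TYPE('s) p (GL TYPE('a) (p * d)\<lparr>carrier := wreath p d G\<rparr>)"
proof -
  let ?W = "GL TYPE('a) (p * d)\<lparr>carrier := wreath p d G\<rparr>"
  let ?B = "GL TYPE('a) (p * d)\<lparr>carrier := diag_part\<rparr>"
  let ?G = "GL TYPE('a) d\<lparr>carrier := G\<rparr>"
  have W: "group ?W" by (rule GLp.subgroup_imp_group[OF subgroup_wreath])
  have B: "group ?B" by (rule GLp.subgroup_imp_group[OF diag_part_subgroup])
  have diag: "block d i i (block_monomial p d g 0) = g i" if "i < p" "\<And>i. i < p \<Longrightarrow> g i \<in> G" for i g
    using that G_carrier block_block_monomial[of i p i g d 0] by simp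
  have "p_solvable TYPE('s) p ?B"
  proof (rule p_solvable_jointly_injective[OF B _ assms _ _ p, where k = p and \<phi> = "\<lambda>i. block d i i"])
    show "group ?G" by (rule GL.subgroup_imp_group[OF G])
    show "block d i i \<in> hom ?B ?G" if i: "i < p" for i
    proof (rule homI)
      show "block d i i A \<in> carrier ?G" if "A \<in> carrier ?B" for A
        using that i diag by (auto elim!: diag_partE)
      show "block d i i (A \<otimes>\<^bsub>?B\<^esub> A') = block d i i A \<otimes>\<^bsub>?G\<^esub> block d i i A'"
        if "A \<in> carrier ?B" "A' \<in> carrier ?B" for A A'
        using that i diag G_mult by (auto elim!: diag_partE simp: diag_part_mult)
    qed
    fix A assume A: "A \<in> carrier ?B" "\<And>i. i < p \<Longrightarrow> block d i i A = \<one>\<^bsub>?G\<^esub>"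
    from A(1) have "A \<in> diag_part" by simp
    then obtain g where g: "\<And>i. i < p \<Longrightarrow> g i \<in> G" "A = block_monomial p d g 0"
      by (elim diag_partE) (rule that; simp)
    have "A = block_monomial p d (\<lambda>_. 1\<^sub>m d) 0"
      unfolding g(2) by (rule block_monomial_cong) (use A(2) g diag in force)
    then show "A = \<one>\<^bsub>?B\<^esub>" using block_monomial_one[OF p_pos] by simp
  qed
  then have 1: "p_solvable TYPE('s) p (?W\<lparr>carrier := diag_part\<rparr>)" by simp
  interpret N: normal diag_part ?W by (rule diag_part_normal)
  have "card (rcosets\<^bsub>?W\<^esub> diag_part) * card diag_part = card (wreath p d G)"
    using group.lagrange[OF W N.subgroup_axioms] by (simp add: Coset.order_def)
  moreover have "card G \<noteq> 0"
    using G_one finite_subset[OF G.subset] by auto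
  ultimately have "Coset.order (?W Mod diag_part) = p"
    by (simp add: card_diag_part card_wreath Coset.order_def FactGroup_def mult.commute)
  then have 2: "p_solvable TYPE('s) p (?W Mod diag_part)"
    by (rule p_solvable_prime_order[OF N.factorgroup_is_group])
  show ?thesis
    by (rule p_solvable_normal_quotient[OF W diag_part_normal 1 2])
qed

text \<open>Acting on a single block and subtracting isolates that block: a nonzero invariant
  subspace contains a nonzero vector supported in one block. By irreducibility of \<open>G\<close>
  it contains all vectors supported there, and the shifts carry them to the other blocks.\<close>

lemma irreducible_wreath:
  assumes irr: "irreducible_linear_group TYPE('a) d G" and nontriv: "G \<noteq> {1\<^sub>m d}"
  shows "irreducible_linear_group TYPE('a) (p * d) (wreath p d G)"
  unfolding irreducible_linear_group_iff
proof (intro conjI allI impI)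
  show "subgroup (wreath p d G) (GL TYPE('a) (p * d))" by (rule subgroup_wreath)
  show "p * d \<noteq> 0" using p_pos d by simp
  fix W :: "'a vec set" assume W: "invariant_subspace (wreath p d G) (p * d) W"
  have Wc: "w \<in> carrier_vec (p * d)" if "w \<in> W" for w
    using that W by (auto simp: invariant_subspace_def)
  have W0: "0\<^sub>v (p * d) \<in> W" and Wadd: "u \<in> W \<Longrightarrow> v \<in> W \<Longrightarrow> u + v \<in> W"
    and Wsmult: "v \<in> W \<Longrightarrow> c \<cdot>\<^sub>v v \<in> W" and Wact: "A \<in> wreath p d G \<Longrightarrow> v \<in> W \<Longrightarrow> A *\<^sub>v v \<in> W"
    for u v c A
    using W by (auto simp: invariant_subspace_def)
  have irrD: "U = {0\<^sub>v d} \<or> U = carrier_vec d" if "invariant_subspace G d U" for U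
    using irr that by (auto simp: irreducible_linear_group_iff)
  show "W = {0\<^sub>v (p * d)} \<or> W = carrier_vec (p * d)"
  proof (cases "W = {0\<^sub>v (p * d)}")
    case False
    then obtain w where w: "w \<in> W" "w \<noteq> 0\<^sub>v (p * d)" using W0 by blast
    have sl0: "slice d i (0\<^sub>v (p * d) :: 'a vec) = 0\<^sub>v d" if "i < p" for i
      using that block_index_less[of i p _ d] by (intro eq_vecI) (auto simp: slice_def)
    have "\<exists>i<p. slice d i w \<noteq> 0\<^sub>v d"
    proof (rule ccontr)
      assume "\<not> (\<exists>i<p. slice d i w \<noteq> 0\<^sub>v d)"
      then have "w = 0\<^sub>v (p * d)"
        using sl0 by (intro slice_eqI[OF Wc[OF w(1)]]) auto
      with w(2) show False ..
    qed
    then obtain i where i: "i < p" "slice d i w \<noteq> 0\<^sub>v d" by blast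
    \<comment> \<open>Otherwise the common fixed vectors of \<open>G\<close> would be a nonzero
      invariant subspace, hence everything, and \<open>G\<close> would be trivial.\<close>
    have "\<exists>g\<in>G. g *\<^sub>v slice d i w \<noteq> slice d i w"
    proof (rule ccontr)
      assume fix_i: "\<not> (\<exists>g\<in>G. g *\<^sub>v slice d i w \<noteq> slice d i w)"
      let ?U = "{u \<in> carrier_vec d. \<forall>g\<in>G. g *\<^sub>v u = u}"
      have "invariant_subspace G d ?U"
        unfolding invariant_subspace_def
        by (auto simp: mult_add_distrib_mat_vec[OF G_carrier] mult_mat_vec[OF G_carrier]
            mult_mat_zero_vec[OF G_carrier])
      moreover have "slice d i w \<in> ?U" using fix_i by auto
      ultimately have U: "?U = carrier_vec d" using i(2) irrD by blast
      have "g = 1\<^sub>m d" if g: "g \<in> G" for g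
      proof (rule eq_matI)
        fix r c assume rc: "r < dim_row (1\<^sub>m d :: 'a mat)" "c < dim_col (1\<^sub>m d :: 'a mat)"
        have "unit_vec d c \<in> ?U" unfolding U by simp
        then have "g *\<^sub>v unit_vec d c = unit_vec d c" using g by blast
        then have "(g *\<^sub>v unit_vec d c) $ r = unit_vec d c $ r" by simp
        then show "g $$ (r, c) = 1\<^sub>m d $$ (r, c)"
          using rc G_carrier[OF g] by simp
      qed (use G_carrier[OF g] in auto)
      then show False using nontriv G_one by blast
    qed
    then obtain g where g: "g \<in> G" "g *\<^sub>v slice d i w \<noteq> slice d i w" by blast
    have e_i: "block_monomial p d (\<lambda>j. if j = i then h else 1\<^sub>m d) 0 \<in> wreath p d G" if "h \<in> G" for h
      using that G_one p_pos by (intro block_monomial_in_wreath) auto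
    have sl_i: "slice d j (block_monomial p d (\<lambda>j. if j = i then h else 1\<^sub>m d) 0 *\<^sub>v v) =
        (if j = i then h *\<^sub>v slice d j v else slice d j v)"
      if "h \<in> G" "j < p" "v \<in> carrier_vec (p * d)" for h j v
      using that G_carrier by (simp add: slice_block_monomial)
    define U where "U = {u \<in> carrier_vec d. put p d i u \<in> W}"
    define u where "u = g *\<^sub>v slice d i w + (- 1) \<cdot>\<^sub>v slice d i w"
    have u: "u \<in> carrier_vec d" "u \<noteq> 0\<^sub>v d"
    proof -
      have gc: "g *\<^sub>v slice d i w \<in> carrier_vec d" using G_carrier[OF g(1)] by simp
      then show "u \<in> carrier_vec d" by (simp add: u_def)
      show "u \<noteq> 0\<^sub>v d"
      proof
        assume "u = 0\<^sub>v d"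
        have "g *\<^sub>v slice d i w = slice d i w"
        proof (rule eq_vecI)
          fix r assume "r < dim_vec (slice d i w)"
          then have r: "r < d" by (simp add: slice_def)
          have "u $ r = 0" using \<open>u = 0\<^sub>v d\<close> r by simp
          then show "(g *\<^sub>v slice d i w) $ r = slice d i w $ r"
            unfolding u_def using r gc G_carrier[OF g(1)] by (simp add: slice_def)
        qed (use G_carrier[OF g(1)] in \<open>simp add: slice_def\<close>)
        then show False using g(2) by simp
      qed
    qed
    \<comment> \<open>The matrix is \<open>g\<close> in block \<open>i\<close> and the identity
      elsewhere, so the difference vanishes outside block \<open>i\<close>, where it equals
      \<open>u\<close>.\<close>
    let ?w' = "block_monomial p d (\<lambda>j. if j = i then g else 1\<^sub>m d) 0 *\<^sub>v w + (- 1) \<cdot>\<^sub>v w"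
    have gw: "block_monomial p d (\<lambda>j. if j = i then g else 1\<^sub>m d) 0 *\<^sub>v w \<in> W"
      by (rule Wact[OF e_i[OF g(1)] w(1)])
    have "?w' \<in> W" by (rule Wadd[OF gw Wsmult[OF w(1)]])
    moreover have "?w' = put p d i u"
    proof (rule slice_eqI[of _ p d])
      fix j assume j: "j < p"
      have "slice d j w + - 1 \<cdot>\<^sub>v slice d j w = 0\<^sub>v d"
        by (rule eq_vecI) (simp_all add: slice_def)
      then show "slice d j ?w' = slice d j (put p d i u)"
        using j Wc[OF w(1)] Wc[OF gw] Wc[OF Wsmult[OF w(1)]] sl_i[OF g(1) j Wc[OF w(1)]]
        unfolding slice_put[OF j u(1)] by (simp add: slice_add slice_smult u_def)
    qed (use Wc[OF gw] Wc[OF w(1)] in auto)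
    ultimately have "u \<in> U" using u(1) by (simp add: U_def)
    have "invariant_subspace G d U"
      unfolding invariant_subspace_def
    proof (intro conjI ballI allI)
      show "U \<subseteq> carrier_vec d" by (auto simp: U_def)
      have "put p d i (0\<^sub>v d) = (0\<^sub>v (p * d) :: 'a vec)"
        by (rule slice_eqI[of _ p d]) (auto simp: slice_put sl0)
      then show "0\<^sub>v d \<in> U" using W0 by (simp add: U_def)
      show "x + y \<in> U" if "x \<in> U" "y \<in> U" for x y
      proof -
        have xy: "x \<in> carrier_vec d" "y \<in> carrier_vec d" using that by (simp_all add: U_def)
        have "put p d i x + put p d i y = put p d i (x + y)"
        proof (rule slice_eqI[of _ p d])
          fix j assume j: "j < p"
          show "slice d j (put p d i x + put p d i y) = slice d j (put p d i (x + y))"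
            unfolding slice_add[OF j put_carrier put_carrier] slice_put[OF j xy(1)]
              slice_put[OF j xy(2)] slice_put[OF j add_carrier_vec[OF xy]] by simp
        qed simp_all
        then show ?thesis using Wadd[of "put p d i x" "put p d i y"] that by (simp add: U_def)
      qed
      show "c \<cdot>\<^sub>v x \<in> U" if "x \<in> U" for c x
      proof -
        have x: "x \<in> carrier_vec d" using that by (simp add: U_def)
        have "c \<cdot>\<^sub>v put p d i x = put p d i (c \<cdot>\<^sub>v x)"
        proof (rule slice_eqI[of _ p d])
          fix j assume j: "j < p"
          show "slice d j (c \<cdot>\<^sub>v put p d i x) = slice d j (put p d i (c \<cdot>\<^sub>v x))"
            unfolding slice_smult[OF j put_carrier] slice_put[OF j x]
              slice_put[OF j smult_carrier_vec[THEN iffD2, OF x]] by (auto intro!: eq_vecI)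
        qed simp_all
        then show ?thesis using Wsmult[of "put p d i x" c] that by (simp add: U_def)
      qed
      show "h *\<^sub>v x \<in> U" if h: "h \<in> G" and x: "x \<in> U" for h x
      proof -
        have xc: "x \<in> carrier_vec d" and hx: "h *\<^sub>v x \<in> carrier_vec d"
          using x G_carrier[OF h] by (auto simp: U_def)
        have "block_monomial p d (\<lambda>j. if j = i then h else 1\<^sub>m d) 0 *\<^sub>v put p d i x = put p d i (h *\<^sub>v x)"
        proof (rule slice_eqI[of _ p d])
          show "block_monomial p d (\<lambda>j. if j = i then h else 1\<^sub>m d) 0 *\<^sub>v put p d i x \<in> carrier_vec (p * d)"
            by (rule mult_mat_vec_carrier[OF block_monomial_carrier put_carrier])
        qed (use xc hx sl_i[OF h] in \<open>auto simp: slice_put\<close>)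
        then show ?thesis
          using Wact[OF e_i[OF h], of "put p d i x"] x hx by (simp add: U_def)
      qed
    qed
    then have "U = carrier_vec d" using irrD \<open>u \<in> U\<close> u(2) by blast
    then have puti: "put p d i x \<in> W" if "x \<in> carrier_vec d" for x
      using that by (auto simp: U_def)
    have putj: "put p d j x \<in> W" if j: "j < p" and x: "x \<in> carrier_vec d" for j x
    proof -
      \<comment> \<open>With this shift, block row \<open>j\<close> reads block \<open>i\<close>;
        the summand \<open>p\<close> prevents truncation of the subtraction.\<close>
      let ?s = "(i + p - j) mod p"
      have s: "?s < p" using p_pos by simp
      have shift: "(j' + ?s) mod p = i \<longleftrightarrow> j' = j" if j': "j' < p" for j'
      proof
        assume "(j' + ?s) mod p = i"
        then have "(j' + (i + p - j)) mod p = i mod p" using i(1) by (simp add: mod_simps)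
        then have "(j' + (i + p - j) + j) mod p = (i + j) mod p"
          by (metis mod_add_left_eq)
        then have "(j' + i + p) mod p = (j + i) mod p"
          using j by (simp add: algebra_simps)
        then have "(j' + i) mod p = (j + i) mod p" by simp
        then have "[j' + i = j + i] (mod p)" by (simp add: cong_def)
        then have "[j' = j] (mod p)" by (simp add: cong_add_rcancel_nat)
        then show "j' = j" using j j' by (simp add: cong_def)
      next
        assume "j' = j"
        then show "(j' + ?s) mod p = i" using i(1) j by (simp add: mod_simps)
      qed
      let ?A = "block_monomial p d (\<lambda>_. 1\<^sub>m d) ?s :: 'a mat"
      have "?A *\<^sub>v put p d i x = put p d j x"
      proof (rule slice_eqI[of _ p d])
        show "?A *\<^sub>v put p d i x \<in> carrier_vec (p * d)"
          by (rule mult_mat_vec_carrier[OF block_monomial_carrier put_carrier])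
        show "slice d j' (?A *\<^sub>v put p d i x) = slice d j' (put p d j x)" if "j' < p" for j'
          using that x shift[OF that] p_pos by (simp add: slice_block_monomial slice_put)
      qed simp
      then show ?thesis
        using Wact[OF block_monomial_in_wreath[of p "\<lambda>_. 1\<^sub>m d" G ?s d] puti[OF x]] G_one s by simp
    qed
    have "v \<in> W" if v: "v \<in> carrier_vec (p * d)" for v
    proof -
      \<comment> \<open>The truncation to the first \<open>m\<close> blocks lets \<open>v\<close> be
        assembled by adding one block at a time.\<close>
      define t where "t m = vec (p * d) (\<lambda>k. if k div d < m then v $ k else 0)" for m
      have tc [simp]: "t m \<in> carrier_vec (p * d)" for m by (simp add: t_def)
      have sl_t: "slice d j (t m) = (if j < m then slice d j v else 0\<^sub>v d)" if "j < p" for j m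
        using that block_index_less[of j p _ d] by (intro eq_vecI) (auto simp: slice_def t_def)
      have "t m \<in> W" if "m \<le> p" for m
        using that
      proof (induction m)
        case 0
        have "t 0 = 0\<^sub>v (p * d)" by (rule eq_vecI) (auto simp: t_def)
        then show ?case using W0 by simp
      next
        case (Suc m)
        have "t (Suc m) = t m + put p d m (slice d m v)"
          by (rule slice_eqI[of _ p d]) (auto simp: slice_add slice_put sl_t less_Suc_eq)
        then show ?case using Wadd Suc putj[of m "slice d m v"] by simp
      qed
      moreover have "t p = v"
        by (rule slice_eqI[of _ p d]) (auto simp: v sl_t)
      ultimately show ?thesis by force
    qed
    then show ?thesis using Wc by blast
  qed simp
qed

end

lemma base_group_wreath:
  assumes "base_group TYPE('a::{field,finite}) p d k" and p: "prime p"
  shows "base_group TYPE('a) p (p * d) (p * k + 1)"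
proof -
  obtain G :: "'a mat set" where G: "irreducible_linear_group TYPE('a) d G" "G \<noteq> {1\<^sub>m d}"
      "p_solvable TYPE('a mat set) p (GL TYPE('a) d\<lparr>carrier := G\<rparr>)" "multiplicity p (card G) = k"
    using assms(1) unfolding base_group_def by blast
  have sub: "subgroup G (GL TYPE('a) d)" and d: "d > 0"
    using G(1) by (auto simp: irreducible_linear_group_iff)
  have card: "card (wreath p d G) = card G ^ p * p"
    by (rule card_wreath[OF sub d p])
  have "finite G"
    using finite_subset[OF subgroup.subset[OF sub]] by simp
  then have "card G \<noteq> 0"
    using subgroup.one_closed[OF sub] by auto
  \<comment> \<open>The \<open>p\<close> copies of \<open>G\<close> contribute \<open>p * k\<close>,
    the cyclic group of shifts contributes 1.\<close>
  then have "multiplicity p (card (wreath p d G)) = p * k + 1"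
    using p G(4) unfolding card
    by (simp add: prime_elem_multiplicity_mult_distrib prime_elem_multiplicity_power_distrib)
  moreover have "wreath p d G \<noteq> {1\<^sub>m (p * d)}"
  proof
    assume "wreath p d G = {1\<^sub>m (p * d)}"
    then have "card (wreath p d G) = 1" by simp
    then have "p = 1" unfolding card by (metis nat_mult_eq_1_iff)
    then show False using p by simp
  qed
  ultimately show ?thesis
    unfolding base_group_def
    using irreducible_wreath[OF sub d p G(1,2)] p_solvable_wreath[OF sub d p G(3)]
    by (intro exI[of _ "wreath p d G"]) simp
qed

section \<open>Nice error bases\<close>

definition mtrace :: "'a::comm_monoid_add mat \<Rightarrow> 'a" where
  "mtrace A = (\<Sum>i<dim_row A. A $$ (i, i))"

lemma mtrace_smult: "A \<in> carrier_mat n n \<Longrightarrow> mtrace (c \<cdot>\<^sub>m A) = c * mtrace (A :: 'a::field mat)"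
  by (auto simp: mtrace_def sum_distrib_left)

lemma mtrace_one: "mtrace (1\<^sub>m n :: 'a::field mat) = of_nat n"
  by (simp add: mtrace_def)

lemma smult_smult_mat: "a \<cdot>\<^sub>m (b \<cdot>\<^sub>m A) = (a * b :: 'a::semigroup_mult) \<cdot>\<^sub>m A"
  by (rule eq_matI) (auto simp: mult.assoc)

lemma one_smult_mat [simp]: "(1 :: 'a::monoid_mult) \<cdot>\<^sub>m A = A"
  by (rule eq_matI) auto

lemma smult_mat_mult:
  assumes "A \<in> carrier_mat n n" "B \<in> carrier_mat n n"
  shows "(a \<cdot>\<^sub>m A) * (b \<cdot>\<^sub>m B) = (a * b :: 'a::comm_ring_1) \<cdot>\<^sub>m (A * B)"
  using assms by (simp add: mult_smult_assoc_mat[of _ n n _ n] mult_smult_distrib[of _ n n _ n]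
      smult_smult_mat mult.commute)

lemma pow_smult_mat:
  "A \<in> carrier_mat n n \<Longrightarrow> (c \<cdot>\<^sub>m A) ^\<^sub>m k = (c ^ k :: 'a::comm_ring_1) \<cdot>\<^sub>m (A ^\<^sub>m k)"
  by (induction k) (simp_all add: smult_mat_mult[of _ n] mult.commute)

lemma intertwine_pow_mat:
  assumes T: "T \<in> carrier_mat n n" and A: "A \<in> carrier_mat n n" and B: "B \<in> carrier_mat n n"
    and eq: "T * A = B * (T :: 'a::comm_ring_1 mat)"
  shows "T * A ^\<^sub>m k = B ^\<^sub>m k * T"
proof (induction k)
  case (Suc k)
  note Ak = pow_carrier_mat[OF A, of k] and Bk = pow_carrier_mat[OF B, of k]
  have "T * (A ^\<^sub>m k * A) = T * A ^\<^sub>m k * A"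
    by (rule assoc_mult_mat[OF T Ak A, symmetric])
  also have "\<dots> = B ^\<^sub>m k * (T * A)"
    unfolding Suc by (rule assoc_mult_mat[OF Bk T A])
  also have "\<dots> = B ^\<^sub>m k * B * T"
    unfolding eq by (rule assoc_mult_mat[OF Bk B T, symmetric])
  finally show ?case by simp
qed (use T A B in simp)

lemma smult_one_mat_eq_iff:
  assumes "n > 0"
  shows "a \<cdot>\<^sub>m 1\<^sub>m n = b \<cdot>\<^sub>m (1\<^sub>m n :: 'a::field mat) \<longleftrightarrow> a = b"
proof
  assume "a \<cdot>\<^sub>m 1\<^sub>m n = b \<cdot>\<^sub>m (1\<^sub>m n :: 'a mat)"
  then have "(a \<cdot>\<^sub>m 1\<^sub>m n) $$ (0, 0) = (b \<cdot>\<^sub>m (1\<^sub>m n :: 'a mat)) $$ (0, 0)" by simp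
  then show "a = b" using assms by simp
qed simp

text \<open>The elements \<open>x\<close> of a nice error basis form a projective representation of a group of order
  \<open>n\<^sup>2\<close>; the assumption \<open>dual\<close> makes them a basis of the matrix algebra that is orthogonal for the
  trace form.\<close>

locale nice_error_basis =
  fixes r n :: nat and e :: "'a::{field,finite}" and R :: "'a mat set"
  assumes n_nonzero: "of_nat n \<noteq> (0 :: 'a)"
    and R_carrier: "x \<in> R \<Longrightarrow> x \<in> carrier_mat n n"
    and one_in_R: "1\<^sub>m n \<in> R"
    and card_R: "card R = n * n"
    and R_mult: "\<lbrakk>x \<in> R; y \<in> R\<rbrakk> \<Longrightarrow> \<exists>c z. c \<noteq> 0 \<and> z \<in> R \<and> x * y = c \<cdot>\<^sub>m z"
    and R_comm: "\<lbrakk>x \<in> R; y \<in> R\<rbrakk> \<Longrightarrow> \<exists>c. c ^ r = 1 \<and> x * y = c \<cdot>\<^sub>m (y * x)"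
    and dual: "y \<in> R \<Longrightarrow> \<exists>z\<in>carrier_mat n n. y * z = 1\<^sub>m n \<and> (\<forall>x\<in>R - {y}. mtrace (x * z) = 0)"
    and scale: "\<lbrakk>x \<in> R; x \<noteq> 1\<^sub>m n\<rbrakk> \<Longrightarrow> \<exists>c. c \<noteq> 0 \<and> (c \<cdot>\<^sub>m x) ^\<^sub>m r = e \<cdot>\<^sub>m 1\<^sub>m n"
    and e_nonzero: "e \<noteq> 0" and r_pos: "r > 0"
begin

lemma n_pos: "n > 0"
  using n_nonzero by (cases n) auto

lemma dim_R [simp]: "x \<in> R \<Longrightarrow> dim_row x = n" "x \<in> R \<Longrightarrow> dim_col x = n"
  using R_carrier by auto

lemma finite_R: "finite R"
  by (rule finite_subset[OF _ finite_carrier_mat[of n n]]) (auto intro: R_carrier)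

section \<open>Coordinates with respect to the basis, and their consequences\<close>

definition lin :: "('a mat \<Rightarrow> 'a) \<Rightarrow> 'a mat" where
  "lin c = mat n n (\<lambda>ij. \<Sum>x\<in>R. c x * x $$ ij)"

lemma lin_carrier [simp]: "lin c \<in> carrier_mat n n"
  by (simp add: lin_def)

lemma mtrace_lin_mult:
  assumes z: "z \<in> carrier_mat n n"
  shows "mtrace (lin c * z) = (\<Sum>x\<in>R. c x * mtrace (x * z))"
proof -
  have tr: "mtrace (A * z) = (\<Sum>i<n. \<Sum>k<n. A $$ (i, k) * z $$ (k, i))" if "A \<in> carrier_mat n n" for A
    using that z by (auto simp: mtrace_def scalar_prod_def atLeast0LessThan)
  have "mtrace (lin c * z) = (\<Sum>i<n. \<Sum>k<n. \<Sum>x\<in>R. c x * (x $$ (i, k) * z $$ (k, i)))"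
    unfolding tr[OF lin_carrier]
    by (intro sum.cong refl) (auto simp: lin_def sum_distrib_right mult.assoc)
  also have "\<dots> = (\<Sum>x\<in>R. \<Sum>i<n. \<Sum>k<n. c x * (x $$ (i, k) * z $$ (k, i)))"
    by (simp only: sum.swap[of _ R "{..<n}"])
  also have "\<dots> = (\<Sum>x\<in>R. c x * mtrace (x * z))"
    by (intro sum.cong refl) (simp add: tr R_carrier sum_distrib_left)
  finally show ?thesis .
qed

text \<open>The trace form paired with the dual matrix of \<open>y\<close> isolates the coefficient
  of \<open>y\<close>. As \<open>of_nat n\<close> is nonzero in the field, this amounts to linear
  independence.\<close>

lemma lin_coeff:
  assumes "y \<in> R" "z \<in> carrier_mat n n" "y * z = 1\<^sub>m n" "\<forall>x\<in>R - {y}. mtrace (x * z) = 0"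
  shows "mtrace (lin c * z) = c y * of_nat n"
proof -
  have "mtrace (lin c * z) = (\<Sum>x\<in>R. if x = y then c y * of_nat n else 0)"
    unfolding mtrace_lin_mult[OF assms(2)]
    by (rule sum.cong) (use assms in \<open>auto simp: mtrace_one\<close>)
  then show ?thesis using finite_R assms(1) by simp
qed

text \<open>Linear independence and a count: both sides have \<open>q ^ (n * n)\<close> elements.\<close>

lemma lin_surj:
  assumes "M \<in> carrier_mat n n"
  shows "\<exists>c. M = lin c"
proof -
  have "inj_on lin (PiE R (\<lambda>_. UNIV))"
  proof (rule inj_onI)
    fix c c' assume *: "c \<in> PiE R (\<lambda>_. UNIV)" "c' \<in> PiE R (\<lambda>_. UNIV)" "lin c = lin c'"
    show "c = c'"
    proof (rule PiE_ext[OF *(1,2)])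
      fix y assume y: "y \<in> R"
      then obtain z where "z \<in> carrier_mat n n" "y * z = 1\<^sub>m n" "\<forall>x\<in>R - {y}. mtrace (x * z) = 0"
        using dual by blast
      then show "c y = c' y"
        using lin_coeff[OF y, of z c] lin_coeff[OF y, of z c'] *(3) n_nonzero by simp
    qed
  qed
  then have "card (lin ` PiE R (\<lambda>_. UNIV)) = card (carrier_mat n n :: 'a mat set)"
    using finite_R by (simp add: card_image card_PiE card_carrier_mat card_R)
  then have "lin ` PiE R (\<lambda>_. UNIV) = carrier_mat n n"
    by (intro card_subset_eq) auto
  then show ?thesis using assms by blast
qed

text \<open>Multiplying by the dual matrix of \<open>y\<close> and taking traces gives
  \<open>b * of_nat n \<noteq> 0\<close> on one side, which forces \<open>x = y\<close>. It makes
  the parametrizations of \<open>scaled\<close> and \<open>roots\<close> injective.\<close>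

lemma R_proportional:
  assumes x: "x \<in> R" and y: "y \<in> R" and eq: "a \<cdot>\<^sub>m x = b \<cdot>\<^sub>m y" and b: "b \<noteq> 0"
  shows "x = y \<and> a = b"
proof -
  obtain z where z: "z \<in> carrier_mat n n" "y * z = 1\<^sub>m n" "\<forall>x\<in>R - {y}. mtrace (x * z) = 0"
    using dual[OF y] by blast
  have "a \<cdot>\<^sub>m (x * z) = b \<cdot>\<^sub>m 1\<^sub>m n"
    using eq z R_carrier[OF x] R_carrier[OF y] by (metis mult_smult_assoc_mat)
  then have tr: "a * mtrace (x * z) = b * of_nat n"
    using z(1) R_carrier[OF x]
    by (metis mtrace_one mtrace_smult mult_carrier_mat one_carrier_mat)
  have xy: "x = y"
  proof (rule ccontr)
    assume "x \<noteq> y"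
    then have "mtrace (x * z) = 0" using z(3) x by blast
    then show False using tr b n_nonzero by simp
  qed
  then show ?thesis using tr z(2) n_nonzero by (simp add: mtrace_one)
qed

text \<open>Since \<open>R\<close> spans all matrices, a subspace invariant under \<open>R\<close>
  is invariant under every matrix, and these act transitively on nonzero vectors.\<close>

lemma irreducible_if_contains_R:
  assumes G: "subgroup G (GL TYPE('a) n)" and RG: "R \<subseteq> G"
  shows "irreducible_linear_group TYPE('a) n G"
  unfolding irreducible_linear_group_iff
proof (intro conjI allI impI)
  show "subgroup G (GL TYPE('a) n)" by (rule G)
  show "n \<noteq> 0" using n_pos by simp
  fix W :: "'a vec set" assume W: "invariant_subspace G n W"
  then have Wc: "W \<subseteq> carrier_vec n" and W0: "0\<^sub>v n \<in> W" by (auto simp: invariant_subspace_def)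
  show "W = {0\<^sub>v n} \<or> W = carrier_vec n"
  proof (cases "W = {0\<^sub>v n}")
    case False
    then obtain w where w: "w \<in> W" "w \<noteq> 0\<^sub>v n" using W0 by blast
    have wc: "w \<in> carrier_vec n" using w Wc by blast
    obtain j where j: "j < n" "w $ j \<noteq> 0"
    proof (rule ccontr)
      assume "\<not> thesis"
      then have "w = 0\<^sub>v n" using that wc by (intro eq_vecI) auto
      with w(2) show False ..
    qed
    have "v \<in> W" if v: "v \<in> carrier_vec n" for v
    proof -
      \<comment> \<open>A rank-one matrix that reads the nonzero coordinate \<open>w $ j\<close> and
        returns \<open>v\<close>.\<close>
      define M where "M = mat n n (\<lambda>(a, b). if b = j then v $ a / w $ j else 0)"
      have Mc: "M \<in> carrier_mat n n" by (simp add: M_def)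
      have "M *\<^sub>v w = v"
      proof (rule eq_vecI)
        fix i assume "i < dim_vec v"
        then have i: "i < n" using v by simp
        have "(M *\<^sub>v w) $ i = (\<Sum>b<n. M $$ (i, b) * w $ b)"
          using i wc Mc by (simp add: scalar_prod_def atLeast0LessThan)
        also have "\<dots> = (\<Sum>b<n. if b = j then v $ i / w $ j * w $ b else 0)"
          by (rule sum.cong) (auto simp: M_def i)
        finally have "(M *\<^sub>v w) $ i = (\<Sum>b<n. if b = j then v $ i / w $ j * w $ b else 0)" .
        then show "(M *\<^sub>v w) $ i = v $ i" using j by simp
      qed (use v in \<open>simp add: M_def\<close>)
      moreover obtain c where c: "M = lin c"
        using lin_surj[OF Mc] by blast
      moreover have "vec n (\<lambda>i. \<Sum>x\<in>S. c x * (x *\<^sub>v w) $ i) \<in> W" if "finite S" "S \<subseteq> R" for S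
        using that
      proof (induction S)
        case empty
        have "vec n (\<lambda>i. \<Sum>x\<in>{}. c x * (x *\<^sub>v w) $ i) = 0\<^sub>v n" by (rule eq_vecI) auto
        then show ?case using W0 by simp
      next
        case (insert x S)
        have "x *\<^sub>v w \<in> W" using W w(1) insert.prems RG by (auto simp: invariant_subspace_def)
        then have "c x \<cdot>\<^sub>v (x *\<^sub>v w) + vec n (\<lambda>i. \<Sum>x\<in>S. c x * (x *\<^sub>v w) $ i) \<in> W"
          using W insert by (auto simp: invariant_subspace_def)
        moreover have "c x \<cdot>\<^sub>v (x *\<^sub>v w) + vec n (\<lambda>i. \<Sum>x\<in>S. c x * (x *\<^sub>v w) $ i) =
            vec n (\<lambda>i. \<Sum>x\<in>insert x S. c x * (x *\<^sub>v w) $ i)"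
          using insert R_carrier[of x] by (intro eq_vecI) auto
        ultimately show ?case by simp
      qed
      moreover have "lin c *\<^sub>v w = vec n (\<lambda>i. \<Sum>x\<in>R. c x * (x *\<^sub>v w) $ i)"
      proof (rule eq_vecI)
        fix i assume "i < dim_vec (vec n (\<lambda>i. \<Sum>x\<in>R. c x * (x *\<^sub>v w) $ i))"
        then have i: "i < n" by simp
        have "(lin c *\<^sub>v w) $ i = (\<Sum>b<n. \<Sum>x\<in>R. c x * (x $$ (i, b) * w $ b))"
          using i wc by (auto simp: lin_def scalar_prod_def atLeast0LessThan sum_distrib_right
              mult.assoc intro!: sum.cong)
        also have "\<dots> = (\<Sum>x\<in>R. \<Sum>b<n. c x * (x $$ (i, b) * w $ b))" by (rule sum.swap)
        also have "\<dots> = (\<Sum>x\<in>R. c x * (x *\<^sub>v w) $ i)"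
          using i wc
          by (auto simp: scalar_prod_def atLeast0LessThan sum_distrib_left intro!: sum.cong)
        finally show "(lin c *\<^sub>v w) $ i = vec n (\<lambda>i. \<Sum>x\<in>R. c x * (x *\<^sub>v w) $ i) $ i"
          using i by simp
      qed (simp add: lin_def)
      ultimately show ?thesis using finite_R by auto
    qed
    then show ?thesis using Wc by blast
  qed simp
qed

text \<open>As \<open>R\<close> spans, such a matrix commutes with all matrices; comparison with
  matrix units shows that it is scalar.\<close>

lemma commutes_with_R_imp_scalar:
  assumes s: "s \<in> carrier_mat n n" and comm: "\<And>x. x \<in> R \<Longrightarrow> s * x = x * s"
  shows "\<exists>a. s = a \<cdot>\<^sub>m 1\<^sub>m n"
proof -
  have all: "s * M = M * s" if M: "M \<in> carrier_mat n n" for M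
  proof -
    obtain c where c: "M = lin c" using lin_surj[OF M] by blast
    have "(s * lin c) $$ (i, j) = (lin c * s) $$ (i, j)" if ij: "i < n" "j < n" for i j
    proof -
      have "(s * lin c) $$ (i, j) = (\<Sum>k<n. \<Sum>x\<in>R. c x * (s $$ (i, k) * x $$ (k, j)))"
        using ij s by (auto simp: lin_def scalar_prod_def atLeast0LessThan sum_distrib_left
            mult.left_commute intro!: sum.cong)
      also have "\<dots> = (\<Sum>x\<in>R. \<Sum>k<n. c x * (s $$ (i, k) * x $$ (k, j)))" by (rule sum.swap)
      also have "\<dots> = (\<Sum>x\<in>R. c x * (s * x) $$ (i, j))"
        using ij s
        by (auto simp: scalar_prod_def atLeast0LessThan sum_distrib_left intro!: sum.cong)
      also have "\<dots> = (\<Sum>x\<in>R. c x * (x * s) $$ (i, j))"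
        by (rule sum.cong) (simp_all add: comm)
      also have "\<dots> = (\<Sum>x\<in>R. \<Sum>k<n. c x * (x $$ (i, k) * s $$ (k, j)))"
        using ij s
        by (auto simp: scalar_prod_def atLeast0LessThan sum_distrib_left intro!: sum.cong)
      also have "\<dots> = (\<Sum>k<n. \<Sum>x\<in>R. c x * (x $$ (i, k) * s $$ (k, j)))" by (rule sum.swap)
      also have "\<dots> = (lin c * s) $$ (i, j)"
        using ij s by (auto simp: lin_def scalar_prod_def atLeast0LessThan sum_distrib_right
            mult.assoc intro!: sum.cong)
      finally show ?thesis .
    qed
    then show ?thesis unfolding c using s by (intro eq_matI) (auto simp: lin_def)
  qed
  have "s = s $$ (0, 0) \<cdot>\<^sub>m 1\<^sub>m n"
  proof (rule eq_matI)
    fix i a assume "i < dim_row (s $$ (0, 0) \<cdot>\<^sub>m 1\<^sub>m n)" "a < dim_col (s $$ (0, 0) \<cdot>\<^sub>m 1\<^sub>m n)"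
    then have ia: "i < n" "a < n" by auto
    \<comment> \<open>The matrix unit at \<open>(a, 0)\<close>: column 0 of \<open>s * M\<close> is
      column \<open>a\<close> of \<open>s\<close>, while column 0 of \<open>M * s\<close> is
      \<open>s $$ (0, 0)\<close> in row \<open>a\<close> and 0 elsewhere.\<close>
    define M where "M = mat n n (\<lambda>(k, l). if k = a \<and> l = 0 then 1 else (0 :: 'a))"
    have Mc: "M \<in> carrier_mat n n" by (simp add: M_def)
    have "(s * M) $$ (i, 0) = (\<Sum>k<n. s $$ (i, k) * M $$ (k, 0))"
      using ia s n_pos Mc by (simp add: scalar_prod_def atLeast0LessThan)
    also have "\<dots> = (\<Sum>k<n. if k = a then s $$ (i, k) else 0)"
      by (rule sum.cong) (auto simp: M_def n_pos)
    finally have 1: "(s * M) $$ (i, 0) = s $$ (i, a)" using ia by simp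
    have "(M * s) $$ (i, 0) = (\<Sum>k<n. M $$ (i, k) * s $$ (k, 0))"
      using ia s n_pos Mc by (simp add: scalar_prod_def atLeast0LessThan)
    also have "\<dots> = (\<Sum>k<n. if k = 0 then (if i = a then s $$ (k, 0) else 0) else 0)"
      by (rule sum.cong) (auto simp: M_def ia)
    finally have 2: "(M * s) $$ (i, 0) = (if i = a then s $$ (0, 0) else 0)" using n_pos by simp
    have "s $$ (i, a) = (if i = a then s $$ (0, 0) else 0)"
      using 1 2 all[OF Mc] by simp
    then show "s $$ (i, a) = (s $$ (0, 0) \<cdot>\<^sub>m 1\<^sub>m n) $$ (i, a)" using ia by simp
  qed (use s in auto)
  then show ?thesis by blast
qed

end

section \<open>Scalar multiples of the basis and their normalizer\<close>

context nice_error_basis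
begin

definition scaled :: "'a mat set" where
  "scaled = (\<lambda>(c, x). c \<cdot>\<^sub>m x) ` ((UNIV - {0}) \<times> R)"

lemma scaledI: "c \<noteq> 0 \<Longrightarrow> x \<in> R \<Longrightarrow> c \<cdot>\<^sub>m x \<in> scaled"
  unfolding scaled_def by force

lemma scaledE:
  assumes "x \<in> scaled"
  obtains c y where "c \<noteq> 0" "y \<in> R" "x = c \<cdot>\<^sub>m y"
  using assms unfolding scaled_def by auto

lemma scaled_carrier: "x \<in> scaled \<Longrightarrow> x \<in> carrier_mat n n"
  by (elim scaledE) (simp add: R_carrier)

lemma R_scaled: "x \<in> R \<Longrightarrow> x \<in> scaled"
  using scaledI[of 1 x] by simp

lemma scaled_smult: "c \<noteq> 0 \<Longrightarrow> x \<in> scaled \<Longrightarrow> c \<cdot>\<^sub>m x \<in> scaled"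
  by (elim scaledE) (simp add: smult_smult_mat scaledI)

lemma scaled_mult:
  assumes "x \<in> scaled" "y \<in> scaled"
  shows "x * y \<in> scaled"
proof -
  obtain a u where u: "a \<noteq> 0" "u \<in> R" "x = a \<cdot>\<^sub>m u" using assms(1) by (rule scaledE)
  obtain b v where v: "b \<noteq> 0" "v \<in> R" "y = b \<cdot>\<^sub>m v" using assms(2) by (rule scaledE)
  obtain c z where z: "c \<noteq> 0" "z \<in> R" "u * v = c \<cdot>\<^sub>m z" using R_mult[OF u(2) v(2)] by blast
  have "x * y = (a * b * c) \<cdot>\<^sub>m z"
    using smult_mat_mult[OF R_carrier[OF u(2)] R_carrier[OF v(2)]] u(3) v(3) z(3)
    by (simp add: smult_smult_mat)
  then show ?thesis using scaledI[of "a * b * c" z] u v z by simp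
qed

lemma scaled_comm:
  assumes "x \<in> scaled" "y \<in> scaled"
  shows "\<exists>c. c ^ r = 1 \<and> x * y = c \<cdot>\<^sub>m (y * x)"
proof -
  obtain a u where u: "a \<noteq> 0" "u \<in> R" "x = a \<cdot>\<^sub>m u" using assms(1) by (rule scaledE)
  obtain b v where v: "b \<noteq> 0" "v \<in> R" "y = b \<cdot>\<^sub>m v" using assms(2) by (rule scaledE)
  obtain c where c: "c ^ r = 1" "u * v = c \<cdot>\<^sub>m (v * u)" using R_comm[OF u(2) v(2)] by blast
  have "x * y = (a * b) \<cdot>\<^sub>m (c \<cdot>\<^sub>m (v * u))"
    using smult_mat_mult[OF R_carrier[OF u(2)] R_carrier[OF v(2)]] u(3) v(3) c(2) by simp
  also have "\<dots> = c \<cdot>\<^sub>m (y * x)"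
    using smult_mat_mult[OF R_carrier[OF v(2)] R_carrier[OF u(2)]] u(3) v(3)
    by (simp add: smult_smult_mat mult.commute)
  finally show ?thesis using c(1) by blast
qed

lemma scaled_GL: "x \<in> scaled \<Longrightarrow> x \<in> carrier (GL TYPE('a) n)"
proof (elim scaledE)
  fix c y assume c: "c \<noteq> 0" and y: "y \<in> R" and x: "x = c \<cdot>\<^sub>m y"
  obtain z where z: "z \<in> carrier_mat n n" "y * z = 1\<^sub>m n" using dual[OF y] by blast
  have "x * (inverse c \<cdot>\<^sub>m z) = 1\<^sub>m n"
    using smult_mat_mult[OF R_carrier[OF y] z(1)] z(2) x c by simp
  then show ?thesis
    unfolding carrier_GL_iff using z(1) x R_carrier[OF y] by (metis smult_carrier_mat)
qed

lemma finite_scaled: "finite scaled"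
  unfolding scaled_def using finite_R by simp

lemma card_scaled: "card scaled = (CARD('a) - 1) * (n * n)"
proof -
  have "inj_on (\<lambda>(c, x). c \<cdot>\<^sub>m x) ((UNIV - {0}) \<times> R)"
    using R_proportional by (auto simp: inj_on_def)
  then show ?thesis
    unfolding scaled_def by (simp add: card_image card_cartesian_product card_R card_Diff_singleton)
qed

lemma subgroup_scaled: "subgroup scaled (GL TYPE('a) n)"
  by (rule group.finite_subgroupI[OF group_GL finite_scaled])
    (use scaled_GL R_scaled[OF one_in_R] scaled_mult in auto)

text \<open>Conjugation is expressed by intertwining, so membership of a concrete matrix can be
  verified without inverses inside the identity.\<close>

definition scaled_normalizer :: "'a mat set" where
  "scaled_normalizer = {T \<in> carrier (GL TYPE('a) n). \<forall>x\<in>scaled. \<exists>y\<in>scaled. T * x = y * T}"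

lemma scaled_normalizer_carrier: "T \<in> scaled_normalizer \<Longrightarrow> T \<in> carrier_mat n n"
  by (simp add: scaled_normalizer_def carrier_GL_carrier_mat)

lemma scaled_normalizerI:
  assumes "T \<in> carrier_mat n n" "T' \<in> carrier_mat n n" "T * T' = 1\<^sub>m n"
    and "\<And>x. x \<in> scaled \<Longrightarrow> \<exists>y\<in>scaled. T * x = y * T"
  shows "T \<in> scaled_normalizer"
  using assms by (auto simp: scaled_normalizer_def carrier_GL_iff)

lemma intertwine_trans:
  assumes "T \<in> carrier_mat n n" "U \<in> carrier_mat n n" "x \<in> carrier_mat n n" "y \<in> carrier_mat n n"
    "z \<in> carrier_mat n n" "T * x = y * T" "U * y = z * (U :: 'a mat)"
  shows "(U * T) * x = z * (U * T)"
proof -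
  have "(U * T) * x = U * (T * x)" by (rule assoc_mult_mat) (use assms in auto)
  also have "\<dots> = (U * y) * T" unfolding assms(6) by (rule assoc_mult_mat[symmetric]) (use assms in auto)
  also have "\<dots> = z * (U * T)" unfolding assms(7) by (rule assoc_mult_mat) (use assms in auto)
  finally show ?thesis .
qed

lemma scaled_normalizer_mult:
  assumes T: "T \<in> scaled_normalizer" and U: "U \<in> scaled_normalizer"
  shows "U * T \<in> scaled_normalizer"
  unfolding scaled_normalizer_def
proof (intro CollectI conjI ballI)
  show "U * T \<in> carrier (GL TYPE('a) n)"
    using T U monoid.m_closed[OF group.is_monoid[OF group_GL], of U n T]
    by (simp add: scaled_normalizer_def)
  fix x assume x: "x \<in> scaled"
  obtain y where y: "y \<in> scaled" "T * x = y * T"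
    using T x by (auto simp: scaled_normalizer_def)
  obtain z where z: "z \<in> scaled" "U * y = z * U"
    using U y(1) by (auto simp: scaled_normalizer_def)
  have "(U * T) * x = z * (U * T)"
    by (rule intertwine_trans[OF scaled_normalizer_carrier[OF T] scaled_normalizer_carrier[OF U]
          scaled_carrier[OF x] scaled_carrier[OF y(1)] scaled_carrier[OF z(1)] y(2) z(2)])
  then show "\<exists>y\<in>scaled. U * T * x = y * (U * T)" using z(1) by blast
qed

text \<open>Elements of \<open>scaled\<close> commute up to scalars, so conjugation among them only
  rescales.\<close>

lemma scaled_subset_normalizer: "scaled \<subseteq> scaled_normalizer"
proof
  fix T assume T: "T \<in> scaled"
  show "T \<in> scaled_normalizer"
    unfolding scaled_normalizer_def
  proof (intro CollectI conjI ballI)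
    show "T \<in> carrier (GL TYPE('a) n)" by (rule scaled_GL[OF T])
    fix x assume x: "x \<in> scaled"
    obtain c where c: "c ^ r = 1" "T * x = c \<cdot>\<^sub>m (x * T)" using scaled_comm[OF T x] by blast
    have "c \<noteq> 0" using c(1) r_pos by (auto simp: power_0_left)
    moreover have "T * x = (c \<cdot>\<^sub>m x) * T"
      using c(2) scaled_carrier[OF T] scaled_carrier[OF x] by (simp add: mult_smult_assoc_mat[of _ n n _ n])
    ultimately show "\<exists>y\<in>scaled. T * x = y * T" using scaled_smult x by blast
  qed
qed

lemma subgroup_scaled_normalizer: "subgroup scaled_normalizer (GL TYPE('a) n)"
proof (rule group.finite_subgroupI[OF group_GL])
  show sub: "scaled_normalizer \<subseteq> carrier (GL TYPE('a) n)" by (auto simp: scaled_normalizer_def)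
  show "finite scaled_normalizer" by (rule finite_subset[OF sub]) simp
  show "scaled_normalizer \<noteq> {}" using scaled_subset_normalizer R_scaled[OF one_in_R] by auto
qed (simp add: scaled_normalizer_mult)

abbreviation "NG \<equiv> GL TYPE('a) n\<lparr>carrier := scaled_normalizer\<rparr>"

lemma group_NG: "group NG"
  by (rule group.subgroup_imp_group[OF group_GL subgroup_scaled_normalizer])

lemma NG_inv:
  assumes "T \<in> scaled_normalizer"
  shows "inv\<^bsub>NG\<^esub> T \<in> scaled_normalizer" "T * inv\<^bsub>NG\<^esub> T = 1\<^sub>m n" "inv\<^bsub>NG\<^esub> T * T = 1\<^sub>m n"
  using group.inv_closed[OF group_NG, of T] group.r_inv[OF group_NG, of T]
    group.l_inv[OF group_NG, of T] assms by auto

lemma conj_eq: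
  assumes T: "T \<in> scaled_normalizer" and y: "y \<in> carrier_mat n n" and eq: "T * x = y * T"
  shows "T * x * inv\<^bsub>NG\<^esub> T = y"
proof -
  have "T * x * inv\<^bsub>NG\<^esub> T = y * (T * inv\<^bsub>NG\<^esub> T)"
    unfolding eq by (rule assoc_mult_mat[OF y scaled_normalizer_carrier[OF T]
          scaled_normalizer_carrier[OF NG_inv(1)[OF T]]])
  then show ?thesis using y NG_inv(2)[OF T] by simp
qed

lemma scaled_normal: "scaled \<lhd> NG"
proof (rule group.normal_invI[OF group_NG])
  show "subgroup scaled NG"
    by (rule group.subgroup_incl[OF group_GL subgroup_scaled subgroup_scaled_normalizer
          scaled_subset_normalizer])
  fix T x assume T: "T \<in> carrier NG" and x: "x \<in> scaled"
  obtain y where y: "y \<in> scaled" "T * x = y * T"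
    using T x by (auto simp: scaled_normalizer_def)
  then show "T \<otimes>\<^bsub>NG\<^esub> x \<otimes>\<^bsub>NG\<^esub> inv\<^bsub>NG\<^esub> T \<in> scaled"
    using conj_eq[of T y x] T scaled_carrier by simp
qed

section \<open>Roots as a single conjugacy class of the normalizer\<close>

definition roots :: "'a mat set" where
  "roots = {x \<in> scaled. x ^\<^sub>m r = e \<cdot>\<^sub>m 1\<^sub>m n \<and> (\<forall>a. x \<noteq> a \<cdot>\<^sub>m 1\<^sub>m n)}"

lemma scaled_scalar_iff:
  assumes "c \<noteq> 0" "x \<in> R"
  shows "(\<exists>a. c \<cdot>\<^sub>m x = a \<cdot>\<^sub>m 1\<^sub>m n) \<longleftrightarrow> x = 1\<^sub>m n"
proof
  assume "\<exists>a. c \<cdot>\<^sub>m x = a \<cdot>\<^sub>m 1\<^sub>m n"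
  then obtain a where "a \<cdot>\<^sub>m 1\<^sub>m n = c \<cdot>\<^sub>m x" by metis
  then show "x = 1\<^sub>m n" using R_proportional[OF one_in_R assms(2)] assms(1) by metis
qed auto

text \<open>For each of the \<open>n * n - 1\<close> nonidentity \<open>x \<in> R\<close>, the
  scalars \<open>c\<close> with \<open>(c \<cdot>\<^sub>m x) ^\<^sub>m r = e \<cdot>\<^sub>m
  1\<^sub>m n\<close> form one coset of the group of \<open>r\<close>-th roots of unity.\<close>

lemma card_roots:
  assumes unity: "card {c :: 'a. c ^ r = 1} = r"
  shows "card roots = r * (n * n - 1)"
proof -
  have "\<forall>x\<in>R - {1\<^sub>m n}. \<exists>c. c \<noteq> 0 \<and> (c \<cdot>\<^sub>m x) ^\<^sub>m r = e \<cdot>\<^sub>m 1\<^sub>m n" using scale by blast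
  then obtain k where k: "\<And>x. x \<in> R \<Longrightarrow> x \<noteq> 1\<^sub>m n \<Longrightarrow> k x \<noteq> 0 \<and> (k x \<cdot>\<^sub>m x) ^\<^sub>m r = e \<cdot>\<^sub>m 1\<^sub>m n"
    by (metis DiffI singletonD)
  let ?f = "\<lambda>(c, x). (c * k x) \<cdot>\<^sub>m x"
  have c0: "c \<noteq> 0" if "c ^ r = 1" for c :: 'a
    using that r_pos by (auto simp: power_0_left)
  have pow: "(c \<cdot>\<^sub>m x) ^\<^sub>m r = c ^ r \<cdot>\<^sub>m (x ^\<^sub>m r)" if "x \<in> R" for c x
    by (rule pow_smult_mat[OF R_carrier[OF that]])
  have "bij_betw ?f ({c. c ^ r = 1} \<times> (R - {1\<^sub>m n})) roots"
    unfolding bij_betw_def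
  proof
    show "inj_on ?f ({c. c ^ r = 1} \<times> (R - {1\<^sub>m n}))"
    proof (rule inj_onI)
      fix u v assume uv: "u \<in> {c. c ^ r = 1} \<times> (R - {1\<^sub>m n})" "v \<in> {c. c ^ r = 1} \<times> (R - {1\<^sub>m n})"
        "?f u = ?f v"
      obtain a x b y where ab: "u = (a, x)" "v = (b, y)" by (cases u, cases v) blast
      have "(a * k x) \<cdot>\<^sub>m x = (b * k y) \<cdot>\<^sub>m y" "b * k y \<noteq> 0" "x \<in> R" "y \<in> R" "x \<noteq> 1\<^sub>m n"
        using uv ab k c0 by auto
      then have "x = y" "a * k x = b * k y" using R_proportional by blast+
      then show "u = v" using ab k[OF \<open>x \<in> R\<close> \<open>x \<noteq> 1\<^sub>m n\<close>] by simp
    qed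
    show "?f ` ({c. c ^ r = 1} \<times> (R - {1\<^sub>m n})) = roots"
    proof (intro equalityI subsetI)
      fix y assume "y \<in> ?f ` ({c. c ^ r = 1} \<times> (R - {1\<^sub>m n}))"
      then obtain c x where c: "c ^ r = 1" and x: "x \<in> R" "x \<noteq> 1\<^sub>m n" and y: "y = (c * k x) \<cdot>\<^sub>m x"
        by auto
      have "y ^\<^sub>m r = c ^ r \<cdot>\<^sub>m ((k x \<cdot>\<^sub>m x) ^\<^sub>m r)"
        unfolding y pow[OF x(1)] by (simp add: smult_smult_mat power_mult_distrib)
      then have "y ^\<^sub>m r = e \<cdot>\<^sub>m 1\<^sub>m n" using k[OF x] c by simp
      then show "y \<in> roots"
        using scaledI[of "c * k x" x] scaled_scalar_iff[of "c * k x" x] k[OF x] c0[OF c] x y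
        unfolding roots_def by auto
    next
      fix y assume y: "y \<in> roots"
      then obtain c x where cx: "c \<noteq> 0" "x \<in> R" "y = c \<cdot>\<^sub>m x" unfolding roots_def by (auto elim: scaledE)
      have x1: "x \<noteq> 1\<^sub>m n" using y cx scaled_scalar_iff[of c x] unfolding roots_def by auto
      have "y ^\<^sub>m r = e \<cdot>\<^sub>m 1\<^sub>m n" using y by (simp add: roots_def)
      then have "c ^ r \<cdot>\<^sub>m (x ^\<^sub>m r) = e \<cdot>\<^sub>m 1\<^sub>m n" unfolding cx(3) pow[OF cx(2)] .
      moreover have kx: "k x ^ r \<cdot>\<^sub>m (x ^\<^sub>m r) = e \<cdot>\<^sub>m 1\<^sub>m n"
        using k[OF cx(2) x1] pow[OF cx(2)] by simp
      moreover have "(c / k x) ^ r * k x ^ r = c ^ r"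
        using k[OF cx(2) x1] by (simp add: power_divide)
      ultimately have "(c / k x) ^ r \<cdot>\<^sub>m (e \<cdot>\<^sub>m 1\<^sub>m n) = e \<cdot>\<^sub>m (1\<^sub>m n :: 'a mat)"
        by (metis smult_smult_mat)
      then have "(c / k x) ^ r = 1"
        using e_nonzero by (simp add: smult_smult_mat smult_one_mat_eq_iff[OF n_pos])
      moreover have "y = ((c / k x) * k x) \<cdot>\<^sub>m x" using cx(3) k[OF cx(2) x1] by simp
      ultimately show "y \<in> ?f ` ({c. c ^ r = 1} \<times> (R - {1\<^sub>m n}))"
        using cx(2) x1 by (intro image_eqI[of _ _ "(c / k x, x)"]) auto
    qed
  qed
  then have "card roots = card ({c :: 'a. c ^ r = 1} \<times> (R - {1\<^sub>m n}))"
    by (rule bij_betw_same_card[symmetric])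
  then show ?thesis
    using unity one_in_R card_R by (simp add: card_cartesian_product card_Diff_singleton)
qed

lemma roots_not_central:
  assumes "s \<in> roots"
  shows "\<exists>x\<in>R. s * x \<noteq> x * s"
  using commutes_with_R_imp_scalar[of s] assms scaled_carrier unfolding roots_def by blast

text \<open>The centralizers of two roots are proper subgroups, so they do not cover \<open>scaled\<close>.\<close>

lemma common_noncommuting_root:
  assumes s: "s \<in> roots" and t: "t \<in> roots"
  shows "\<exists>w\<in>roots. s * w \<noteq> w * s \<and> t * w \<noteq> w * t"
proof -
  have sc: "s \<in> carrier_mat n n" and tc: "t \<in> carrier_mat n n"
    using s t scaled_carrier by (auto simp: roots_def)
  \<comment> \<open>If \<open>u\<close> commutes with a product and with one of its invertible
    factors, it commutes with the other factor.\<close>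
  have cancel: "u * (x * y) \<noteq> (x * y) * u"
    if u: "u \<in> carrier_mat n n" and x: "x \<in> R" and y: "y \<in> R"
      and *: "(u * x = x * u \<and> u * y \<noteq> y * u) \<or> (u * x \<noteq> x * u \<and> u * y = y * u)" for u x y
  proof
    note xc = R_carrier[OF x] and yc = R_carrier[OF y]
    assume eq: "u * (x * y) = (x * y) * u"
    from * show False
    proof
      assume xy: "u * x = x * u \<and> u * y \<noteq> y * u"
      obtain z where z: "z \<in> carrier_mat n n" "x * z = 1\<^sub>m n" using dual[OF x] by blast
      have zx: "z * x = 1\<^sub>m n" by (rule mat_mult_left_right_inverse[OF xc z])
      have "x * (u * y) = (u * x) * y"
        using xy assoc_mult_mat[OF xc u yc] by simp
      also have "\<dots> = x * (y * u)"
        using eq assoc_mult_mat[OF u xc yc] assoc_mult_mat[OF xc yc u] by simp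
      finally have "z * x * (u * y) = z * x * (y * u)"
        using assoc_mult_mat[OF z(1) xc, of _ n] u yc by simp
      then show False using xy u yc by (simp add: zx)
    next
      assume xy: "u * x \<noteq> x * u \<and> u * y = y * u"
      obtain z where z: "z \<in> carrier_mat n n" "y * z = 1\<^sub>m n" using dual[OF y] by blast
      have "(u * x) * y = x * (u * y)"
        using eq xy assoc_mult_mat[OF u xc yc] assoc_mult_mat[OF xc yc u] by simp
      also have "\<dots> = (x * u) * y"
        using assoc_mult_mat[OF xc u yc] by simp
      finally have "(u * x) * (y * z) = (x * u) * (y * z)"
        using assoc_mult_mat[OF _ yc z(1), of "u * x" n] assoc_mult_mat[OF _ yc z(1), of "x * u" n]
          u xc by simp
      then show False using xy u xc by (simp add: z)
    qed
  qed
  obtain x where x: "x \<in> R" "s * x \<noteq> x * s" using roots_not_central[OF s] by blast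
  obtain y where y: "y \<in> R" "t * y \<noteq> y * t" using roots_not_central[OF t] by blast
  \<comment> \<open>If \<open>x\<close> commutes with \<open>t\<close> and \<open>y\<close> with
    \<open>s\<close>, the product \<open>x * y\<close> commutes with neither; otherwise
    \<open>x\<close> or \<open>y\<close> itself serves.\<close>
  have "\<exists>w\<in>scaled. s * w \<noteq> w * s \<and> t * w \<noteq> w * t"
  proof (cases "t * x = x * t \<and> s * y = y * s")
    case True
    have "x * y \<in> scaled" by (rule scaled_mult[OF R_scaled[OF x(1)] R_scaled[OF y(1)]])
    moreover have "s * (x * y) \<noteq> x * y * s" using cancel[OF sc x(1) y(1)] x(2) True by simp
    moreover have "t * (x * y) \<noteq> x * y * t" using cancel[OF tc x(1) y(1)] y(2) True by simp
    ultimately show ?thesis by blast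
  next
    case False
    then show ?thesis
    proof (cases "t * x = x * t")
      case True
      with False show ?thesis using y R_scaled[OF y(1)] by (intro bexI[of _ y]) auto
    next
      case False
      then show ?thesis using x R_scaled[OF x(1)] by (intro bexI[of _ x]) auto
    qed
  qed
  then obtain w where w: "w \<in> scaled" "s * w \<noteq> w * s" "t * w \<noteq> w * t" by blast
  obtain c z where z: "c \<noteq> 0" "z \<in> R" "w = c \<cdot>\<^sub>m z" using w(1) by (rule scaledE)
  note zc = R_carrier[OF z(2)]
  have smult_comm: "u * (d \<cdot>\<^sub>m z) = d \<cdot>\<^sub>m z * u \<longleftrightarrow> u * z = z * u"
    if "u \<in> carrier_mat n n" "d \<noteq> 0" for u d
  proof -
    have "u * (d \<cdot>\<^sub>m z) = d \<cdot>\<^sub>m (u * z)" "d \<cdot>\<^sub>m z * u = d \<cdot>\<^sub>m (z * u)"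
      using that zc by (auto simp: mult_smult_distrib[of _ n n] mult_smult_assoc_mat[of _ n n _ n])
    then show ?thesis
      using that(2) by (metis left_inverse one_smult_mat smult_smult_mat)
  qed
  have nz: "s * z \<noteq> z * s" "t * z \<noteq> z * t"
    using w z smult_comm[OF sc z(1)] smult_comm[OF tc z(1)] by auto
  have z1: "z \<noteq> 1\<^sub>m n" using nz(1) sc by auto
  \<comment> \<open>Rescaling turns the witness into a root without changing what it commutes
    with.\<close>
  obtain d where d: "d \<noteq> 0" "(d \<cdot>\<^sub>m z) ^\<^sub>m r = e \<cdot>\<^sub>m 1\<^sub>m n" using scale[OF z(2) z1] by blast
  have "d \<cdot>\<^sub>m z \<in> roots"
    using scaledI[OF d(1) z(2)] d scaled_scalar_iff[OF d(1) z(2)] z1 unfolding roots_def by auto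
  then show ?thesis
    using smult_comm[OF sc d(1)] smult_comm[OF tc d(1)] nz by (intro bexI[of _ "d \<cdot>\<^sub>m z"]) simp_all
qed

text \<open>Conjugation preserves the \<open>r\<close>-th power, which is scalar, and the property
  of being nonscalar, so the orbit stays inside \<open>roots\<close>. Conversely, two commuting
  roots are linked by a root that commutes with neither, and the two intertwiners compose.\<close>

lemma roots_single_orbit:
  assumes conj: "\<And>s t. \<lbrakk>s \<in> roots; t \<in> roots; s * t \<noteq> t * s\<rbrakk> \<Longrightarrow> \<exists>T\<in>scaled_normalizer. T * s = t * T"
    and s: "s \<in> roots"
  shows "orbit NG (\<lambda>g. \<lambda>h\<in>carrier NG. g \<otimes>\<^bsub>NG\<^esub> h \<otimes>\<^bsub>NG\<^esub> inv\<^bsub>NG\<^esub> g) s = roots"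
proof (intro equalityI subsetI)
  have rc: "x \<in> scaled" "x \<in> carrier_mat n n" "x \<in> scaled_normalizer" if "x \<in> roots" for x
    using that scaled_carrier scaled_subset_normalizer by (auto simp: roots_def)
  fix y assume "y \<in> orbit NG (\<lambda>g. \<lambda>h\<in>carrier NG. g \<otimes>\<^bsub>NG\<^esub> h \<otimes>\<^bsub>NG\<^esub> inv\<^bsub>NG\<^esub> g) s"
  then obtain T where T: "T \<in> scaled_normalizer" and y: "y = T * s * inv\<^bsub>NG\<^esub> T"
    using rc(3)[OF s] by (auto simp: orbit_def)
  note Tc = scaled_normalizer_carrier[OF T]
  obtain z where z: "z \<in> scaled" "T * s = z * T"
    using T rc(1)[OF s] by (auto simp: scaled_normalizer_def)
  note zc = scaled_carrier[OF z(1)]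
  have yz: "y = z" unfolding y by (rule conj_eq[OF T zc z(2)])
  obtain T' where T': "T' \<in> carrier_mat n n" "T * T' = 1\<^sub>m n" "T' * T = 1\<^sub>m n"
    using NG_inv[OF T] scaled_normalizer_carrier by blast
  have "z ^\<^sub>m r * T = T * s ^\<^sub>m r"
    by (rule intertwine_pow_mat[OF Tc rc(2)[OF s] zc z(2), symmetric])
  also have "\<dots> = e \<cdot>\<^sub>m T"
    using s Tc by (simp add: roots_def mult_smult_distrib[of _ n n _ n])
  finally have "z ^\<^sub>m r * T * T' = e \<cdot>\<^sub>m 1\<^sub>m n"
    using Tc T' by (simp add: mult_smult_assoc_mat[of _ n n _ n])
  then have "z ^\<^sub>m r = e \<cdot>\<^sub>m 1\<^sub>m n"
    using assoc_mult_mat[OF pow_carrier_mat[OF zc, of r] Tc T'(1)] T'(2)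
      right_mult_one_mat[OF pow_carrier_mat[OF zc, of r]] by simp
  moreover have "z \<noteq> a \<cdot>\<^sub>m 1\<^sub>m n" for a
  proof
    assume "z = a \<cdot>\<^sub>m 1\<^sub>m n"
    then have "T * s = a \<cdot>\<^sub>m T" using z(2) Tc by (simp add: mult_smult_assoc_mat[of _ n n _ n])
    then have "T' * (T * s) = a \<cdot>\<^sub>m 1\<^sub>m n" using T' Tc by (simp add: mult_smult_distrib[of _ n n _ n])
    then have "s = a \<cdot>\<^sub>m 1\<^sub>m n"
      using T' Tc rc(2)[OF s] by (metis assoc_mult_mat left_mult_one_mat)
    then show False using s unfolding roots_def by blast
  qed
  ultimately show "y \<in> roots" using z(1) yz by (simp add: roots_def)
next
  have rc: "x \<in> scaled" "x \<in> carrier_mat n n" "x \<in> scaled_normalizer" if "x \<in> roots" for x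
    using that scaled_carrier scaled_subset_normalizer by (auto simp: roots_def)
  fix t assume t: "t \<in> roots"
  have "\<exists>T\<in>scaled_normalizer. T * s = t * T"
  proof (cases "s * t = t * s")
    case False
    then show ?thesis using conj s t by blast
  next
    case True
    obtain w where w: "w \<in> roots" "s * w \<noteq> w * s" "t * w \<noteq> w * t"
      using common_noncommuting_root[OF s t] by blast
    obtain T where T: "T \<in> scaled_normalizer" "T * s = w * T" using conj[OF s w(1,2)] by blast
    obtain U where U: "U \<in> scaled_normalizer" "U * w = t * U"
      using conj[OF w(1) t w(3)[symmetric]] by blast
    have "(U * T) * s = t * (U * T)"
      by (rule intertwine_trans[OF _ _ _ _ _ T(2) U(2)])
        (use rc s t w T U scaled_normalizer_carrier in auto)
    then show ?thesis using scaled_normalizer_mult[OF T(1) U(1)] by blast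
  qed
  then obtain T where T: "T \<in> scaled_normalizer" "T * s = t * T" by blast
  have "t = T * s * inv\<^bsub>NG\<^esub> T" by (rule conj_eq[OF T(1) rc(2)[OF t] T(2), symmetric])
  then show "t \<in> orbit NG (\<lambda>g. \<lambda>h\<in>carrier NG. g \<otimes>\<^bsub>NG\<^esub> h \<otimes>\<^bsub>NG\<^esub> inv\<^bsub>NG\<^esub> g) s"
    unfolding orbit_def using T(1) rc(3)[OF s] by auto
qed

text \<open>The exact order of the normalizer is not computed: the orbit length
  \<open>r * (n * n - 1)\<close> divides it. Since \<open>p\<close> does not divide
  \<open>card scaled\<close>, a preimage of a \<open>p\<close>-subgroup of the quotient has exponent
  exactly \<open>c\<close>, and it is irreducible because it contains \<open>R\<close>.\<close>

lemma base_group_nice_error_basis: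
  assumes conj: "\<And>s t. \<lbrakk>s \<in> roots; t \<in> roots; s * t \<noteq> t * s\<rbrakk> \<Longrightarrow> \<exists>T\<in>scaled_normalizer. T * s = t * T"
    and unity: "card {c :: 'a. c ^ r = 1} = r" and n: "n > 1"
    and p: "prime p" and c: "c = 1 \<or> p = 2" and dvd: "p ^ c dvd r * (n * n - 1)"
    and coprime: "\<not> p dvd CARD('a) - 1" "\<not> p dvd n"
  shows "base_group TYPE('a) p n c"
proof -
  have cr: "card roots = r * (n * n - 1)" by (rule card_roots[OF unity])
  have "n * n - 1 > 0" using n by (cases n) auto
  then have "card roots > 0" using cr r_pos by simp
  then obtain s where s: "s \<in> roots" by (metis card_gt_0_iff ex_in_conv)
  interpret act: group_action NG "carrier NG"
      "\<lambda>g. \<lambda>h\<in>carrier NG. g \<otimes>\<^bsub>NG\<^esub> h \<otimes>\<^bsub>NG\<^esub> inv\<^bsub>NG\<^esub> g"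
    by (rule group.action_by_conjugation[OF group_NG])
  have sN: "s \<in> carrier NG" using s scaled_subset_normalizer by (auto simp: roots_def)
  let ?conj = "\<lambda>g. \<lambda>h\<in>carrier NG. g \<otimes>\<^bsub>NG\<^esub> h \<otimes>\<^bsub>NG\<^esub> inv\<^bsub>NG\<^esub> g"
  have orb: "orbit NG ?conj s = roots"
    by (rule roots_single_orbit[OF _ s]) (rule conj)
  have "Coset.order NG = card (orbit NG ?conj s) * card (stabilizer NG ?conj s)"
    by (rule act.orbit_stabilizer_theorem[OF sN, symmetric])
  then have "card roots dvd Coset.order NG"
    unfolding orb by (rule dvdI)
  with dvd have d: "p ^ c dvd Coset.order NG" unfolding cr[symmetric] by (rule dvd_trans)
  have fin: "finite (carrier NG)"
    using finite_subset[OF subgroup.subset[OF subgroup_scaled_normalizer]] by simp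
  have "\<not> p dvd card scaled"
    unfolding card_scaled using coprime p by (simp add: prime_dvd_mult_iff)
  then obtain G where G: "subgroup G NG" "scaled \<subseteq> G" "multiplicity p (card G) = c"
      "p_solvable TYPE('a mat set) p (NG\<lparr>carrier := G\<rparr>)"
    using subgroup_with_p_part[OF group_NG fin scaled_normal _ p c d] by metis
  have sub: "subgroup G (GL TYPE('a) n)"
    using group.incl_subgroup[OF group_GL subgroup_scaled_normalizer G(1)] .
  have "irreducible_linear_group TYPE('a) n G"
    by (rule irreducible_if_contains_R[OF sub]) (use G(2) R_scaled in blast)
  moreover have "G \<noteq> {1\<^sub>m n}"
  proof
    assume "G = {1\<^sub>m n}"
    then have "s = 1\<^sub>m n" using s G(2) by (auto simp: roots_def)
    moreover have "s \<noteq> 1 \<cdot>\<^sub>m 1\<^sub>m n" using s unfolding roots_def by blast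
    ultimately show False by simp
  qed
  ultimately show ?thesis
    unfolding base_group_def using G(3,4) by (intro exI[of _ G]) simp
qed

end

section \<open>Explicit intertwiners between noncommuting roots\<close>

lemma square_mat_mult_carrier:
  "A \<in> carrier_mat n n \<Longrightarrow> B \<in> carrier_mat n n \<Longrightarrow> A * B \<in> carrier_mat n n"
  by simp

context nice_error_basis
begin

text \<open>Products are expanded and bracketed to the right, scalars are moved to the front. The
  dimensions are fixed so that the carrier conditions can be discharged during rewriting.\<close>

lemmas mat_ring_simps = square_mat_mult_carrier[of _ n] add_carrier_mat smult_carrier_mat one_carrier_mat
  mult_add_distrib_mat[of _ n n _ n] add_mult_distrib_mat[of _ n n _ _ n]
  mult_smult_distrib[of _ n n _ n] mult_smult_assoc_mat[of _ n n _ n] assoc_mult_mat[of _ n n _ n _ n]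
  smult_smult_mat right_mult_one_mat[of _ n n] left_mult_one_mat[of _ n n]

lemma roots_commutator:
  assumes "s \<in> roots" "t \<in> roots" "s * t \<noteq> t * s"
  shows "\<exists>c. c ^ r = 1 \<and> c \<noteq> 1 \<and> s * t = c \<cdot>\<^sub>m (t * s)"
proof -
  obtain c where "c ^ r = 1" "s * t = c \<cdot>\<^sub>m (t * s)"
    using scaled_comm[of s t] assms by (auto simp: roots_def)
  moreover from this assms(3) have "c \<noteq> 1" by auto
  ultimately show ?thesis by blast
qed

text \<open>The roots anticommute and have square \<open>-1\<close>, so
  \<open>(s + t) * s = t * s - 1 = t * (s + t)\<close>. The cross terms of the square of
  \<open>s + t\<close> cancel, leaving \<open>-2\<close>, which is invertible.\<close>

lemma roots_conjugate_order_two: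
  assumes r: "r = 2" and e: "e = -1" and two: "(2 :: 'a) \<noteq> 0"
    and s: "s \<in> roots" and t: "t \<in> roots" and st: "s * t \<noteq> t * s"
  shows "\<exists>T\<in>scaled_normalizer. T * s = t * T"
proof -
  have sc: "s \<in> carrier_mat n n" and tc: "t \<in> carrier_mat n n" and sE: "s \<in> scaled" and tE: "t \<in> scaled"
    using s t scaled_carrier by (auto simp: roots_def)
  have sq: "x * x = (-1) \<cdot>\<^sub>m 1\<^sub>m n" if "x \<in> roots" for x
  proof -
    have "x ^\<^sub>m r = e \<cdot>\<^sub>m 1\<^sub>m n" and "x \<in> scaled" using that by (simp_all add: roots_def)
    then have "x ^\<^sub>m 2 = (-1) \<cdot>\<^sub>m 1\<^sub>m n" "x \<in> carrier_mat n n"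
      using scaled_carrier r e by simp_all
    then show ?thesis by (simp add: numeral_2_eq_2)
  qed
  obtain c where c: "c\<^sup>2 = 1" "c \<noteq> 1" "s * t = c \<cdot>\<^sub>m (t * s)"
    using roots_commutator[OF s t st] r by auto
  then have comm: "s * t = (-1) \<cdot>\<^sub>m (t * s)" by (simp add: power2_eq_1_iff)
  have comm': "s * (t * x) = (-1) \<cdot>\<^sub>m (t * (s * x))" if "x \<in> carrier_mat n n" for x
  proof -
    have "s * (t * x) = (s * t) * x" using sc tc that by (simp add: mat_ring_simps)
    also have "\<dots> = (-1) \<cdot>\<^sub>m (t * (s * x))" unfolding comm using sc tc that by (simp add: mat_ring_simps)
    finally show ?thesis .
  qed
  note sq = sq[OF s] sq[OF t]
  have sq': "s * (s * x) = (-1) \<cdot>\<^sub>m x" "t * (t * x) = (-1) \<cdot>\<^sub>m x" if "x \<in> carrier_mat n n" for x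
    using sq sc tc that
    by (simp_all add: assoc_mult_mat[of _ n n _ n _ n, symmetric] mult_smult_assoc_mat[of _ n n _ n])
  define T where "T = s + t"
  have Tc: "T \<in> carrier_mat n n" using sc tc by (simp add: T_def)
  have "T * s = t * T"
    unfolding T_def using sc tc sq by (simp add: mat_ring_simps comm_add_mat[of _ n n])
  moreover have "T \<in> scaled_normalizer"
  proof (rule scaled_normalizerI[OF Tc])
    show "(- 1 / 2) \<cdot>\<^sub>m T \<in> carrier_mat n n" using Tc by simp
    have "T * T = (-2) \<cdot>\<^sub>m 1\<^sub>m n"
      unfolding T_def using sc tc
      by (simp add: mat_ring_simps sq comm) (rule eq_matI, auto)
    then show "T * ((- 1 / 2) \<cdot>\<^sub>m T) = 1\<^sub>m n"
      using Tc two by (simp add: mat_ring_simps)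
  next
    fix v assume v: "v \<in> scaled"
    note vc = scaled_carrier[OF v]
    obtain a where a: "a\<^sup>2 = 1" "s * v = a \<cdot>\<^sub>m (v * s)" using scaled_comm[OF sE v] r by auto
    obtain b where b: "b\<^sup>2 = 1" "t * v = b \<cdot>\<^sub>m (v * t)" using scaled_comm[OF tE v] r by auto
    have Tv: "T * v = a \<cdot>\<^sub>m (v * s) + b \<cdot>\<^sub>m (v * t)"
      unfolding T_def using sc tc vc a b by (simp add: mat_ring_simps)
    have ab: "a = b \<or> b = - a" "a \<noteq> 0" using a(1) b(1) by (auto simp: power2_eq_1_iff)
    from ab(1) show "\<exists>y\<in>scaled. T * v = y * T"
    proof
      assume "a = b"
      then have "T * v = (a \<cdot>\<^sub>m v) * T"
        unfolding Tv unfolding T_def using sc tc vc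
        by (simp add: mat_ring_simps add_smult_distrib_left_mat[of _ n n])
      then show ?thesis using scaled_smult[OF ab(2) v] by blast
    next
      assume "b = - a"
      \<comment> \<open>Opposite signs turn \<open>s + t\<close> into \<open>a * (s - t)\<close>
        when moved past \<open>v\<close>, and \<open>t * s * (s + t) = s - t\<close>.\<close>
      have "(a \<cdot>\<^sub>m (v * (t * s))) * T = T * v"
        unfolding Tv unfolding T_def \<open>b = - a\<close> using sc tc vc
        by (simp add: mat_ring_simps sq sq' comm comm') (rule eq_matI, auto)
      moreover have "a \<cdot>\<^sub>m (v * (t * s)) \<in> scaled"
        using scaled_smult[OF ab(2)] scaled_mult v sE tE by simp
      ultimately show ?thesis by metis
    qed
  qed
  ultimately show ?thesis by blast
qed

text \<open>The intertwiner is a quadratic Gauss sum in \<open>u = t * inverse s\<close>, with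
  coefficients \<open>c ^ (j * (j - 1) div 2)\<close> at \<open>u ^ j\<close>. Moving it past an
  element of \<open>scaled\<close> replaces \<open>u\<close> by a multiple \<open>a * u\<close>, and
  this multiplies the Gauss sum by a scalar times a power of \<open>u\<close>.\<close>

lemma roots_conjugate_order_three:
  assumes r: "r = 3" and e: "e = 1" and two: "(1 :: 'a) + 1 = 0"
    and s: "s \<in> roots" and t: "t \<in> roots" and st: "s * t \<noteq> t * s"
  shows "\<exists>T\<in>scaled_normalizer. T * s = t * T"
proof -
  have sc: "s \<in> carrier_mat n n" and tc: "t \<in> carrier_mat n n" and sE: "s \<in> scaled" and tE: "t \<in> scaled"
    using s t scaled_carrier by (auto simp: roots_def)
  have cube: "x * (x * x) = 1\<^sub>m n" if "x \<in> roots" for x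
  proof -
    have "x ^\<^sub>m r = e \<cdot>\<^sub>m 1\<^sub>m n" and "x \<in> scaled" using that by (simp_all add: roots_def)
    then have "x ^\<^sub>m 3 = 1\<^sub>m n" "x \<in> carrier_mat n n"
      using scaled_carrier r e by simp_all
    then show ?thesis by (simp add: numeral_3_eq_3 mat_ring_simps)
  qed
  obtain c where c: "c ^ 3 = 1" "c \<noteq> 1" "s * t = c \<cdot>\<^sub>m (t * s)"
    using roots_commutator[OF s t st] r by auto
  have c_sum: "1 + c + c * c = 0"
  proof -
    have "(c - 1) * (1 + c + c * c) = c ^ 3 - 1" by (simp add: algebra_simps power3_eq_cube)
    then show ?thesis using c by simp
  qed
  have ccc: "c * (c * c) = 1" using c(1) by (simp add: power3_eq_cube mult.assoc)
  \<comment> \<open>Because \<open>s\<close> has order three, \<open>s * s\<close> is its inverse,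
    so \<open>u * s = t\<close>.\<close>
  define u where "u = t * (s * s)"
  have uE: "u \<in> scaled" unfolding u_def using scaled_mult sE tE by simp
  note uc = scaled_carrier[OF uE]
  have us: "u * s = t" unfolding u_def using sc tc cube[OF s] by (simp add: mat_ring_simps)
  have su: "s * u = c \<cdot>\<^sub>m (u * s)"
  proof -
    have "s * u = (s * t) * (s * s)" unfolding u_def using sc tc by (simp add: mat_ring_simps)
    also have "\<dots> = c \<cdot>\<^sub>m t" unfolding c(3) using sc tc cube[OF s] by (simp add: mat_ring_simps)
    finally show ?thesis unfolding us .
  qed
  have su': "s * (u * x) = c \<cdot>\<^sub>m (u * (s * x))" if "x \<in> carrier_mat n n" for x
  proof -
    have "s * (u * x) = (s * u) * x" using sc uc that by (simp add: mat_ring_simps)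
    also have "\<dots> = c \<cdot>\<^sub>m (u * (s * x))" unfolding su using sc uc that by (simp add: mat_ring_simps)
    finally show ?thesis .
  qed
  have u3: "u * (u * u) = 1\<^sub>m n"
  proof -
    have "t * (t * t) = (c * (c * c)) \<cdot>\<^sub>m (u * (u * (u * (s * (s * s)))))"
      unfolding us[symmetric] using sc uc by (simp add: mat_ring_simps su')
    then show ?thesis using cube[OF t] cube[OF s] uc ccc by (simp add: mat_ring_simps)
  qed
  have u3': "u * (u * (u * x)) = x" if "x \<in> carrier_mat n n" for x
  proof -
    have "u * (u * (u * x)) = (u * (u * u)) * x" using uc that by (simp add: mat_ring_simps)
    then show ?thesis unfolding u3 using that by simp
  qed
  define T where "T = 1\<^sub>m n + u + c \<cdot>\<^sub>m (u * u)"
  have Tc: "T \<in> carrier_mat n n" using uc by (simp add: T_def mat_ring_simps)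
  have "T * s = u * s * T"
    unfolding T_def using sc uc
    by (simp add: mat_ring_simps su su' u3' ccc) (rule eq_matI, auto simp: algebra_simps ccc)
  then have "T * s = t * T" unfolding us .
  moreover have "T \<in> scaled_normalizer"
  proof (rule scaled_normalizerI[OF Tc])
    \<comment> \<open>In \<open>T * ?T'\<close> the coefficients of \<open>u\<close> and
      \<open>u * u\<close> are \<open>1 + c + c * c = 0\<close>, and the constant term is
      \<open>3 = 1\<close> in characteristic two.\<close>
    let ?T' = "1\<^sub>m n + (c * c) \<cdot>\<^sub>m u + u * u"
    show "?T' \<in> carrier_mat n n" using uc by (simp add: mat_ring_simps)
    have entry: "a + a = 0" "a + (a + b) = b" "a + c * a + c * (c * a) = 0" for a b :: 'a
    proof -
      show *: "a + a = 0" for a :: 'a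
        using two by (metis distrib_left mult.right_neutral mult_zero_right)
      then show "a + (a + b) = b" by (simp add: add.assoc[symmetric])
      have "a + c * a + c * (c * a) = (1 + c + c * c) * a" by (simp add: algebra_simps)
      then show "a + c * a + c * (c * a) = 0" using c_sum by simp
    qed
    have c2: "c * c = 1 + c"
      using c_sum entry(1)[of "1 + c"] by (metis add_left_cancel)
    have "T * ?T' = 1\<^sub>m n + (1 + c + c * c) \<cdot>\<^sub>m u + (1 + c + c * c) \<cdot>\<^sub>m (u * u)"
      unfolding T_def using uc
      by (simp add: mat_ring_simps u3 u3' ccc)
        (rule eq_matI, auto simp: algebra_simps entry ccc)
    then show "T * ?T' = 1\<^sub>m n"
      unfolding c_sum using uc by (intro eq_matI) auto
  next
    fix v assume v: "v \<in> scaled"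
    note vc = scaled_carrier[OF v]
    obtain a where a: "a ^ 3 = 1" "u * v = a \<cdot>\<^sub>m (v * u)" using scaled_comm[OF uE v] r by auto
    have uv: "u * (v * x) = a \<cdot>\<^sub>m (v * (u * x))" if "x \<in> carrier_mat n n" for x
    proof -
      have "u * (v * x) = (u * v) * x" using uc vc that by (simp add: mat_ring_simps)
      also have "\<dots> = a \<cdot>\<^sub>m (v * (u * x))" unfolding a(2) using uc vc that by (simp add: mat_ring_simps)
      finally show ?thesis .
    qed
    have Tv: "T * v = v + a \<cdot>\<^sub>m (v * u) + (c * (a * a)) \<cdot>\<^sub>m (v * (u * u))"
      unfolding T_def using uc vc by (simp add: mat_ring_simps a(2) uv)
    \<comment> \<open>The cube roots of unity are \<open>1\<close>, \<open>c\<close> and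
      \<open>c * c\<close>; each determines the power of \<open>u\<close> by which \<open>v\<close>
      has to be corrected.\<close>
    have "(a - 1) * ((a - c) * (a - c * c)) =
        a ^ 3 - c * (c * c) - (a * a - a * c) * (1 + c + c * c)"
      by (simp add: algebra_simps power3_eq_cube)
    then have "(a - 1) * ((a - c) * (a - c * c)) = 0"
      unfolding a(1) ccc c_sum by simp
    then consider "a = 1" | "a = c" | "a = c * c" by auto
    then show "\<exists>y\<in>scaled. T * v = y * T"
    proof cases
      case 1
      then have "T * v = v * T"
        unfolding Tv unfolding T_def using uc vc by (simp add: mat_ring_simps)
      then show ?thesis using v by blast
    next
      case 2
      have "T * v = (v * (u * u)) * T"
        unfolding Tv unfolding T_def 2 using uc vc
        by (simp add: mat_ring_simps u3 u3' ccc) (rule eq_matI, auto simp: algebra_simps ccc)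
      moreover have "v * (u * u) \<in> scaled" using scaled_mult v uE by simp
      ultimately show ?thesis by blast
    next
      case 3
      have c5: "c * (c * c * (c * c)) = c * c" using ccc by (metis mult.assoc mult.commute mult_1)
      have "T * v = ((c * c) \<cdot>\<^sub>m (v * u)) * T"
        unfolding Tv unfolding T_def 3 c5 using uc vc
        by (simp add: mat_ring_simps u3 u3' ccc mult.assoc) (rule eq_matI, auto simp: algebra_simps ccc)
      moreover have "(c * c) \<cdot>\<^sub>m (v * u) \<in> scaled"
        using scaled_smult[of "c * c"] scaled_mult v uE ccc by fastforce
      ultimately show ?thesis by blast
    qed
  qed
  ultimately show ?thesis by blast
qed

end

section \<open>Weyl operators\<close>

text \<open>Column \<open>y\<close> has its only nonzero entry in row \<open>y + b\<close>:
  multiplication by the character \<open>c\<close> followed by translation by \<open>b\<close>, that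
  is, a generalized Pauli (clock and shift) matrix.\<close>

definition weyl :: "nat \<Rightarrow> (nat \<Rightarrow> nat \<Rightarrow> nat) \<Rightarrow> (nat \<Rightarrow> nat \<Rightarrow> 'a::field) \<Rightarrow> nat \<Rightarrow> nat \<Rightarrow> 'a mat" where
  "weyl n pl \<chi> b c = mat n n (\<lambda>(x, y). if x = pl y b then \<chi> c y else 0)"

text \<open>A finite abelian group on \<open>{..<n}\<close>, identified with its character group by
  the bicharacter \<open>\<chi>\<close>; \<open>chi_sum\<close> is nondegeneracy. It covers both
  bitwise addition and addition modulo 3.\<close>

locale self_dual_group =
  fixes r n :: nat and pl :: "nat \<Rightarrow> nat \<Rightarrow> nat" and neg :: "nat \<Rightarrow> nat"
    and \<chi> :: "nat \<Rightarrow> nat \<Rightarrow> 'a::{field,finite}"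
  assumes n_nonzero: "of_nat n \<noteq> (0 :: 'a)" and r_pos: "r > 0"
    and add_less: "x < n \<Longrightarrow> y < n \<Longrightarrow> pl x y < n"
    and add_assoc: "x < n \<Longrightarrow> y < n \<Longrightarrow> z < n \<Longrightarrow> pl (pl x y) z = pl x (pl y z)"
    and add_comm: "x < n \<Longrightarrow> y < n \<Longrightarrow> pl x y = pl y x"
    and add_0: "x < n \<Longrightarrow> pl 0 x = x"
    and neg_less: "x < n \<Longrightarrow> neg x < n" and add_neg: "x < n \<Longrightarrow> pl x (neg x) = 0"
    and chi_add: "c < n \<Longrightarrow> x < n \<Longrightarrow> y < n \<Longrightarrow> \<chi> c (pl x y) = \<chi> c x * \<chi> c y"
    and chi_add_left: "c < n \<Longrightarrow> d < n \<Longrightarrow> x < n \<Longrightarrow> \<chi> (pl c d) x = \<chi> c x * \<chi> d x"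
    and chi_pow: "c < n \<Longrightarrow> x < n \<Longrightarrow> \<chi> c x ^ r = 1"
    and chi_sum: "c < n \<Longrightarrow> c \<noteq> 0 \<Longrightarrow> (\<Sum>x<n. \<chi> c x) = 0"
begin

abbreviation "W \<equiv> weyl n pl \<chi>"

lemma n_pos: "n > 0"
  using n_nonzero by (cases n) auto

lemma W_carrier [simp]: "W b c \<in> carrier_mat n n"
  by (simp add: weyl_def)

lemma chi_nonzero: "c < n \<Longrightarrow> x < n \<Longrightarrow> \<chi> c x \<noteq> 0"
  using chi_pow[of c x] r_pos by (auto simp: power_0_left)

lemma chi_0: "x < n \<Longrightarrow> \<chi> 0 x = 1"
  using chi_add_left[of 0 0 x] add_0[of 0] n_pos chi_nonzero[of 0 x] by simp

lemma W_0: "W 0 0 = 1\<^sub>m n"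
  by (rule eq_matI) (auto simp: weyl_def add_comm[OF _ n_pos] add_0 chi_0)

lemma W_mult:
  assumes "b < n" "c < n" "b' < n" "c' < n"
  shows "W b c * W b' c' = \<chi> c b' \<cdot>\<^sub>m W (pl b b') (pl c c')"
proof (rule eq_matI)
  fix x y assume "x < dim_row (\<chi> c b' \<cdot>\<^sub>m W (pl b b') (pl c c'))"
    "y < dim_col (\<chi> c b' \<cdot>\<^sub>m W (pl b b') (pl c c'))"
  then have xy: "x < n" "y < n" by (simp_all add: weyl_def)
  let ?z = "pl y b'"
  have z: "?z < n" using add_less xy assms by simp
  have "(W b c * W b' c') $$ (x, y) =
      (\<Sum>z<n. (if x = pl z b then \<chi> c z else 0) * (if z = ?z then \<chi> c' y else 0))"
    using xy by (simp add: scalar_prod_def atLeast0LessThan weyl_def)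
  also have "\<dots> = (\<Sum>z<n. if z = ?z then (if x = pl z b then \<chi> c z else 0) * \<chi> c' y else 0)"
    by (rule sum.cong) auto
  also have "\<dots> = (if x = pl ?z b then \<chi> c ?z else 0) * \<chi> c' y"
    using z by simp
  also have "pl ?z b = pl y (pl b b')"
    using assms xy by (simp add: add_assoc add_comm[of b b'])
  also have "(if x = pl y (pl b b') then \<chi> c ?z else 0) * \<chi> c' y =
      (\<chi> c b' \<cdot>\<^sub>m W (pl b b') (pl c c')) $$ (x, y)"
    using assms xy by (simp add: weyl_def chi_add chi_add_left)
  finally show "(W b c * W b' c') $$ (x, y) = (\<chi> c b' \<cdot>\<^sub>m W (pl b b') (pl c c')) $$ (x, y)" .
qed (simp_all add: weyl_def)

lemma add_eq_self_iff:
  assumes "b < n" "y < n"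
  shows "y = pl y b \<longleftrightarrow> b = 0"
proof
  assume eq: "y = pl y b"
  have "b = pl (pl (neg y) y) b" using assms by (simp add: add_comm[of "neg y" y] neg_less add_neg add_0)
  also have "\<dots> = pl (neg y) y" using assms eq neg_less add_assoc[of "neg y" y b] by simp
  also have "\<dots> = 0" using assms by (simp add: add_comm[of "neg y" y] neg_less add_neg)
  finally show "b = 0" .
qed (use assms n_pos add_comm[of y 0] add_0 in simp)

text \<open>A translation by \<open>b \<noteq> 0\<close> has no fixed point, so the diagonal
  vanishes; for \<open>b = 0\<close> the trace is a character sum.\<close>

lemma mtrace_W:
  assumes "b < n" "c < n"
  shows "mtrace (W b c) = (if b = 0 \<and> c = 0 then of_nat n else 0)"
proof -
  have "mtrace (W b c) = (\<Sum>y<n. if b = 0 then \<chi> c y else 0)"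
    unfolding mtrace_def by (rule sum.cong) (use assms add_eq_self_iff in \<open>auto simp: weyl_def\<close>)
  then show ?thesis
    using assms chi_sum[of c] by (cases "b = 0"; cases "c = 0") (simp_all add: chi_0)
qed

lemma mtrace_W_mult_neg:
  assumes "b < n" "c < n" "b' < n" "c' < n"
  shows "mtrace (W b c * W (neg b') (neg c')) \<noteq> 0 \<longleftrightarrow> b = b' \<and> c = c'"
proof -
  have add_neg_iff: "pl x (neg y) = 0 \<longleftrightarrow> x = y" if "x < n" "y < n" for x y
  proof
    assume eq: "pl x (neg y) = 0"
    have "x = pl x (pl (neg y) y)"
      using that n_pos by (simp add: add_comm[of "neg y" y] add_comm[of x 0] neg_less add_neg add_0)
    also have "\<dots> = pl (pl x (neg y)) y" using that neg_less by (simp add: add_assoc)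
    also have "\<dots> = y" using that by (simp add: eq add_0)
    finally show "x = y" .
  qed (use that add_neg in simp)
  have "mtrace (W b c * W (neg b') (neg c')) =
      \<chi> c (neg b') * mtrace (W (pl b (neg b')) (pl c (neg c')))"
    using assms neg_less W_mult by (simp add: mtrace_smult[OF W_carrier])
  then show ?thesis
    using assms neg_less add_less n_nonzero chi_nonzero[of c "neg b'"]
    by (auto simp: mtrace_W add_neg_iff)
qed

text \<open>The rescaling to a prescribed \<open>r\<close>-th power depends on the roots available
  in the field and is therefore left to the instances.\<close>

lemma nice_error_basis_weyl:
  assumes scale: "\<And>b c. \<lbrakk>b < n; c < n\<rbrakk> \<Longrightarrow> \<exists>k. k \<noteq> 0 \<and> (k \<cdot>\<^sub>m W b c) ^\<^sub>m r = e \<cdot>\<^sub>m 1\<^sub>m n"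
    and e: "e \<noteq> 0"
  shows "nice_error_basis r n e ((\<lambda>(b, c). W b c) ` ({..<n} \<times> {..<n}))"
proof
  let ?R = "(\<lambda>(b, c). W b c) ` ({..<n} \<times> {..<n})"
  show "of_nat n \<noteq> (0 :: 'a)" "r > 0" "e \<noteq> 0" by (fact n_nonzero r_pos e)+
  show "x \<in> carrier_mat n n" if "x \<in> ?R" for x using that by auto
  show "1\<^sub>m n \<in> ?R" using W_0 n_pos by (intro image_eqI[of _ _ "(0, 0)"]) auto
  have "inj_on (\<lambda>(b, c). W b c) ({..<n} \<times> {..<n})"
  proof (rule inj_onI)
    fix u v assume uv: "u \<in> {..<n} \<times> {..<n}" "v \<in> {..<n} \<times> {..<n}"
      "(\<lambda>(b, c). W b c) u = (\<lambda>(b, c). W b c) v"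
    obtain b c b' c' where bc: "u = (b, c)" "v = (b', c')" by (cases u, cases v) blast
    with uv have *: "b < n" "c < n" "b' < n" "c' < n" "W b c = W b' c'" by auto
    then have "mtrace (W b c * W (neg b') (neg c')) \<noteq> 0"
      using mtrace_W_mult_neg[of b' c' b' c'] by simp
    then show "u = v" using mtrace_W_mult_neg[of b c b' c'] * bc by simp
  qed
  then show "card ?R = n * n" by (simp add: card_image card_cartesian_product)
  show "\<exists>k z. k \<noteq> 0 \<and> z \<in> ?R \<and> x * y = k \<cdot>\<^sub>m z" if xy: "x \<in> ?R" "y \<in> ?R" for x y
  proof -
    obtain b c b' c' where *: "b < n" "c < n" "b' < n" "c' < n" "x = W b c" "y = W b' c'"
      using xy by auto
    then show ?thesis
      using W_mult[of b c b' c'] chi_nonzero[of c b'] add_less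
      by (intro exI[of _ "\<chi> c b'"] exI[of _ "W (pl b b') (pl c c')"]) auto
  qed
  show "\<exists>k. k ^ r = 1 \<and> x * y = k \<cdot>\<^sub>m (y * x)" if xy: "x \<in> ?R" "y \<in> ?R" for x y
  proof -
    obtain b c b' c' where *: "b < n" "c < n" "b' < n" "c' < n" "x = W b c" "y = W b' c'"
      using xy by auto
    \<comment> \<open>Both orders of multiplication produce the same Weyl operator, so the
      commutator is a ratio of two \<open>r\<close>-th roots of unity.\<close>
    have "x * y = (\<chi> c b' / \<chi> c' b) \<cdot>\<^sub>m (y * x)"
      using * W_mult[of b c b' c'] W_mult[of b' c' b c] chi_nonzero[of c' b]
      by (simp add: smult_smult_mat add_comm[of b b'] add_comm[of c c'])
    moreover have "(\<chi> c b' / \<chi> c' b) ^ r = 1" using * by (simp add: power_divide chi_pow)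
    ultimately show ?thesis by blast
  qed
  show "\<exists>z\<in>carrier_mat n n. y * z = 1\<^sub>m n \<and> (\<forall>x\<in>?R - {y}. mtrace (x * z) = 0)" if y: "y \<in> ?R" for y
  proof -
    obtain b c where *: "b < n" "c < n" "y = W b c" using y by auto
    let ?k = "inverse (\<chi> c (neg b))"
    let ?z = "?k \<cdot>\<^sub>m W (neg b) (neg c)"
    have mult_z: "x * ?z = ?k \<cdot>\<^sub>m (x * W (neg b) (neg c))" if "x \<in> carrier_mat n n" for x
      by (rule mult_smult_distrib[OF that W_carrier])
    have "y * ?z = 1\<^sub>m n"
      using * neg_less chi_nonzero[of c "neg b"]
      by (simp add: mult_z W_mult add_neg W_0 smult_smult_mat)
    moreover have "mtrace (x * ?z) = 0" if x: "x \<in> ?R - {y}" for x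
    proof -
      obtain b' c' where x': "b' < n" "c' < n" "x = W b' c'" using x by auto
      then have "\<not> (b' = b \<and> c' = c)" using x * by auto
      then have "mtrace (x * W (neg b) (neg c)) = 0"
        unfolding x'(3) using mtrace_W_mult_neg[OF x'(1,2) *(1,2)] by blast
      moreover have "x * W (neg b) (neg c) \<in> carrier_mat n n"
        unfolding x'(3) by (rule mult_carrier_mat[OF W_carrier W_carrier])
      ultimately show ?thesis using x' by (simp add: mult_z mtrace_smult[of _ n])
    qed
    ultimately show ?thesis by (intro bexI[of _ ?z]) auto
  qed
  show "\<exists>k. k \<noteq> 0 \<and> (k \<cdot>\<^sub>m x) ^\<^sub>m r = e \<cdot>\<^sub>m 1\<^sub>m n" if "x \<in> ?R" for x
    using that scale by auto
qed

end

section \<open>Elementary abelian 2-groups and the cyclic group of order three\<close>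

lemma xor_less_power_two: "x < 2 ^ m \<Longrightarrow> y < 2 ^ m \<Longrightarrow> Bit_Operations.xor x y < (2 ^ m :: nat)"
  by (metis take_bit_nat_eq_self_iff take_bit_xor)

text \<open>The Walsh character: \<open>-1\<close> to the number of common binary digits of
  \<open>c\<close> and \<open>x\<close> among the lowest \<open>m\<close>.\<close>

definition walsh :: "nat \<Rightarrow> nat \<Rightarrow> nat \<Rightarrow> 'a::field" where
  "walsh m c x = (\<Prod>j<m. if bit c j \<and> bit x j then -1 else 1)"

lemma walsh_xor: "walsh m c (Bit_Operations.xor x y) = walsh m c x * walsh m c y"
  unfolding walsh_def prod.distrib[symmetric] by (rule prod.cong) (auto simp: bit_xor_iff)

lemma walsh_sym: "walsh m c x = walsh m x c"
  unfolding walsh_def by (rule prod.cong) auto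

lemma walsh_cases: "walsh m c x = (1 :: 'a::field) \<or> walsh m c x = (-1 :: 'a)"
  unfolding walsh_def by (induction m) auto

lemma self_dual_group_xor:
  assumes two: "(2 :: 'a::{field,finite}) \<noteq> 0"
  shows "self_dual_group 2 (2 ^ m) Bit_Operations.xor (\<lambda>x. x) (walsh m :: nat \<Rightarrow> nat \<Rightarrow> 'a)"
proof
  show "of_nat (2 ^ m) \<noteq> (0 :: 'a)" using two by simp
  show "Bit_Operations.xor x y < 2 ^ m" if "x < 2 ^ m" "y < 2 ^ m" for x y :: nat
    by (rule xor_less_power_two[OF that])
  show "(walsh m c x :: 'a)\<^sup>2 = 1" for c x
    using walsh_cases[of m c x, where 'a = 'a] by auto
  show "walsh m (Bit_Operations.xor c d) x = walsh m c x * (walsh m d x :: 'a)" for c d x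
    by (simp add: walsh_sym[of m _ x] walsh_xor)
  show "(\<Sum>x<2 ^ m. walsh m c x) = (0 :: 'a)" if c: "c < 2 ^ m" "c \<noteq> 0" for c
  proof -
    have "\<exists>j<m. bit c j"
    proof (rule ccontr)
      assume "\<not> (\<exists>j<m. bit c j)"
      then have "take_bit m c = 0" by (auto simp: bit_eq_iff bit_take_bit_iff)
      then show False using c take_bit_nat_eq_self_iff[of m c] by simp
    qed
    then obtain j where j: "j < m" "bit c j" by blast
    let ?f = "\<lambda>x. Bit_Operations.xor x (2 ^ j :: nat)"
    have pj: "(2 ^ j :: nat) < 2 ^ m" using j by simp
    have "walsh m c (2 ^ j) = (\<Prod>i<m. if i = j then -1 else (1 :: 'a))"
      unfolding walsh_def by (rule prod.cong) (use j in \<open>auto simp: bit_exp_iff\<close>)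
    then have "walsh m c (2 ^ j) = (-1 :: 'a)" using j by simp
    then have neg: "walsh m c (?f x) = - (walsh m c x :: 'a)" for x by (simp add: walsh_xor)
    \<comment> \<open>Flipping a digit that is set in \<open>c\<close> permutes the summation range
      and reverses every sign, so the sum equals its negative.\<close>
    have "(\<Sum>x<2 ^ m. walsh m c x) = (\<Sum>x<2 ^ m. walsh m c (?f x) :: 'a)"
      by (rule sum.reindex_bij_witness[of _ ?f ?f])
        (use xor_less_power_two[OF _ pj] in \<open>auto simp: xor.assoc\<close>)
    also have "\<dots> = - (\<Sum>x<2 ^ m. walsh m c x)" by (simp add: neg sum_negf)
    finally have "2 * (\<Sum>x<2 ^ m. walsh m c x) = (0 :: 'a)"
      by (metis add.right_inverse mult_2)
    then show ?thesis using two by simp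
  qed
qed (simp_all add: walsh_xor xor.assoc xor.commute xor.left_commute)

lemma self_dual_group_mod_three:
  fixes \<omega> :: "'a::{field,finite}"
  assumes \<omega>: "\<omega> ^ 3 = 1" "\<omega> \<noteq> 1" and three: "(3 :: 'a) \<noteq> 0"
  shows "self_dual_group 3 3 (\<lambda>x y. (x + y) mod 3) (\<lambda>x. (3 - x) mod 3) (\<lambda>c x. \<omega> ^ (c * x))"
proof
  have pow_mod: "\<omega> ^ (k mod 3) = \<omega> ^ k" for k
  proof -
    have "\<omega> ^ k = \<omega> ^ (3 * (k div 3) + k mod 3)" by simp
    also have "\<dots> = \<omega> ^ (k mod 3)" unfolding power_add power_mult \<omega>(1) by simp
    finally show ?thesis by simp
  qed
  show "of_nat 3 \<noteq> (0 :: 'a)" using three by simp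
  show "\<omega> ^ (c * ((x + y) mod 3)) = \<omega> ^ (c * x) * \<omega> ^ (c * y)" for c x y
    using pow_mod[of "c * ((x + y) mod 3)"] pow_mod[of "c * (x + y)"]
    by (simp add: mod_mult_right_eq distrib_left power_add)
  show "\<omega> ^ (((c + d) mod 3) * x) = \<omega> ^ (c * x) * \<omega> ^ (d * x)" for c d x
    using pow_mod[of "((c + d) mod 3) * x"] pow_mod[of "(c + d) * x"]
    by (simp add: mod_mult_left_eq distrib_right power_add)
  show "(\<omega> ^ (c * x)) ^ 3 = 1" for c x
  proof -
    have "(\<omega> ^ (c * x)) ^ 3 = (\<omega> ^ 3) ^ (c * x)" by (simp flip: power_mult add: mult.commute)
    then show ?thesis by (simp add: \<omega>(1))
  qed
  show "(\<Sum>x<3. \<omega> ^ (c * x)) = 0" if "c < 3" "c \<noteq> 0" for c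
  proof -
    have "(\<omega> - 1) * (1 + \<omega> + \<omega> * \<omega>) = \<omega> ^ 3 - 1" by (simp add: algebra_simps power3_eq_cube)
    then have sum: "1 + \<omega> + \<omega> * \<omega> = 0" using \<omega> by simp
    have "{..<3} = {0, 1, 2 :: nat}" by auto
    then have expand: "(\<Sum>x<3. \<omega> ^ (c * x)) = 1 + \<omega> ^ c + \<omega> ^ (c * 2)" by simp
    have "c = 1 \<or> c = 2" using that by auto
    then show ?thesis
    proof
      assume "c = 1"
      then show ?thesis using sum expand by (simp add: power2_eq_square)
    next
      assume "c = 2"
      \<comment> \<open>For \<open>c = 2\<close> the summands are the same three cube roots of unity
        in another order.\<close>
      moreover have "\<omega> ^ 4 = \<omega>" using pow_mod[of 4] by simp
      ultimately show ?thesis using sum expand by (simp add: power2_eq_square algebra_simps)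
    qed
  qed
qed (auto simp: mod_simps algebra_simps)

section \<open>Base groups\<close>

lemma of_nat_eq_0_iff_prime_dvd:
  assumes "prime p" "CARD('a::{field,finite}) = p ^ f"
  shows "of_nat k = (0 :: 'a) \<longleftrightarrow> p dvd k"
proof -
  have "CHAR('a) dvd p ^ f"
    using CHAR_dvd_CARD[where 'a = 'a] assms(2) by simp
  moreover have pr: "prime CHAR('a)"
    by (rule prime_CHAR_semidom[OF finite_imp_CHAR_pos]) simp
  ultimately have "CHAR('a) dvd p"
    using prime_dvd_power by blast
  then have "CHAR('a) = p"
    using pr assms(1) primes_dvd_imp_eq by blast
  then show ?thesis by (simp add: of_nat_eq_0_iff_char_dvd)
qed

text \<open>All \<open>q - 1\<close> nonzero scalars: an order prime to \<open>p\<close>, hence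
  \<open>k = 0\<close>. The condition \<open>q > 2\<close> makes the group nontrivial.\<close>

lemma base_group_scalars:
  assumes q: "CARD('a::{field,finite}) > 2" and p: "\<not> p dvd CARD('a) - 1"
  shows "base_group TYPE('a) p 1 0"
proof -
  let ?G = "carrier (GL TYPE('a) 1)"
  have G: "?G = (\<lambda>c. c \<cdot>\<^sub>m 1\<^sub>m 1) ` (UNIV - {0})"
  proof (intro equalityI subsetI)
    fix A assume A: "A \<in> ?G"
    then obtain B where B: "A \<in> carrier_mat 1 1" "B \<in> carrier_mat 1 1" "A * B = 1\<^sub>m 1"
      by (auto simp: carrier_GL_iff)
    then have "(A * B) $$ (0, 0) = 1" by simp
    then have "A $$ (0, 0) * B $$ (0, 0) = 1" using B(1,2) by (simp add: scalar_prod_def)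
    then have "A $$ (0, 0) \<noteq> 0" by auto
    moreover have "A = A $$ (0, 0) \<cdot>\<^sub>m 1\<^sub>m 1" using B(1) by (intro eq_matI) auto
    ultimately show "A \<in> (\<lambda>c. c \<cdot>\<^sub>m 1\<^sub>m 1) ` (UNIV - {0})" by blast
  next
    fix A :: "'a mat" assume "A \<in> (\<lambda>c. c \<cdot>\<^sub>m 1\<^sub>m 1) ` (UNIV - {0})"
    then obtain c where c: "c \<noteq> 0" "A = c \<cdot>\<^sub>m 1\<^sub>m 1" by auto
    then have "A * (inverse c \<cdot>\<^sub>m 1\<^sub>m 1) = 1\<^sub>m 1"
      by (simp add: smult_mat_mult[of _ 1])
    then show "A \<in> ?G" unfolding carrier_GL_iff using c by auto
  qed
  have "inj_on (\<lambda>c :: 'a. c \<cdot>\<^sub>m 1\<^sub>m 1) (UNIV - {0})"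
    by (simp add: inj_on_def smult_one_mat_eq_iff)
  then have card: "card ?G = CARD('a) - 1"
    unfolding G by (simp add: card_image card_Diff_singleton)
  have sub: "subgroup ?G (GL TYPE('a) 1)" by (rule group.subgroup_self[OF group_GL])
  have "irreducible_linear_group TYPE('a) 1 ?G"
    unfolding irreducible_linear_group_iff
  proof (intro conjI allI impI)
    fix W :: "'a vec set" assume W: "invariant_subspace ?G 1 W"
    show "W = {0\<^sub>v 1} \<or> W = carrier_vec 1"
    proof (cases "W = {0\<^sub>v 1}")
      case False
      then obtain w where w: "w \<in> W" "w \<noteq> 0\<^sub>v 1" "w \<in> carrier_vec 1"
        using W by (auto simp: invariant_subspace_def)
      have w0: "w $ 0 \<noteq> 0"
      proof
        assume "w $ 0 = 0"
        then have "w = 0\<^sub>v 1" using w(3) by (intro eq_vecI) auto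
        with w(2) show False ..
      qed
      have "v \<in> W" if v: "v \<in> carrier_vec 1" for v
      proof -
        have "v = (v $ 0 / w $ 0) \<cdot>\<^sub>v w" using v w(3) w0 by (intro eq_vecI) auto
        then show ?thesis using W w(1) unfolding invariant_subspace_def by metis
      qed
      then show ?thesis using W by (auto simp: invariant_subspace_def)
    qed simp
  qed (use sub in auto)
  moreover have "?G \<noteq> {1\<^sub>m 1}"
  proof
    assume "?G = {1\<^sub>m 1}"
    then have "card ?G = 1" by simp
    then show False using card q by simp
  qed
  moreover have "p_solvable TYPE('a mat set) p (GL TYPE('a) 1\<lparr>carrier := ?G\<rparr>)"
  proof -
    have "\<not> p dvd Coset.order (GL TYPE('a) 1)" using p card by (simp add: Coset.order_def)
    from p_solvable_coprime[OF group_GL this] show ?thesis by simp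
  qed
  moreover have "multiplicity p (card ?G) = 0"
    unfolding card using p by (rule not_dvd_imp_multiplicity_0)
  ultimately show ?thesis
    unfolding base_group_def by (intro exI[of _ ?G]) simp
qed

section \<open>Two by two matrices: \<open>GL(2, 2)\<close> and the quaternion units\<close>

lemma pow_mat_two: "A \<in> carrier_mat n n \<Longrightarrow> A ^\<^sub>m 2 = (A * A :: 'a::semiring_1 mat)"
  by (simp add: numeral_2_eq_2)

definition mat2 :: "'a \<Rightarrow> 'a \<Rightarrow> 'a \<Rightarrow> 'a \<Rightarrow> 'a mat" where
  "mat2 a b c d = mat 2 2 (\<lambda>(i, j). if i = 0 then if j = 0 then a else b else if j = 0 then c else d)"

lemma mat2_carrier [simp]: "mat2 a b c d \<in> carrier_mat 2 2"
  by (simp add: mat2_def)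

lemma mat2_dim [simp]: "dim_row (mat2 a b c d) = 2" "dim_col (mat2 a b c d) = 2"
  by (simp_all add: mat2_def)

lemma mat2_index [simp]:
  "mat2 a b c d $$ (0, 0) = a" "mat2 a b c d $$ (0, Suc 0) = b"
  "mat2 a b c d $$ (Suc 0, 0) = c" "mat2 a b c d $$ (Suc 0, Suc 0) = d"
  by (simp_all add: mat2_def)

lemma mat2_eq_iff [simp]: "mat2 a b c d = mat2 a' b' c' d' \<longleftrightarrow> a = a' \<and> b = b' \<and> c = c' \<and> d = d'"
  by (metis mat2_index)

lemma mat2_eqI:
  assumes "A \<in> carrier_mat 2 2" "A $$ (0, 0) = a" "A $$ (0, Suc 0) = b"
    "A $$ (Suc 0, 0) = c" "A $$ (Suc 0, Suc 0) = d"
  shows "A = mat2 a b c d"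
  using assms by (intro eq_matI) (auto simp: less_2_cases_iff)

lemma mat2_cases:
  assumes "A \<in> carrier_mat 2 2"
  obtains a b c d where "A = mat2 a b c d"
  using mat2_eqI[OF assms] by blast

lemma mat2_mult:
  "mat2 a b c d * mat2 a' b' c' d' =
    mat2 (a * a' + b * c') (a * b' + b * d') (c * a' + d * c') (c * b' + d * d' :: 'a::comm_ring_1)"
  by (rule mat2_eqI) (auto simp: scalar_prod_def numeral_2_eq_2 intro!: mult_carrier_mat[of _ 2 2])

lemma mat2_smult: "k \<cdot>\<^sub>m mat2 a b c d = mat2 (k * a) (k * b) (k * c) (k * d)"
  by (rule mat2_eqI) auto

lemma mat2_one: "1\<^sub>m 2 = mat2 1 0 0 1"
  by (rule mat2_eqI) auto

lemma mtrace_mat2: "mtrace (mat2 a b c d) = a + d"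
  by (simp add: mtrace_def numeral_2_eq_2 lessThan_Suc add.commute)

lemma mat2_GL_iff: "mat2 a b c d \<in> carrier (GL TYPE('a::field) 2) \<longleftrightarrow> a * d - b * c \<noteq> 0"
proof
  assume "mat2 a b c d \<in> carrier (GL TYPE('a) 2)"
  then obtain B where "B \<in> carrier_mat 2 2" and B: "mat2 a b c d * B = 1\<^sub>m 2"
    by (auto simp: carrier_GL_iff)
  moreover then obtain a' b' c' d' where B': "B = mat2 a' b' c' d'" by (elim mat2_cases)
  ultimately have "a * a' + b * c' = 1" "a * b' + b * d' = 0" "c * a' + d * c' = 0" "c * b' + d * d' = 1"
    by (auto simp: mat2_mult mat2_one)
  \<comment> \<open>Multiplicativity of the determinant, written out.\<close>
  moreover have "(a * d - b * c) * (a' * d' - b' * c') =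
      (a * a' + b * c') * (c * b' + d * d') - (a * b' + b * d') * (c * a' + d * c')"
    by (simp add: algebra_simps)
  ultimately show "a * d - b * c \<noteq> 0" by auto
next
  assume D: "a * d - b * c \<noteq> 0"
  let ?D = "a * d - b * c"
  have "mat2 a b c d * (inverse ?D \<cdot>\<^sub>m mat2 d (- b) (- c) a) = inverse ?D \<cdot>\<^sub>m mat2 ?D 0 0 ?D"
    by (subst mult_smult_distrib[of _ 2 2 _ 2]) (auto simp: mat2_mult algebra_simps)
  also have "\<dots> = 1\<^sub>m 2" using D by (simp add: mat2_smult mat2_one)
  finally show "mat2 a b c d \<in> carrier (GL TYPE('a) 2)"
    unfolding carrier_GL_iff by (metis mat2_carrier smult_carrier_mat)
qed

text \<open>Over the field with two elements the scalars are trivial, so dimension 2 is used. The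
  order 6 gives \<open>k = 1\<close>, which fits \<open>d = 2\<close> with ratio 1.\<close>

lemma base_group_GL2:
  assumes q: "CARD('a::{field,finite}) = 2"
  shows "base_group TYPE('a) 2 2 1"
proof -
  let ?G = "carrier (GL TYPE('a) 2)"
  have "card {0, 1 :: 'a} = CARD('a)" using q by simp
  then have "{0, 1 :: 'a} = UNIV" by (intro card_subset_eq) auto
  then have two: "x = 0 \<or> x = 1" for x :: 'a by blast
  define S :: "('a \<times> 'a \<times> 'a \<times> 'a) set" where "S = {(1, 0, 0, 1), (1, 1, 0, 1), (1, 0, 1, 1), (0, 1, 1, 0), (1, 1, 1, 0), (0, 1, 1, 1 :: 'a)}"
  have G: "?G = (\<lambda>(a, b, c, d). mat2 a b c d) ` S"
  proof (intro equalityI subsetI)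
    fix A assume A: "A \<in> ?G"
    then obtain a b c d where abcd: "A = mat2 a b c d"
      using carrier_GL_carrier_mat mat2_cases by metis
    then have "a * d - b * c \<noteq> 0" using A mat2_GL_iff by metis
    then have "(a, b, c, d) \<in> S"
      using two[of a] two[of b] two[of c] two[of d] by (elim disjE) (simp_all add: S_def)
    then show "A \<in> (\<lambda>(a, b, c, d). mat2 a b c d) ` S" using abcd by force
  qed (auto simp: S_def mat2_GL_iff)
  have "inj (\<lambda>(a, b, c, d). mat2 a b c (d :: 'a))" by (auto simp: inj_def)
  then have "inj_on (\<lambda>(a, b, c, d). mat2 a b c d) S" by (rule inj_on_subset) simp
  moreover have "card S = 6" by (simp add: S_def)
  ultimately have card: "card ?G = 6" unfolding G by (simp add: card_image)
  have sub: "subgroup ?G (GL TYPE('a) 2)" by (rule group.subgroup_self[OF group_GL])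
  have "irreducible_linear_group TYPE('a) 2 ?G"
    unfolding irreducible_linear_group_iff
  proof (intro conjI allI impI)
    fix W :: "'a vec set" assume W: "invariant_subspace ?G 2 W"
    have add: "u \<in> W \<Longrightarrow> v \<in> W \<Longrightarrow> u + v \<in> W" and smult: "v \<in> W \<Longrightarrow> c \<cdot>\<^sub>v v \<in> W"
      and act: "A \<in> ?G \<Longrightarrow> v \<in> W \<Longrightarrow> A *\<^sub>v v \<in> W" for u v c A
      using W by (auto simp: invariant_subspace_def)
    define e where "e a b = vec 2 (\<lambda>i. if i = 0 then a else b)" for a b :: 'a
    have vecE: "v = e (v $ 0) (v $ 1)" if "v \<in> carrier_vec 2" for v
      using that by (intro eq_vecI) (auto simp: e_def less_2_cases_iff)
    have e_add: "e a b + e a' b' = e (a + a') (b + b')" and e_smult: "k \<cdot>\<^sub>v e a b = e (k * a) (k * b)"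
      and e_act: "mat2 a' b' c' d' *\<^sub>v e a b = e (a' * a + b' * b) (c' * a + d' * b)" for a b a' b' c' d' k
      by (auto intro!: eq_vecI simp: e_def less_Suc_eq scalar_prod_def numeral_2_eq_2)
    show "W = {0\<^sub>v 2} \<or> W = carrier_vec 2"
    proof (cases "W = {0\<^sub>v 2}")
      case False
      then obtain w where w: "w \<in> W" "w \<noteq> 0\<^sub>v 2" "w \<in> carrier_vec 2"
        using W by (auto simp: invariant_subspace_def)
      obtain a b where ab: "w = e a b" using vecE[OF w(3)] by blast
      have zero: "e 0 0 = 0\<^sub>v 2" by (intro eq_vecI) (auto simp: e_def)
      have e1: "e 1 0 \<in> W"
      proof (cases "b = 0")
        case True
        then have "a \<noteq> 0" using w(2) ab zero by auto
        then have "inverse a \<cdot>\<^sub>v w = e 1 0" unfolding ab e_smult using True by simp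
        then show ?thesis using smult[OF w(1)] by metis
      next
        case False
        \<comment> \<open>A transvection minus the identity leaves only a multiple of the first
          basis vector.\<close>
        have "mat2 1 1 0 1 *\<^sub>v w + (-1) \<cdot>\<^sub>v w = e b 0" unfolding ab e_act e_smult e_add by simp
        moreover have "mat2 1 1 0 1 *\<^sub>v w + (-1) \<cdot>\<^sub>v w \<in> W"
          by (intro add act smult w(1)) (simp add: mat2_GL_iff)
        ultimately have "inverse b \<cdot>\<^sub>v e b 0 \<in> W" using smult by metis
        then show ?thesis using False by (simp add: e_smult)
      qed
      have "mat2 0 1 1 0 *\<^sub>v e 1 0 \<in> W" by (rule act[OF _ e1]) (simp add: mat2_GL_iff)
      then have e2: "e 0 1 \<in> W" by (simp add: e_act)
      have "v \<in> W" if v: "v \<in> carrier_vec 2" for v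
      proof -
        have "v = (v $ 0) \<cdot>\<^sub>v e 1 0 + (v $ 1) \<cdot>\<^sub>v e 0 1"
          unfolding e_smult e_add using vecE[OF v] by simp
        then show ?thesis using add[OF smult[OF e1] smult[OF e2]] by metis
      qed
      then show ?thesis using W by (auto simp: invariant_subspace_def)
    qed simp
  qed (use sub in auto)
  moreover have "?G \<noteq> {1\<^sub>m 2}"
  proof
    assume "?G = {1\<^sub>m 2}"
    then have "card ?G = 1" by simp
    then show False using card by simp
  qed
  moreover have "p_solvable TYPE('a mat set) 2 (GL TYPE('a) 2\<lparr>carrier := ?G\<rparr>)"
  proof -
    have "Coset.order (GL TYPE('a) 2) = 6" using card by (simp add: Coset.order_def)
    from p_solvable_order_six[OF group_GL this] show ?thesis by simp
  qed
  moreover have "multiplicity 2 (card ?G) = 1"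
    unfolding card by (rule multiplicity_eqI) simp_all
  ultimately show ?thesis
    unfolding base_group_def by (intro exI[of _ ?G]) simp
qed

text \<open>A matrix with rows \<open>(x, y)\<close> and \<open>(y, -x)\<close> has square
  \<open>x * x + y * y\<close>. In characteristic 3 the value \<open>-1\<close> is reached by
  \<open>x = y = 1\<close>, so no square root of \<open>-1\<close> is required.\<close>

lemma quaternion_matrices:
  assumes three: "(3 :: 'a::field) = 0"
  obtains I J K :: "'a::field mat" where
    "I \<in> carrier_mat 2 2" "J \<in> carrier_mat 2 2" "K \<in> carrier_mat 2 2"
    "I * I = (-1) \<cdot>\<^sub>m 1\<^sub>m 2" "J * J = (-1) \<cdot>\<^sub>m 1\<^sub>m 2" "K * K = (-1) \<cdot>\<^sub>m 1\<^sub>m 2"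
    "I * J = K" "J * I = (-1) \<cdot>\<^sub>m K" "J * K = I" "K * J = (-1) \<cdot>\<^sub>m I" "K * I = J" "I * K = (-1) \<cdot>\<^sub>m J"
    "mtrace I = 0" "mtrace J = 0" "mtrace K = 0" "card {1\<^sub>m 2, I, J, K} = 4"
proof -
  have "(1 :: 'a) + 1 - (-1) = 3" by simp
  then have t1: "(1 :: 'a) + 1 = -1"
    using three eq_iff_diff_eq_0 by metis
  have t2: "(-1 :: 'a) - 1 = 1"
    using arg_cong[OF t1, of uminus] by simp
  have ne: "(-1 :: 'a) \<noteq> 1"
    using t1 by (metis add.right_inverse one_neq_zero add_cancel_left_left)
  show ?thesis
    by (rule that[of "mat2 1 1 1 (-1)" "mat2 0 (-1) 1 0" "mat2 1 (-1) (-1) (-1)"])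
      (use ne three in \<open>simp_all add: mat2_mult mat2_smult mat2_one mtrace_mat2 t1 t2 del: one_add_one\<close>)
qed

lemma nice_error_basis_quaternion:
  assumes three: "(3 :: 'a::{field,finite}) = 0"
  shows "\<exists>R. nice_error_basis 2 2 (-1 :: 'a) R"
proof -
  obtain I J K :: "'a mat" where carrier: "I \<in> carrier_mat 2 2" "J \<in> carrier_mat 2 2" "K \<in> carrier_mat 2 2"
    and squares: "I * I = (-1) \<cdot>\<^sub>m 1\<^sub>m 2" "J * J = (-1) \<cdot>\<^sub>m 1\<^sub>m 2" "K * K = (-1) \<cdot>\<^sub>m 1\<^sub>m 2"
    and prods: "I * J = K" "J * I = (-1) \<cdot>\<^sub>m K" "J * K = I" "K * J = (-1) \<cdot>\<^sub>m I" "K * I = J" "I * K = (-1) \<cdot>\<^sub>m J"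
    and tr: "mtrace I = 0" "mtrace J = 0" "mtrace K = 0" and card: "card {1\<^sub>m 2, I, J, K} = 4"
    using quaternion_matrices[OF three] by metis
  let ?R = "{1\<^sub>m 2, I, J, K}"
  note one = right_mult_one_mat[OF carrier(1)] right_mult_one_mat[OF carrier(2)] right_mult_one_mat[OF carrier(3)]
    left_mult_one_mat[OF carrier(1)] left_mult_one_mat[OF carrier(2)] left_mult_one_mat[OF carrier(3)]
  have R: "x \<in> carrier_mat 2 2" if "x \<in> ?R" for x using that carrier by auto
  have "nice_error_basis 2 2 (-1) ?R"
  proof
    have "(2 :: 'a) \<noteq> 0" 
    proof
      assume "(2 :: 'a) = 0"
      moreover have "(3 :: 'a) = 2 + 1" by simp
      ultimately show False using three by simp
    qed
    then show "of_nat 2 \<noteq> (0 :: 'a)" by simp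
    show "x \<in> carrier_mat 2 2" if "x \<in> ?R" for x by (rule R[OF that])
    show "card ?R = 2 * 2" using card by simp
    have pm: "\<exists>c\<in>{1, -1}. \<exists>z\<in>?R. x * y = c \<cdot>\<^sub>m z" if "x \<in> ?R" "y \<in> ?R" for x y
      using that by (elim insertE emptyE) (simp_all add: one squares prods)
    show "\<exists>c z. c \<noteq> 0 \<and> z \<in> ?R \<and> x * y = c \<cdot>\<^sub>m z" if xy: "x \<in> ?R" "y \<in> ?R" for x y
    proof -
      obtain c z where "c \<in> {1, -1}" "z \<in> ?R" "x * y = c \<cdot>\<^sub>m z" using pm[OF xy] by metis
      then show ?thesis by (intro exI[of _ c] exI[of _ z]) auto
    qed
    have comm: "\<exists>c\<in>{1, -1}. x * y = c \<cdot>\<^sub>m (y * x)" if "x \<in> ?R" "y \<in> ?R" for x y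
      using that by (elim insertE emptyE) (simp_all add: one squares prods smult_smult_mat)
    show "\<exists>c. c\<^sup>2 = 1 \<and> x * y = c \<cdot>\<^sub>m (y * x)" if xy: "x \<in> ?R" "y \<in> ?R" for x y
    proof -
      obtain c where "c \<in> {1, -1}" "x * y = c \<cdot>\<^sub>m (y * x)" using comm[OF xy] by metis
      then show ?thesis by (intro exI[of _ c]) auto
    qed
    show "\<exists>z\<in>carrier_mat 2 2. y * z = 1\<^sub>m 2 \<and> (\<forall>x\<in>?R - {y}. mtrace (x * z) = 0)" if y: "y \<in> ?R" for y
    proof -
      \<comment> \<open>Each unit is its own inverse up to sign, so the dual matrix of
        \<open>y\<close> is a multiple of \<open>y\<close>; products of distinct units are multiples
        of \<open>I\<close>, \<open>J\<close> or \<open>K\<close> and have trace 0.\<close>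
      have "\<exists>k. k \<cdot>\<^sub>m (y * y) = 1\<^sub>m 2"
      proof (cases "y = 1\<^sub>m 2")
        case True
        then show ?thesis by (intro exI[of _ 1]) simp
      next
        case False
        then have "y * y = (-1) \<cdot>\<^sub>m 1\<^sub>m 2" using y squares by auto
        then show ?thesis by (intro exI[of _ "-1"]) (simp add: smult_smult_mat)
      qed
      then obtain k where k: "k \<cdot>\<^sub>m (y * y) = 1\<^sub>m 2" by blast
      have distrib: "x * (k \<cdot>\<^sub>m y) = k \<cdot>\<^sub>m (x * y)" if "x \<in> ?R" for x
        by (rule mult_smult_distrib[OF R[OF that] R[OF y]])
      have "mtrace (x * y) = 0" if "x \<in> ?R - {y}" for x
        using that y
        by (elim DiffE insertE emptyE)
          (simp_all add: one prods tr mtrace_smult[OF carrier(1)] mtrace_smult[OF carrier(2)]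
            mtrace_smult[OF carrier(3)])
      then have "mtrace (x * (k \<cdot>\<^sub>m y)) = 0" if "x \<in> ?R - {y}" for x
        using that distrib[of x] mtrace_smult[OF mult_carrier_mat[OF R R[OF y]], of x k] by simp
      then show ?thesis
        using k distrib[OF y] R[OF y] by (intro bexI[of _ "k \<cdot>\<^sub>m y"]) simp_all
    qed
    show "\<exists>c. c \<noteq> 0 \<and> (c \<cdot>\<^sub>m x) ^\<^sub>m 2 = (-1) \<cdot>\<^sub>m 1\<^sub>m 2" if x: "x \<in> ?R" "x \<noteq> 1\<^sub>m 2" for x
    proof -
      have "x * x = (-1) \<cdot>\<^sub>m 1\<^sub>m 2" using x squares by auto
      then show ?thesis using pow_mat_two[OF R[OF x(1)]] by (intro exI[of _ 1]) simp
    qed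
  qed simp_all
  then show ?thesis by blast
qed

text \<open>Cauchy's theorem for the multiplicative group, obtained from a subgroup of order
  \<open>p ^ 1\<close> supplied by Sylow.\<close>

lemma exists_root_of_unity:
  assumes p: "prime p" and dvd: "p dvd CARD('a::{field,finite}) - 1"
  shows "\<exists>x::'a. x ^ p = 1 \<and> x \<noteq> 1"
proof -
  define M :: "'a monoid" where "M = \<lparr>carrier = UNIV - {0}, monoid.mult = (*), one = 1\<rparr>"
  have M: "group M"
  proof (rule groupI)
    show "\<exists>y\<in>carrier M. y \<otimes>\<^bsub>M\<^esub> x = \<one>\<^bsub>M\<^esub>" if "x \<in> carrier M" for x
      using that by (intro bexI[of _ "inverse x"]) (auto simp: M_def)
  qed (auto simp: M_def mult.assoc)
  have ord: "Coset.order M = CARD('a) - 1"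
    by (simp add: M_def Coset.order_def card_Diff_singleton)
  obtain m where "CARD('a) - 1 = p ^ 1 * m" using dvd by (metis dvdE power_one_right)
  then obtain H where H: "subgroup H M" "card H = p ^ 1"
    using sylow_thm[OF p M, of 1 m] ord by (auto simp: M_def)
  then have "card H > 1" using prime_gt_1_nat[OF p] by simp
  then have "H \<noteq> {1}" by auto
  moreover have "1 \<in> H" using subgroup.one_closed[OF H(1)] by (simp add: M_def)
  ultimately obtain x where x: "x \<in> H" "x \<noteq> 1" by blast
  interpret HM: group "M\<lparr>carrier := H\<rparr>" by (rule group.subgroup_imp_group[OF M H(1)])
  have "x [^]\<^bsub>M\<lparr>carrier := H\<rparr>\<^esub> k = x ^ k" for k :: nat
    by (induction k) (simp_all add: M_def mult.commute)
  moreover have "x [^]\<^bsub>M\<lparr>carrier := H\<rparr>\<^esub> Coset.order (M\<lparr>carrier := H\<rparr>) = 1"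
    using HM.pow_order_eq_1[of x] x(1) by (simp add: M_def)
  ultimately show ?thesis using x(2) H(2) by (auto simp: Coset.order_def)
qed

lemma not_dvd_card_minus_one:
  assumes "prime p" "f \<ge> 1" "CARD('a::finite) = p ^ f"
  shows "\<not> p dvd CARD('a) - 1"
proof
  assume "p dvd CARD('a) - 1"
  moreover have "p dvd CARD('a)" using assms by simp
  ultimately have "p dvd 1"
    using dvd_diffD1[of p "CARD('a)" 1] by (simp add: Suc_leI)
  then show False using assms(1) by simp
qed

lemma pow_mat_three: "A \<in> carrier_mat n n \<Longrightarrow> A ^\<^sub>m 3 = (A * A * A :: 'a::semiring_1 mat)"
  by (simp add: numeral_3_eq_3)

text \<open>The exponent 3 is that of 2 in the orbit length \<open>3 * (9 - 1) = 24\<close>. The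
  cube root of unity exists because \<open>4 ^ g - 1\<close> is divisible by 3.\<close>

lemma base_group_three:
  assumes "CARD('a::{field,finite}) = 2 ^ f" "f \<ge> 1" "even f"
  shows "base_group TYPE('a) 2 3 3"
proof -
  have two: "(1 :: 'a) + 1 = 0" and three: "(3 :: 'a) \<noteq> 0"
    using of_nat_eq_0_iff_prime_dvd[OF two_is_prime_nat assms(1), of 2]
      of_nat_eq_0_iff_prime_dvd[OF two_is_prime_nat assms(1), of 3] by simp_all
  have "3 dvd CARD('a) - 1"
  proof -
    obtain g where "f = 2 * g" using assms(3) by (elim evenE)
    then have "CARD('a) = 4 ^ g" using assms(1) by (simp add: power_mult)
    moreover have "[4 ^ g = 1 ^ g] (mod (3 :: nat))" by (intro cong_pow) (simp add: cong_def)
    ultimately show ?thesis using cong_altdef_nat[of 1 "4 ^ g" 3] by (simp add: cong_sym)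
  qed
  then obtain \<omega> :: 'a where \<omega>: "\<omega> ^ 3 = 1" "\<omega> \<noteq> 1"
    using exists_root_of_unity[of 3, where 'a = 'a] by auto
  interpret self_dual_group 3 3 "\<lambda>x y. (x + y) mod 3" "\<lambda>x. (3 - x) mod 3" "\<lambda>c x. \<omega> ^ (c * x)"
    by (rule self_dual_group_mod_three[OF \<omega> three])
  have neb: "nice_error_basis 3 3 1 ((\<lambda>(b, c). W b c) ` ({..<3} \<times> {..<3}))"
  proof (rule nice_error_basis_weyl)
    fix b c :: nat assume bc: "b < 3" "c < 3"
    let ?d = "\<lambda>x. (x + x) mod 3"
    have d: "?d x < 3" "(?d x + x) mod 3 = 0" for x :: nat
    proof -
      have "(?d x + x) mod 3 = (x + x + x) mod 3" by (rule mod_add_left_eq)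
      also have "x + x + x = 3 * x" by simp
      finally show "(?d x + x) mod 3 = 0" by simp
    qed simp
    \<comment> \<open>The cube picks up the character values of \<open>c\<close> and
      \<open>2 * c\<close> at \<open>b\<close>, whose product is 1. So every Weyl operator has cube
      1 without rescaling.\<close>
    have "W b c * W b c * W b c = (\<omega> ^ (c * b) * \<omega> ^ (?d c * b)) \<cdot>\<^sub>m W 0 0"
      unfolding W_mult[OF bc bc] mult_smult_assoc_mat[OF W_carrier W_carrier]
        W_mult[OF d(1) d(1) bc] d(2) smult_smult_mat ..
    also have "\<omega> ^ (c * b) * \<omega> ^ (?d c * b) = 1"
    proof -
      have "\<omega> ^ (c * b) * \<omega> ^ (?d c * b) = \<omega> ^ ((c + ?d c) mod 3 * b)"
        by (rule chi_add_left[OF bc(2) d(1) bc(1), symmetric])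
      also have "(c + ?d c) mod 3 = 0" using d(2)[of c] by (simp only: add.commute)
      finally show ?thesis by simp
    qed
    finally have "W b c ^\<^sub>m 3 = 1\<^sub>m 3"
      unfolding pow_mat_three[OF W_carrier] W_0 one_smult_mat .
    then show "\<exists>k. k \<noteq> 0 \<and> (k \<cdot>\<^sub>m W b c) ^\<^sub>m 3 = 1 \<cdot>\<^sub>m 1\<^sub>m 3"
      by (intro exI[of _ 1]) simp
  qed simp
  interpret N: nice_error_basis 3 3 1 "(\<lambda>(b, c). W b c) ` ({..<3} \<times> {..<3})" by (rule neb)
  have "c = 1 \<or> c = \<omega> \<or> c = \<omega> * \<omega>" if "c ^ 3 = 1" for c
  proof -
    have fac: "(x - 1) * (1 + x + x * x) = x ^ 3 - 1" for x :: 'a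
      by (simp add: algebra_simps power3_eq_cube)
    have sum: "1 + \<omega> + \<omega> * \<omega> = 0" using fac[of \<omega>] \<omega> by simp
    have "(c - 1) * ((c - \<omega>) * (c - \<omega> * \<omega>)) =
        c ^ 3 - \<omega> ^ 3 - (c * c - c * \<omega>) * (1 + \<omega> + \<omega> * \<omega>)"
      by (simp add: algebra_simps power3_eq_cube)
    then have "(c - 1) * ((c - \<omega>) * (c - \<omega> * \<omega>)) = 0" unfolding that \<omega>(1) sum by simp
    then show ?thesis by auto
  qed
  moreover have "(\<omega> * \<omega>) ^ 3 = 1" using \<omega>(1) by (simp add: power_mult_distrib)
  ultimately have "{c :: 'a. c ^ 3 = 1} = {1, \<omega>, \<omega> * \<omega>}" using \<omega>(1) by auto
  moreover have "\<omega> * \<omega> \<noteq> 1" "\<omega> * \<omega> \<noteq> \<omega>"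
    using \<omega> by (auto simp: power3_eq_cube)
  ultimately have unity: "card {c :: 'a. c ^ 3 = 1} = 3" using \<omega>(2) by simp
  show ?thesis
  proof (rule N.base_group_nice_error_basis[OF _ unity])
    show "\<exists>T\<in>N.scaled_normalizer. T * s = t * T"
      if "s \<in> N.roots" "t \<in> N.roots" "s * t \<noteq> t * s" for s t
      by (rule N.roots_conjugate_order_three[OF refl refl two that])
    show "\<not> 2 dvd CARD('a) - 1"
      by (rule not_dvd_card_minus_one[OF two_is_prime_nat assms(2,1)])
  qed simp_all
qed

text \<open>The square of a Weyl operator is 1 or \<open>-1\<close>; to reach \<open>-1\<close> it
  is scaled by \<open>i\<close> in the first case and by 1 in the second.\<close>

lemma nice_error_basis_sqrt_minus_one:
  fixes i :: "'a::{field,finite}"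
  assumes two: "(2 :: 'a) \<noteq> 0" and i: "i * i = -1"
  shows "\<exists>R. nice_error_basis 2 (2 ^ m) (-1 :: 'a) R"
proof -
  interpret self_dual_group 2 "2 ^ m" Bit_Operations.xor "\<lambda>x. x" "walsh m :: nat \<Rightarrow> nat \<Rightarrow> 'a"
    by (rule self_dual_group_xor[OF two])
  have "\<exists>k. k \<noteq> 0 \<and> (k \<cdot>\<^sub>m W b c) ^\<^sub>m 2 = (-1) \<cdot>\<^sub>m 1\<^sub>m (2 ^ m)" if bc: "b < 2 ^ m" "c < 2 ^ m" for b c
  proof -
    have "W b c * W b c = walsh m c b \<cdot>\<^sub>m 1\<^sub>m (2 ^ m)"
      unfolding W_mult[OF bc bc] by (simp add: W_0)
    then have sq: "(k \<cdot>\<^sub>m W b c) ^\<^sub>m 2 = (k * k * walsh m c b) \<cdot>\<^sub>m 1\<^sub>m (2 ^ m)" for k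
      unfolding pow_smult_mat[OF W_carrier] pow_mat_two[OF W_carrier]
      by (simp add: smult_smult_mat power2_eq_square)
    from walsh_cases[of m c b, where 'a = 'a] show ?thesis
    proof
      assume "walsh m c b = (1 :: 'a)"
      moreover have "i \<noteq> 0" using i by auto
      ultimately show ?thesis by (intro exI[of _ i]) (simp add: sq i)
    next
      assume "walsh m c b = (-1 :: 'a)"
      then show ?thesis using sq[of 1] by (intro exI[of _ 1]) simp
    qed
  qed
  then show ?thesis using nice_error_basis_weyl[of "-1"] by auto
qed

lemma base_group_fermat:
  assumes fp: "fermat_prime p" and f: "f \<ge> 1" and card: "CARD('a::{field,finite}) = p ^ f"
  shows "base_group TYPE('a) p (p - 1) 1"
proof -
  obtain k where p: "prime p" and k: "p = 2 ^ (2 ^ k) + 1"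
    using fp by (auto simp: fermat_prime_def)
  note char = of_nat_eq_0_iff_prime_dvd[OF p card]
  have p3: "p \<ge> 3"
  proof -
    have "(2 :: nat) ^ 1 \<le> 2 ^ (2 ^ k)" by (intro power_increasing) auto
    then show ?thesis using k by simp
  qed
  have two: "(2 :: 'a) \<noteq> 0"
    using char[of 2] p3 by (auto dest: dvd_imp_le)
  have minus1: "of_nat (p - 1) = (-1 :: 'a)"
  proof -
    have "of_nat (p - 1) + 1 = (of_nat p :: 'a)" using k by simp
    then show ?thesis using char[of p] by (simp add: eq_neg_iff_add_eq_0)
  qed
  have "\<exists>R. nice_error_basis 2 (p - 1) (-1 :: 'a) R"
  proof (cases k)
    case 0
    then have "p = 3" using k by simp
    \<comment> \<open>For \<open>p = 3\<close> the exponent \<open>2 ^ k\<close> is 1 and cannot be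
      halved to produce a square root of \<open>-1\<close>; the quaternion units take over.\<close>
    then have "(3 :: 'a) = 0" using char[of 3] by simp
    then show ?thesis using nice_error_basis_quaternion \<open>p = 3\<close> by auto
  next
    case (Suc j)
    \<comment> \<open>Its square is \<open>2 ^ (2 ^ k) = p - 1\<close>, which is \<open>-1\<close>
      in characteristic \<open>p\<close>.\<close>
    define i :: 'a where "i = 2 ^ (2 ^ j)"
    have "i * i = of_nat (p - 1)"
      unfolding i_def k Suc by (simp flip: power_add mult_2)
    then have "i * i = -1" using minus1 by simp
    then show ?thesis
      using nice_error_basis_sqrt_minus_one[OF two, of i "2 ^ k"] k by simp
  qed
  then obtain R where "nice_error_basis 2 (p - 1) (-1 :: 'a) R" by blast
  then interpret N: nice_error_basis 2 "p - 1" "-1 :: 'a" R .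
  have "{c :: 'a. c\<^sup>2 = 1} = {1, -1}" by (auto simp: power2_eq_1_iff)
  moreover have "(1 :: 'a) \<noteq> -1" using two by (metis add.right_inverse one_add_one)
  ultimately have unity: "card {c :: 'a. c\<^sup>2 = 1} = 2" by simp
  show ?thesis
  proof (rule N.base_group_nice_error_basis[OF _ unity])
    show "\<exists>T\<in>N.scaled_normalizer. T * s = t * T"
      if "s \<in> N.roots" "t \<in> N.roots" "s * t \<noteq> t * s" for s t
      by (rule N.roots_conjugate_order_two[OF refl refl two that])
    show "prime p" by (rule p)
    show "\<not> p dvd CARD('a) - 1" by (rule not_dvd_card_minus_one[OF p f card])
    show "\<not> p dvd p - 1" using p3 by (auto dest: dvd_imp_le)
    obtain s where s: "p = s + 2" using p3 by (metis add.commute le_Suc_ex nat_le_linear numeral_le_iff order_trans semiring_norm(69,72))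
    \<comment> \<open>The factorization \<open>(p - 1) * (p - 1) - 1 = p * (p - 2)\<close> puts
      \<open>p\<close> into the orbit length.\<close>
    then have "(p - 1) * (p - 1) - 1 = p * s" by simp
    then show "p ^ 1 dvd 2 * ((p - 1) * (p - 1) - 1)" by simp
  qed (use p3 in auto)
qed

section \<open>Iterated wreath products and the infinite set of dimensions\<close>

lemma base_group_iterated_wreath:
  assumes base: "base_group TYPE('a::{field,finite}) p d k" and p: "prime p"
  shows "\<exists>l. base_group TYPE('a) p (p ^ n * d) l \<and> (p - 1) * l + 1 = p ^ n * ((p - 1) * k + 1)"
proof (induction n)
  case 0
  show ?case using base by auto
next
  case (Suc n)
  then obtain l where l: "base_group TYPE('a) p (p ^ n * d) l"
      "(p - 1) * l + 1 = p ^ n * ((p - 1) * k + 1)" by blast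
  \<comment> \<open>The quantity \<open>(p - 1) * l + 1\<close> is multiplied by \<open>p\<close>,
    exactly like the dimension.\<close>
  have "(p - 1) * (p * l + 1) + 1 = p * ((p - 1) * l + 1)"
    using prime_gt_0_nat[OF p] by (cases p) (simp_all add: algebra_simps)
  also have "\<dots> = p ^ Suc n * ((p - 1) * k + 1)" unfolding l(2) by (simp only: power_Suc mult.assoc)
  finally show ?case
    using base_group_wreath[OF l(1) p] by (auto simp: mult.assoc)
qed

theorem mainTheorem2:
  fixes p f q :: nat
  assumes "prime p" and "f \<ge> 1" and "q = p ^ f"
    and "CARD('a::{field,finite}) = q"
  shows "infinite {d::nat. d > 0 \<and>
    (\<exists>G. irreducible_linear_group TYPE('a) d G \<and>
         real (num_comp_factors p ((GL TYPE('a) d)\<lparr>carrier := G\<rparr>))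
           = (eps p f * real d - 1) / (real p - 1))}"
proof -
  note p = assms(1) and f = assms(2)
  have card: "CARD('a) = p ^ f" using assms(3,4) by simp
  have p2: "p \<ge> 2" by (rule prime_ge_2_nat[OF p])
  \<comment> \<open>The required formula for a single group, cleared of its denominator. The cases
    give \<open>4 / 3 * 3 = 3 + 1\<close>, \<open>p = (p - 1) + 1\<close>, \<open>2 = 1 + 1\<close>
    and \<open>1 = 0 + 1\<close>.\<close>
  obtain d k where base: "base_group TYPE('a) p d k" and dk: "eps p f * real d = (real p - 1) * real k + 1"
  proof (cases "p = 2 \<and> even f")
    case True
    then have "base_group TYPE('a) p 3 3" using base_group_three[of f, where 'a = 'a] card f by simp
    then show ?thesis using that[of 3 3] True by (simp add: eps_def)
  next
    case not_four: False
    show ?thesis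
    proof (cases "fermat_prime p")
      case True
      have "base_group TYPE('a) p (p - 1) 1" by (rule base_group_fermat[OF True f card])
      then show ?thesis
        using that[of "p - 1" 1] True not_four p2 by (simp add: eps_def of_nat_diff)
    next
      case False
      have eps: "eps p f = 1" unfolding eps_def using not_four False by simp
      show ?thesis
      proof (cases "CARD('a) = 2")
        case True
        have "p dvd CARD('a)" unfolding card using f by simp
        then have "p \<le> 2" unfolding True by (rule dvd_imp_le) simp
        then have "p = 2" using p2 by simp
        then show ?thesis
          using that[of 2 1] base_group_GL2[OF True] eps by simp
      next
        case False
        have "p ^ 1 \<le> p ^ f" using f p2 by (intro power_increasing) auto
        then have "CARD('a) > 2" using False card p2 by simp
        then show ?thesis
          using that[OF base_group_scalars[OF _ not_dvd_card_minus_one[OF p f card]]] eps by simp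
      qed
    qed
  qed
  have d: "d > 0" using num_comp_factors_base_group[OF base p] by blast
  have "p ^ n * d \<in> {d::nat. d > 0 \<and>
    (\<exists>G. irreducible_linear_group TYPE('a) d G \<and>
         real (num_comp_factors p ((GL TYPE('a) d)\<lparr>carrier := G\<rparr>))
           = (eps p f * real d - 1) / (real p - 1))}" for n
  proof -
    obtain l where l: "base_group TYPE('a) p (p ^ n * d) l" "(p - 1) * l + 1 = p ^ n * ((p - 1) * k + 1)"
      using base_group_iterated_wreath[OF base p] by blast
    have "real (p - 1) = real p - 1" using p2 by simp
    moreover have "real ((p - 1) * l + 1) = real (p ^ n * ((p - 1) * k + 1))" unfolding l(2) ..
    ultimately have "(real p - 1) * real l + 1 = real p ^ n * (eps p f * real d)"
      unfolding dk by (simp only: of_nat_add of_nat_mult of_nat_power of_nat_1)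
    then have "real l = (eps p f * real (p ^ n * d) - 1) / (real p - 1)"
      using p2 by (simp add: field_simps)
    then show ?thesis
      using num_comp_factors_base_group[OF l(1) p] by auto
  qed
  then have "range (\<lambda>n. p ^ n * d) \<subseteq> {d::nat. d > 0 \<and>
    (\<exists>G. irreducible_linear_group TYPE('a) d G \<and>
         real (num_comp_factors p ((GL TYPE('a) d)\<lparr>carrier := G\<rparr>))
           = (eps p f * real d - 1) / (real p - 1))}" by blast
  \<comment> \<open>As \<open>d > 0\<close> and \<open>p \<ge> 2\<close>, the dimensions
    \<open>p ^ n * d\<close> are pairwise distinct.\<close>
  moreover have "inj (\<lambda>n. p ^ n * d)"
    using d p2 by (auto simp: inj_on_def)
  then have "infinite (range (\<lambda>n. p ^ n * d))"
    by (simp add: finite_image_iff)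
  ultimately show ?thesis using finite_subset by blast
qed

end
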